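(* Assume that the arrangement $\mathcal{A}$ is simple and that the direction $\hat{\mathbf r}$ is generic. Let $\mathcal{T}=\{\mathbf z\in\mathbb{C}^d : |z_1|=\cdots=|z_d|=\varepsilon\}$, with $\varepsilon>0$ sufficiently small, be the product of positively oriented circles (the domain of integration in the Cauchy integral $a_{\mathbf r}=(2\pi i)^{-d}\int_{\mathcal T}F(\mathbf z)\,\mathbf z^{-\mathbf r-\mathbf 1}\,d\mathbf z$). Then $$[\mathcal{T}] = \sum_{\boldsymbol\sigma\in \mathrm{contrib}} \boldsymbol\tau_{\boldsymbol\sigma}\qquad\text{in } H_d(\mathcal M,-\infty).$$
   Context: Arrangement. Let $\ell_j(\mathbf z)=1-\sum_{i=1}^d b^{(j)}_i z_i$, $1\le j\le m$, be pairwise distinct, with $\mathbf b^{(j)}\in\mathbb R^d\setminus\{0\}$, and let $F=G/\prod_j \ell_j^{p_j}$ with $p_j\geq 1$ integers and $G$ entire, not identically zero on the zero set of any $\ell_j$. For nonempty $S\subseteq\{1,\dots,m\}$ let $\mathcal V_S=\{\mathbf z\in\mathbb C^d:\ell_k(\mathbf z)=0\ \forall k\in S\}$; the nonempty $\mathcal V_S$ are the flats. $\mathcal V=\bigcup_j\mathcal V_{\{j\}}$, and $\mathcal A$ denotes the hyperplane arrangement. $\mathcal A$ is simple if for every $S$ with $\mathcal V_S\neq\emptyset$ the vectors $(\mathbf b^{(k)})_{k\in S}$ are linearly independent. For $\boldsymbol\sigma\in\mathcal V$ put $S(\boldsymbol\sigma)=\{j:\ell_j(\boldsymbol\sigma)=0\}$.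 Height and critical points. $\mathbb C_*=\mathbb C\setminus\{0\}$, $\mathbb R_*=\mathbb R\setminus\{0\}$. Fix $\hat{\mathbf r}\in\mathbb R_{>0}^d$ with $\hat r_1+\dots+\hat r_d=1$ and let $h(\mathbf z)=-\sum_j\hat r_j\log|z_j|$ on $\mathbb C_*^d$. A critical point of a flat $\mathcal V_S$ is a point of $\mathcal V_S\cap\mathbb C_*^d$ at which the differential of $h|_{\mathcal V_S\cap\mathbb C_*^d}$ vanishes (the single point of a zero-dimensional flat, if in $\mathbb C_*^d$, is critical). All critical points are in $\mathbb R^d$. $\Omega$ is the finite set of all critical points of all flats. $\hat{\mathbf r}$ is generic if no point is a critical point of two distinct flats. Contributing points. $N(\boldsymbol\sigma)=\{\sum_{j\in S(\boldsymbol\sigma)}a_j\mathbf b^{(j)}:a_j>0\}$. The set $\mathrm{contrib}\subseteq\Omega$ consists of the $\boldsymbol\sigma$ with $-(\nabla h)(\boldsymbol\sigma)=(\hat r_1/\sigma_1,\dots,\hat r_d/\sigma_d)\in N(\boldsymbol\sigma)$. Topology. $\mathcal M=\mathbb C_*^d\setminus\mathcal V$, $\mathcal M_{\le a}=\{\mathbf z\in\mathcal M:h(\mathbf z)\le a\}$, $h_{\min}=\min_{\Omega}h$. For $a<h_{\min}$ the groups $H_d(\mathcal M,\mathcal M_{\le a};\mathbb Z)$ are naturally isomorphic and denoted $H_d(\mathcal M,-\infty)$. An oriented closed (possibly non-compact) $d$-chain in $\mathcal M$ without boundary whose part in $\{h\ge a\}$ is compact for each $a$ defines a class there. Fibers and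 linking tori. $\mathcal M_{\mathbb R}=\mathbb R_*^d\setminus\mathcal V$. For $\mathbf x\in\mathcal M_{\mathbb R}$ the imaginary fiber is $\mathcal C_{\mathbf x}=\mathbf x+i\mathbb R^d$, with the standard orientation of $\mathbb R^d$; its class depends only on the connected component $B$ of $\mathcal M_{\mathbb R}$ containing $\mathbf x$ and is denoted $\mathcal C_B$. For a component $B$ and any $\mathbf x\in B$ let $\operatorname{sgn}(B)=\operatorname{sgn}(x_1\cdots x_d)$, and for $\boldsymbol\sigma\in\Omega\cap\overline B$ let $\operatorname{sgn}_{\boldsymbol\sigma}(B)=\operatorname{sgn}\prod_{k\in S(\boldsymbol\sigma)}\ell_k(\mathbf x)$. The linking torus is $\boldsymbol\tau_{\boldsymbol\sigma}=\sum_{B:\,\boldsymbol\sigma\in\overline B}\operatorname{sgn}(B)\operatorname{sgn}_{\boldsymbol\sigma}(B)\,\mathcal C_B$. *)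

theory Defs
  imports "HOL-Homology.Homology" "HOL-Combinatorics.Permutations"
begin

text \<open>
  An arrangement is given by vectors \<open>b 1, \<dots>, b m\<close> in \<open>real ^ 'd\<close>. The linear order on the
  index type \<open>'d\<close> serves only to fix orientations: it orders the coordinates of \<open>\<real>\<^sup>d\<close>.
\<close>

definition ell :: "real ^ 'd \<Rightarrow> complex ^ 'd \<Rightarrow> complex" where
  "ell v z = 1 - (\<Sum>i\<in>UNIV. of_real (v $ i) * z $ i)"

definition cvec :: "real ^ 'd \<Rightarrow> complex ^ 'd" where
  "cvec x = (\<chi> i. complex_of_real (x $ i))"

definition cstar :: "(complex ^ 'd) set" where
  "cstar = {z. \<forall>i. z $ i \<noteq> 0}"

text \<open>Entire functions of several variables: the real Frechet derivative exists everywhere and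
  is complex linear.\<close>

definition entire :: "(complex ^ 'd \<Rightarrow> complex) \<Rightarrow> bool" where
  "entire G \<longleftrightarrow> (\<forall>z. \<exists>D. (G has_derivative D) (at z) \<and> (\<forall>c v. D (c *s v) = c * D v))"

definition flat :: "(nat \<Rightarrow> real ^ 'd) \<Rightarrow> nat set \<Rightarrow> (complex ^ 'd) set" where
  "flat b S = {z. \<forall>k\<in>S. ell (b k) z = 0}"

definition simple_arrangement :: "nat \<Rightarrow> (nat \<Rightarrow> real ^ 'd) \<Rightarrow> bool" where
  "simple_arrangement m b \<longleftrightarrow>
     (\<forall>S. S \<subseteq> {1..m} \<and> S \<noteq> {} \<and> flat b S \<noteq> {} \<longrightarrow> inj_on b S \<and> independent (b ` S))"

definition incident :: "nat \<Rightarrow> (nat \<Rightarrow> real ^ 'd) \<Rightarrow> complex ^ 'd \<Rightarrow> nat set" where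
  "incident m b \<sigma> = {j \<in> {1..m}. ell (b j) \<sigma> = 0}"

definition height :: "real ^ 'd \<Rightarrow> complex ^ 'd \<Rightarrow> real" where
  "height r z = - (\<Sum>i\<in>UNIV. r $ i * ln (cmod (z $ i)))"

text \<open>The derivative within the affine space \<open>flat b S\<close> is the differential of the restricted
  function. For a zero-dimensional flat, \<^term>\<open>at \<sigma> within {\<sigma>}\<close> is the trivial filter and the
  condition holds automatically, as required.\<close>

definition critical_point ::
  "(nat \<Rightarrow> real ^ 'd) \<Rightarrow> real ^ 'd \<Rightarrow> nat set \<Rightarrow> complex ^ 'd \<Rightarrow> bool" where
  "critical_point b r S \<sigma> \<longleftrightarrow>
     \<sigma> \<in> flat b S \<inter> cstar \<and>
     (height r has_derivative (\<lambda>_. 0)) (at \<sigma> within flat b S \<inter> cstar)"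

definition Omega :: "nat \<Rightarrow> (nat \<Rightarrow> real ^ 'd) \<Rightarrow> real ^ 'd \<Rightarrow> (complex ^ 'd) set" where
  "Omega m b r = {\<sigma>. \<exists>S. S \<subseteq> {1..m} \<and> S \<noteq> {} \<and> critical_point b r S \<sigma>}"

text \<open>Flats are compared as sets: different index sets may define the same flat.\<close>

definition generic_direction :: "nat \<Rightarrow> (nat \<Rightarrow> real ^ 'd) \<Rightarrow> real ^ 'd \<Rightarrow> bool" where
  "generic_direction m b r \<longleftrightarrow>
     \<not> (\<exists>\<sigma> S T. S \<subseteq> {1..m} \<and> S \<noteq> {} \<and> T \<subseteq> {1..m} \<and> T \<noteq> {} \<and> flat b S \<noteq> flat b T \<and>
         critical_point b r S \<sigma> \<and> critical_point b r T \<sigma>)"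

definition normal_cone :: "nat \<Rightarrow> (nat \<Rightarrow> real ^ 'd) \<Rightarrow> complex ^ 'd \<Rightarrow> (real ^ 'd) set" where
  "normal_cone m b \<sigma> =
     {\<Sum>j\<in>incident m b \<sigma>. a j *\<^sub>R b j | a. \<forall>j\<in>incident m b \<sigma>. (0::real) < a j}"

text \<open>The vector \<open>(r\<^sub>i / \<sigma>\<^sub>i)\<^sub>i\<close> is \<open>- (\<nabla>h)(\<sigma>)\<close>; it is real because all critical points are.\<close>

definition contrib :: "nat \<Rightarrow> (nat \<Rightarrow> real ^ 'd) \<Rightarrow> real ^ 'd \<Rightarrow> (complex ^ 'd) set" where
  "contrib m b r =
     {\<sigma> \<in> Omega m b r. (\<chi> i. complex_of_real (r $ i) / \<sigma> $ i) \<in> cvec ` normal_cone m b \<sigma>}"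

definition mfd :: "nat \<Rightarrow> (nat \<Rightarrow> real ^ 'd) \<Rightarrow> (complex ^ 'd) set" where
  "mfd m b = cstar - (\<Union>j\<in>{1..m}. flat b {j})"

definition mfd_le :: "nat \<Rightarrow> (nat \<Rightarrow> real ^ 'd) \<Rightarrow> real ^ 'd \<Rightarrow> real \<Rightarrow> (complex ^ 'd) set" where
  "mfd_le m b r a = {z \<in> mfd m b. height r z \<le> a}"

definition mfd_real :: "nat \<Rightarrow> (nat \<Rightarrow> real ^ 'd) \<Rightarrow> (real ^ 'd) set" where
  "mfd_real m b = {x. cvec x \<in> mfd m b}"

text \<open>
  \<open>H\<^sub>d(\<M>, \<M>\<^bsub>\<le>a\<^esub>; \<int>)\<close>. The group \<open>H\<^sub>d(\<M>, -\<infinity>)\<close> is represented by these groups for all \<open>a\<close> below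
  every critical value. Groups of the homology library are written multiplicatively, so sums of
  classes are \<^const>\<open>finprod\<close> and integer multiples are powers.
\<close>

definition hgroup ::
  "nat \<Rightarrow> (nat \<Rightarrow> real ^ 'd::finite) \<Rightarrow> real ^ 'd \<Rightarrow> real \<Rightarrow> (complex ^ 'd) chain set monoid" where
  "hgroup m b r a =
     relative_homology_group (int CARD('d)) (top_of_set (mfd m b)) (mfd_le m b r a)"

definition hclass ::
  "nat \<Rightarrow> (nat \<Rightarrow> real ^ 'd::finite) \<Rightarrow> real ^ 'd \<Rightarrow> real \<Rightarrow> (complex ^ 'd) chain
     \<Rightarrow> (complex ^ 'd) chain set" where
  "hclass m b r a c = homologous_rel_set CARD('d) (top_of_set (mfd m b)) (mfd_le m b r a) c"

definition below_critical :: "nat \<Rightarrow> (nat \<Rightarrow> real ^ 'd) \<Rightarrow> real ^ 'd \<Rightarrow> real \<Rightarrow> bool" where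
  "below_critical m b r a \<longleftrightarrow> (\<forall>\<sigma>\<in>Omega m b r. a < height r \<sigma>)"

text \<open>
  The cube \<open>[0,1]\<^sup>n\<close> with its standard orientation as a singular chain: for each permutation \<open>\<pi>\<close>
  the simplex with vertices \<open>0, e\<^bsub>\<pi> 0\<^esub>, e\<^bsub>\<pi> 0\<^esub> + e\<^bsub>\<pi> 1\<^esub>, \<dots>\<close>, counted with the sign of \<open>\<pi>\<close>.
\<close>

definition cube_chain :: "nat \<Rightarrow> (nat \<Rightarrow> real) chain" where
  "cube_chain n = (\<Sum>\<pi> | \<pi> permutes {..<n}.
     frag_cmul (sign \<pi>)
       (frag_of (oriented_simplex n (\<lambda>j i. if i \<in> \<pi> ` {..<j} then 1 else 0))))"

definition coord :: "(nat \<Rightarrow> real) \<Rightarrow> 'd::{finite,linorder} \<Rightarrow> real" where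
  "coord t k = t (card {..<k})"

text \<open>The product of positively oriented circles of radius \<open>\<epsilon>\<close>. This chain is a cycle, because
  opposite faces of the cube have the same image.\<close>

definition torus_chain :: "real \<Rightarrow> (complex ^ 'd::{finite,linorder}) chain" where
  "torus_chain \<epsilon> =
     chain_map CARD('d) (\<lambda>t. \<chi> k. of_real \<epsilon> * cis (2 * pi * coord t k)) (cube_chain CARD('d))"

text \<open>The part \<open>x + i [-R,R]\<^sup>d\<close> of the imaginary fiber over \<open>x\<close>.\<close>

definition fiber_chain :: "real ^ 'd::{finite,linorder} \<Rightarrow> real \<Rightarrow> (complex ^ 'd::{finite,linorder}) chain" where
  "fiber_chain x R =
     chain_map CARD('d) (\<lambda>t. \<chi> k. Complex (x $ k) (R * (2 * coord t k - 1))) (cube_chain CARD('d))"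

text \<open>For large \<open>R\<close> the part of \<open>x + i \<real>\<^sup>d\<close> outside \<open>x + i (-R,R)\<^sup>d\<close> lies in \<open>\<M>\<^bsub>\<le>a\<^esub>\<close>, so the class
  of the truncated fiber is eventually constant in \<open>R\<close>; this constant is the class of the fiber.\<close>

definition fiber_class ::
  "nat \<Rightarrow> (nat \<Rightarrow> real ^ 'd::{finite,linorder}) \<Rightarrow> real ^ 'd::{finite,linorder} \<Rightarrow> real \<Rightarrow> real ^ 'd::{finite,linorder}
     \<Rightarrow> (complex ^ 'd::{finite,linorder}) chain set" where
  "fiber_class m b r a x =
     (THE C. \<forall>\<^sub>F R in at_top. hclass m b r a (fiber_chain x R) = C)"

text \<open>In the next three definitions \<open>B\<close> is a connected component of \<^term>\<open>mfd_real m b\<close>; the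
  values do not depend on the chosen point of \<open>B\<close>.\<close>

definition component_class ::
  "nat \<Rightarrow> (nat \<Rightarrow> real ^ 'd::{finite,linorder}) \<Rightarrow> real ^ 'd::{finite,linorder} \<Rightarrow> real \<Rightarrow> (real ^ 'd::{finite,linorder}) set
     \<Rightarrow> (complex ^ 'd::{finite,linorder}) chain set" where
  "component_class m b r a B = fiber_class m b r a (SOME x. x \<in> B)"

definition sgn_comp :: "(real ^ 'd) set \<Rightarrow> int" where
  "sgn_comp B = (let x = SOME x. x \<in> B in \<lfloor>sgn (\<Prod>i\<in>UNIV. x $ i)\<rfloor>)"

definition sgn_comp_at ::
  "nat \<Rightarrow> (nat \<Rightarrow> real ^ 'd) \<Rightarrow> complex ^ 'd \<Rightarrow> (real ^ 'd) set \<Rightarrow> int" where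
  "sgn_comp_at m b \<sigma> B =
     (let x = SOME x. x \<in> B in \<lfloor>sgn (\<Prod>k\<in>incident m b \<sigma>. Re (ell (b k) (cvec x)))\<rfloor>)"

definition linking_torus ::
  "nat \<Rightarrow> (nat \<Rightarrow> real ^ 'd::{finite,linorder}) \<Rightarrow> real ^ 'd::{finite,linorder} \<Rightarrow> real \<Rightarrow> complex ^ 'd::{finite,linorder}
     \<Rightarrow> (complex ^ 'd::{finite,linorder}) chain set" where
  "linking_torus m b r a \<sigma> =
     (\<Otimes>\<^bsub>hgroup m b r a\<^esub>B\<in>{B \<in> components (mfd_real m b). \<sigma> \<in> cvec ` closure B}.
        component_class m b r a B [^]\<^bsub>hgroup m b r a\<^esub> (sgn_comp B * sgn_comp_at m b \<sigma> B))"

end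

theory Submission
  imports Defs "HOL-Analysis.Analysis"
begin

text \<open>
  Why the theorem holds. Write \<open>C\<^sub>B\<close> for the class of the imaginary fiber over the cell \<open>B\<close>, and
  \<open>S(\<sigma>)\<close> for the hyperplanes through \<open>\<sigma>\<close>.

  The torus. For small \<open>\<epsilon>\<close> no \<open>\<ell>\<^sub>j\<close> vanishes where all \<open>\<bar>Re z\<^sub>k\<bar> \<le> \<epsilon>\<close>. In one coordinate plane the
  circle of radius \<open>\<epsilon>\<close> stretches, inside the strip \<open>\<bar>Re z\<bar> \<le> \<epsilon>\<close> and outside the disc \<open>\<bar>z\<bar> < \<epsilon>\<close>, to a tall
  ellipse. Cut at its two tips it becomes the upward line through \<open>\<epsilon>\<close> minus the upward line through
  \<open>-\<epsilon>\<close>: the tips are so far away that the height there is below the given level. Doing this in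
  every coordinate turns the torus into the sum of \<open>sgn(B) C\<^sub>B\<close> over the \<open>2\<^sup>d\<close> cells \<open>B\<close> at the
  origin (\<open>torus_as_fibers\<close>). These homologies come from one formula, the boundary of a cube as
  the alternating sum of its faces (\<open>chain_boundary_cube_chain\<close>).

  The linking tori. In the sum of the linking tori the class \<open>C\<^sub>B\<close> occurs with the coefficient
  \<open>sgn(B)\<close> times the sum of \<open>sgn\<^sub>\<sigma>(B)\<close> over the contributing points \<open>\<sigma>\<close> in the closure of \<open>B\<close>. If
  \<open>B\<close> is unbounded, then \<open>C\<^sub>B = 0\<close>, because \<open>B\<close> has points of arbitrarily low height
  (\<open>fiber_unbounded_cell_null\<close>). What remains is an identity for each bounded cell: the sum of the
  \<open>sgn\<^sub>\<sigma>(B)\<close> is \<open>1\<close> if \<open>B\<close> is a cell at the origin and \<open>0\<close> otherwise (\<open>signed_contrib_count\<close>).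

  The identity. Let \<open>K\<close> be the set of hyperplanes that separate \<open>B\<close> from the origin, so that
  \<open>sgn\<^sub>\<sigma>(B)\<close> is \<open>-1\<close> to the power \<open>card (S(\<sigma>) \<inter> K)\<close>, and \<open>P\<close> the other hyperplanes. The height is
  strictly convex on the orthant of \<open>B\<close>. For each \<open>T \<subseteq> K\<close> let \<open>x\<^sub>T\<close> be the unique lowest point of
  this orthant, cut off by a large box, subject to \<open>\<ell>\<^sub>k \<ge> 0\<close> for \<open>k \<in> P \<union> T\<close>. If \<open>\<ell>\<^sub>k(x\<^sub>T) > 0\<close> for some
  \<open>k \<in> K\<close>, then the constraint \<open>k\<close> is slack, and adding \<open>k\<close> to \<open>T\<close> or removing it does not move the
  lowest point; hence these \<open>T\<close> cancel in pairs in the sum of \<open>(-1)\<^bsup>card T\<^esup>\<close> over \<open>T \<subseteq> K\<close>. For the other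
  \<open>T\<close> the point \<open>x\<^sub>T\<close> lies in the closure of \<open>B\<close>. Its Lagrange multipliers are nonnegative, and
  genericity makes them positive on every hyperplane through \<open>x\<^sub>T\<close>: the point is contributing and
  \<open>T = S(x\<^sub>T) \<inter> K\<close>. Conversely, by convexity every contributing \<open>\<sigma>\<close> in the closure of \<open>B\<close> is \<open>x\<^sub>T\<close> for
  \<open>T = S(\<sigma>) \<inter> K\<close>. So the sum of the \<open>sgn\<^sub>\<sigma>(B)\<close> equals the sum of \<open>(-1)\<^bsup>card T\<^esup>\<close> over all \<open>T \<subseteq> K\<close>, which
  is \<open>1\<close> for empty \<open>K\<close> and \<open>0\<close> otherwise.
\<close>

section \<open>The boundary of the cube chain\<close>

text \<open>
  The cycle \<open>b \<rightarrow> b + 1 \<rightarrow> \<dots> \<rightarrow> n \<rightarrow> b\<close> of \<open>{b..n}\<close>. On \<open>{..<n}\<close> it is the increasing enumeration of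
  \<open>{..n} - {b}\<close>, which is the relabelling of coordinates that happens on a face of the cube.
\<close>

definition cycle_to :: "nat \<Rightarrow> nat \<Rightarrow> nat \<Rightarrow> nat" where
  "cycle_to b n c = (if c < b \<or> n < c then c else if c = n then b else Suc c)"

text \<open>
  This recursion gives the sign of the cycle by induction.
\<close>

lemma cycle_to_Suc:
  assumes "b \<le> n"
  shows "cycle_to b (Suc n) = cycle_to b n \<circ> Transposition.transpose n (Suc n)"
  using assms by (auto simp: cycle_to_def Transposition.transpose_def fun_eq_iff)

lemma cycle_to_permutes_sign:
  assumes "b \<le> n"
  shows "cycle_to b n permutes {..<Suc n} \<and> sign (cycle_to b n) = (-1) ^ (n - b)"
  using assms
proof (induction rule: dec_induct)
  case base
  have "cycle_to b b = id" by (auto simp: cycle_to_def fun_eq_iff)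
  then show ?case by (simp add: permutes_id[unfolded id_def] id_def)
next
  case (step n)
  have t: "Transposition.transpose n (Suc n) permutes {..<Suc (Suc n)}"
    by (intro permutes_swap_id) auto
  have c: "cycle_to b n permutes {..<Suc (Suc n)}"
    using step.IH by (blast intro: permutes_subset[of _ "{..<Suc n}"] lessThan_subset_iff[THEN iffD2] le_SucI)
  have "cycle_to b (Suc n) permutes {..<Suc (Suc n)}"
    unfolding cycle_to_Suc[OF step(1)] by (rule permutes_compose[OF t c])
  moreover have "sign (cycle_to b (Suc n)) = sign (cycle_to b n) * sign (Transposition.transpose n (Suc n))"
    unfolding cycle_to_Suc[OF step(1)]
    by (rule sign_compose; rule permutes_imp_permutation[OF _ c] permutes_imp_permutation[OF _ t]) auto
  ultimately show ?case using step by (simp add: sign_swap_id Suc_diff_le)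
qed

lemmas cycle_to_permutes = conjunct1[OF cycle_to_permutes_sign]
lemmas sign_cycle_to = conjunct2[OF cycle_to_permutes_sign]

lemma permutes_compose_cycle_to:
  assumes "b \<le> n" "q permutes {..<n}"
  shows "cycle_to b n \<circ> q permutes {..<Suc n}"
    and "sign (cycle_to b n \<circ> q) = (-1) ^ (n - b) * sign q"
    and "(cycle_to b n \<circ> q) n = b"
proof -
  have q: "q permutes {..<Suc n}"
    using assms(2) by (rule permutes_subset) auto
  show "cycle_to b n \<circ> q permutes {..<Suc n}"
    by (rule permutes_compose[OF q cycle_to_permutes[OF assms(1)]])
  show "sign (cycle_to b n \<circ> q) = (-1) ^ (n - b) * sign q"
    using sign_compose[OF permutes_imp_permutation[OF _ cycle_to_permutes[OF assms(1)]]
        permutes_imp_permutation[OF _ q]] sign_cycle_to[OF assms(1)] by simp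
  show "(cycle_to b n \<circ> q) n = b"
    using assms by (simp add: permutes_not_in cycle_to_def)
qed

text \<open>
  A permutation of \<open>{..<Suc n}\<close> is determined by its last value \<open>b\<close> and the order in which the other
  values occur; the latter is a permutation of \<open>{..<n}\<close> after the increasing relabelling.
\<close>

lemma sum_permutes_Suc_last:
  fixes f :: "(nat \<Rightarrow> nat) \<Rightarrow> 'a::comm_monoid_add"
  shows "(\<Sum>\<pi> | \<pi> permutes {..<Suc n}. f \<pi>)
       = (\<Sum>b\<le>n. \<Sum>q | q permutes {..<n}. f (cycle_to b n \<circ> q))"
proof -
  have "(\<Sum>\<pi> | \<pi> permutes {..<Suc n}. f \<pi>)
      = (\<Sum>(b, q) \<in> {..n} \<times> {q. q permutes {..<n}}. f (cycle_to b n \<circ> q))"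
  proof (rule sum.reindex_bij_witness
      [where i = "\<lambda>(b, q). cycle_to b n \<circ> q" and j = "\<lambda>\<pi>. (\<pi> n, inv_into UNIV (cycle_to (\<pi> n) n) \<circ> \<pi>)"];
      clarsimp simp del: o_apply)
    fix \<pi> :: "nat \<Rightarrow> nat" assume p: "\<pi> permutes {..<Suc n}"
    have le: "\<pi> n \<le> n" using permutes_in_image[OF p, of n] by auto
    note c = cycle_to_permutes[OF le]
    show "cycle_to (\<pi> n) n \<circ> (inv_into UNIV (cycle_to (\<pi> n) n) \<circ> \<pi>) = \<pi>"
      using permutes_inv_o(1)[OF c] by (simp add: o_assoc)
    then show "f (cycle_to (\<pi> n) n \<circ> (inv_into UNIV (cycle_to (\<pi> n) n) \<circ> \<pi>)) = f \<pi>" by simp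
    have ip: "inv_into UNIV (cycle_to (\<pi> n) n) \<circ> \<pi> permutes {..<Suc n}"
      by (rule permutes_compose[OF p permutes_inv[OF c]])
    have "cycle_to (\<pi> n) n n = \<pi> n" using le by (simp add: cycle_to_def)
    then have "inv_into UNIV (cycle_to (\<pi> n) n) (\<pi> n) = n"
      using permutes_inverses(2)[OF c, of n] by simp
    then have "inv_into UNIV (cycle_to (\<pi> n) n) \<circ> \<pi> permutes {..<n}"
      using permutes_superset[OF ip, of "{..<n}"] by (auto simp: less_Suc_eq)
    with le show "\<pi> n \<le> n \<and> inv_into UNIV (cycle_to (\<pi> n) n) \<circ> \<pi> permutes {..<n}" by simp
  next
    fix b q assume bq: "b \<le> n" "q permutes {..<n}"
    note c = cycle_to_permutes[OF bq(1)]
    show "cycle_to b n \<circ> q permutes {..<Suc n}" by (rule permutes_compose_cycle_to[OF bq])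
    show "(cycle_to b n \<circ> q) n = b \<and>
      inv_into UNIV (cycle_to ((cycle_to b n \<circ> q) n) n) \<circ> (cycle_to b n \<circ> q) = q"
      unfolding permutes_compose_cycle_to(3)[OF bq]
      using permutes_inv_o(2)[OF c] by (simp add: o_assoc)
  qed
  then show ?thesis by (simp add: sum.cartesian_product)
qed

text \<open>
  The analogous splitting by the first value: precomposition with the rotation that moves the last
  argument to the front.
\<close>

lemma sum_permutes_Suc_first:
  fixes f :: "(nat \<Rightarrow> nat) \<Rightarrow> 'a::comm_monoid_add"
  shows "(\<Sum>\<pi> | \<pi> permutes {..<Suc n}. f \<pi>)
       = (\<Sum>b\<le>n. \<Sum>q | q permutes {..<n}. f (cycle_to b n \<circ> q \<circ> inv_into UNIV (cycle_to 0 n)))"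
proof -
  have c: "inv_into UNIV (cycle_to 0 n) permutes {..<Suc n}"
    by (intro permutes_inv cycle_to_permutes) simp
  have "(\<Sum>\<pi> | \<pi> permutes {..<Suc n}. f \<pi>) = (\<Sum>\<pi> | \<pi> permutes {..<Suc n}. f (\<pi> \<circ> inv_into UNIV (cycle_to 0 n)))"
    using sum_permutations_compose_right[OF c, of f] by simp
  then show ?thesis by (simp only: sum_permutes_Suc_last)
qed

definition cube_path :: "(nat \<Rightarrow> nat) \<Rightarrow> nat \<Rightarrow> nat \<Rightarrow> real" where
  "cube_path \<pi> j i = (if i \<in> \<pi> ` {..<j} then 1 else 0)"

lemma cube_chain_cube_path:
  "cube_chain n = (\<Sum>\<pi> | \<pi> permutes {..<n}.
     frag_cmul (sign \<pi>) (frag_of (oriented_simplex n (cube_path \<pi>))))"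
  unfolding cube_chain_def cube_path_def ..

text \<open>
  The embedding of the cube as the slice \<open>t\<^sub>j = a\<close> of the cube with one more coordinate.
\<close>

definition insert_coord :: "nat \<Rightarrow> real \<Rightarrow> (nat \<Rightarrow> real) \<Rightarrow> nat \<Rightarrow> real" where
  "insert_coord j a t i = (if i < j then t i else if i = j then a else t (i - 1))"

lemma cycle_to_image:
  assumes "b \<le> n" "Q \<subseteq> {..<n}"
  shows "c \<in> cycle_to b n ` Q \<longleftrightarrow> (if c < b then c \<in> Q else if c = b then False else c - 1 \<in> Q)"
proof -
  have "c \<in> cycle_to b n ` Q \<longleftrightarrow> (\<exists>y\<in>Q. c = (if y < b then y else Suc y))"
    using assms by (auto simp: cycle_to_def image_iff intro!: bex_cong)
  also have "\<dots> \<longleftrightarrow> (if c < b then c \<in> Q else if c = b then False else c - 1 \<in> Q)"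
  proof (cases "c \<le> b")
    case True
    then show ?thesis by (auto split: if_splits)
  next
    case False
    then show ?thesis by (auto split: if_splits intro!: bexI[of _ "c - 1"])
  qed
  finally show ?thesis .
qed

text \<open>
  In the face \<open>t\<^sub>b = 0\<close> of the cube the paths of the smaller cube become the paths of the larger
  one that take the step in direction \<open>b\<close> last, without that step.
\<close>

lemma chain_map_insert_coord_0:
  assumes "b \<le> n" "q permutes {..<n}"
  shows "simplex_map n (insert_coord b 0) (oriented_simplex n (cube_path q))
       = oriented_simplex n (cube_path (cycle_to b n \<circ> q))"
proof -
  have sub: "q ` {..<j} \<subseteq> {..<n}" if "j \<le> n" for j
    using permutes_image[OF assms(2)] that by auto
  have "insert_coord b 0 (\<lambda>i. \<Sum>j\<le>n. cube_path q j i * x j) i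
      = (\<Sum>j\<le>n. cube_path (cycle_to b n \<circ> q) j i * x j)" for x i
  proof -
    have "cube_path (cycle_to b n \<circ> q) j i
        = (if i < b then cube_path q j i else if i = b then 0 else cube_path q j (i - 1))"
      if "j \<le> n" for j
      unfolding cube_path_def image_comp[symmetric] using cycle_to_image[OF assms(1) sub[OF that]] by auto
    then show ?thesis by (simp add: insert_coord_def)
  qed
  then show ?thesis by (auto simp: simplex_map_def oriented_simplex_def fun_eq_iff)
qed

text \<open>
  In the face \<open>t\<^sub>b = 1\<close> they become the paths that take the step in direction \<open>b\<close> first, without
  their starting point.
\<close>

lemma chain_map_insert_coord_1:
  assumes "b \<le> n" "q permutes {..<n}"
  shows "simplex_map n (insert_coord b 1) (oriented_simplex n (cube_path q))
       = oriented_simplex n (\<lambda>j. cube_path (cycle_to b n \<circ> q \<circ> inv_into UNIV (cycle_to 0 n)) (Suc j))"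
proof -
  note c = cycle_to_permutes[of 0 n, simplified]
  have sub: "q ` {..<j} \<subseteq> {..<n}" if "j \<le> n" for j
    using permutes_image[OF assms(2)] that by auto
  have inv: "inv_into UNIV (cycle_to 0 n) ` {..<Suc j} = insert n {..<j}" if "j \<le> n" for j
  proof -
    have "cycle_to 0 n ` insert n {..<j} = {..<Suc j}"
    proof -
      have "cycle_to 0 n ` {..<j} = Suc ` {..<j}"
        using that by (intro image_cong) (auto simp: cycle_to_def)
      moreover have "cycle_to 0 n n = 0" by (simp add: cycle_to_def)
      ultimately show ?thesis by (simp add: lessThan_Suc_eq_insert_0)
    qed
    then show ?thesis
      by (metis c permutes_inj image_inv_f_f)
  qed
  have "insert_coord b 1 (\<lambda>i. \<Sum>j\<le>n. cube_path q j i * x j) i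
      = (\<Sum>j\<le>n. cube_path (cycle_to b n \<circ> q \<circ> inv_into UNIV (cycle_to 0 n)) (Suc j) i * x j)"
    if x: "x \<in> standard_simplex n" for x i
  proof -
    have *: "cube_path (cycle_to b n \<circ> q \<circ> inv_into UNIV (cycle_to 0 n)) (Suc j) i
        = (if i < b then cube_path q j i else if i = b then 1 else cube_path q j (i - 1))"
      if "j \<le> n" for j
    proof -
      have "(cycle_to b n \<circ> q \<circ> inv_into UNIV (cycle_to 0 n)) ` {..<Suc j} = (cycle_to b n \<circ> q) ` insert n {..<j}"
        using inv[OF that] by (metis image_comp)
      also have "\<dots> = insert b (cycle_to b n ` q ` {..<j})"
        using permutes_compose_cycle_to(3)[OF assms] by (auto simp: image_comp)
      finally show ?thesis
        unfolding cube_path_def using cycle_to_image[OF assms(1) sub[OF that]] by auto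
    qed
    have "(\<Sum>j\<le>n. x j) = 1" using x by (simp add: standard_simplex_def)
    then show ?thesis by (simp add: insert_coord_def *)
  qed
  then show ?thesis by (auto simp: simplex_map_def oriented_simplex_def fun_eq_iff)
qed

lemma frag_eq_uminus:
  fixes z :: "'a \<Rightarrow>\<^sub>0 int"
  assumes "z = - z"
  shows "z = 0"
proof (rule poly_mapping_eqI)
  fix i
  have "Poly_Mapping.lookup z i = - Poly_Mapping.lookup z i"
    using arg_cong[OF assms, of "\<lambda>z. Poly_Mapping.lookup z i"] by simp
  then show "Poly_Mapping.lookup z i = Poly_Mapping.lookup 0 i" by simp
qed

text \<open>
  Omitting an inner vertex \<open>k\<close> of a path makes the order of its steps \<open>k - 1\<close> and \<open>k\<close> invisible. Thus
  two paths that differ by exchanging these steps have this face in common, and they are counted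
  with opposite signs.
\<close>

lemma inner_faces_cancel:
  assumes "0 < k" "k \<le> n"
  shows "(\<Sum>\<pi> | \<pi> permutes {..<Suc n}. frag_cmul (sign \<pi>)
            (frag_of (singular_face (Suc n) k (oriented_simplex (Suc n) (cube_path \<pi>))))) = 0"
    (is "?Z = 0")
proof -
  define \<tau> where "\<tau> = Transposition.transpose (k - 1) k"
  have t: "\<tau> permutes {..<Suc n}" unfolding \<tau>_def using assms by (intro permutes_swap_id) auto
  let ?X = "\<lambda>\<pi>. singular_face (Suc n) k (oriented_simplex (Suc n) (cube_path \<pi>))"
  have X: "?X (\<pi> \<circ> \<tau>) = ?X \<pi>" for \<pi>
  proof -
    have "\<tau> ` {..<j} = {..<j}" if "j < k \<or> k < j" for j
    proof (cases "j < k")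
      case True
      then have "\<tau> x = x" if "x < j" for x using that by (simp add: \<tau>_def Transposition.transpose_def)
      then show ?thesis by (simp cong: image_cong_simp)
    next
      case False
      then have "\<tau> permutes {..<j}" using that unfolding \<tau>_def by (intro permutes_swap_id) auto
      then show ?thesis by (rule permutes_image)
    qed
    then have "cube_path (\<pi> \<circ> \<tau>) j = cube_path \<pi> j" if "j < k \<or> k < j" for j
      using that unfolding cube_path_def image_comp[symmetric] by auto
    then show ?thesis
      using assms by (auto simp: singular_face_oriented_simplex oriented_simplex_eq)
  qed
  have "sign \<tau> = -1" using assms by (simp add: \<tau>_def sign_swap_id)
  then have sgn: "sign (\<pi> \<circ> \<tau>) = - sign \<pi>" if "\<pi> permutes {..<Suc n}" for \<pi>
    using sign_compose[OF permutes_imp_permutation[OF _ that] permutes_imp_permutation[OF _ t]] by simp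
  have "?Z = (\<Sum>\<pi> | \<pi> permutes {..<Suc n}. frag_cmul (sign (\<pi> \<circ> \<tau>)) (frag_of (?X (\<pi> \<circ> \<tau>))))"
    using sum_permutations_compose_right[OF t] .
  also have "\<dots> = (\<Sum>\<pi> | \<pi> permutes {..<Suc n}. - frag_cmul (sign \<pi>) (frag_of (?X \<pi>)))"
    by (intro sum.cong refl) (simp add: sgn X)
  also have "\<dots> = - ?Z" by (rule sum_negf)
  finally show ?thesis by (rule frag_eq_uminus)
qed

lemma frag_cmul_sub: "frag_cmul c (a - b) = frag_cmul c a - frag_cmul c b"
  by (rule poly_mapping_eqI) (simp add: lookup_minus algebra_simps)

text \<open>
  By \<open>inner_faces_cancel\<close> only the omission of the first or of the last vertex contributes to the
  boundary. The former gives the simplices in the faces \<open>t\<^sub>j = 1\<close>, the latter those in the faces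
  \<open>t\<^sub>j = 0\<close>, where \<open>j\<close> is the direction of the first or last step. The signs combine
  that of the relabelling cycle with that of the omitted vertex.
\<close>

theorem chain_boundary_cube_chain:
  "chain_boundary (Suc n) (cube_chain (Suc n))
     = (\<Sum>j\<le>n. frag_cmul ((-1) ^ j)
         (chain_map n (insert_coord j 1) (cube_chain n) - chain_map n (insert_coord j 0) (cube_chain n)))"
proof -
  let ?S = "\<lambda>\<pi>. oriented_simplex (Suc n) (cube_path \<pi>)"
  let ?Z = "\<lambda>k. \<Sum>\<pi> | \<pi> permutes {..<Suc n}. frag_cmul (sign \<pi>) (frag_of (singular_face (Suc n) k (?S \<pi>)))"
  have fin: "finite {\<pi>. \<pi> permutes {..<n}}" for n :: nat by (simp add: finite_permutations)
  have map: "chain_map n (insert_coord j a) (cube_chain n) = (\<Sum>q | q permutes {..<n}. frag_cmul (sign q)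
      (frag_of (simplex_map n (insert_coord j a) (oriented_simplex n (cube_path q)))))" for j a
    unfolding cube_chain_cube_path by (subst chain_map_sum[OF fin]) simp
  have m1: "(-1::int) ^ (n - b) * (-1) ^ n = (-1) ^ b" if "b \<le> n" for b
    using that by (auto simp: minus_one_power_iff)
  have "chain_boundary (Suc n) (cube_chain (Suc n)) = (\<Sum>\<pi> | \<pi> permutes {..<Suc n}. \<Sum>k\<le>Suc n.
      frag_cmul ((-1) ^ k) (frag_cmul (sign \<pi>) (frag_of (singular_face (Suc n) k (?S \<pi>)))))"
    by (simp add: cube_chain_cube_path chain_boundary_sum chain_boundary_cmul chain_boundary_of
        frag_cmul_sum frag_cmul_distrib2 mult.commute o_def del: sum.atMost_Suc)
  also have "\<dots> = (\<Sum>k\<le>Suc n. frag_cmul ((-1) ^ k) (?Z k))"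
    by (subst sum.swap) (simp add: frag_cmul_sum del: sum.atMost_Suc)
  also have "\<dots> = (\<Sum>k\<in>{0, Suc n}. frag_cmul ((-1) ^ k) (?Z k))"
    by (rule sum.mono_neutral_right) (auto simp: inner_faces_cancel le_Suc_eq)
  also have "\<dots> = ?Z 0 + frag_cmul ((-1) ^ Suc n) (?Z (Suc n))" by simp
  also have "?Z 0 = (\<Sum>j\<le>n. frag_cmul ((-1) ^ j) (chain_map n (insert_coord j 1) (cube_chain n)))"
    unfolding sum_permutes_Suc_first map frag_cmul_sum
  proof (intro sum.cong refl)
    fix b q assume "b \<in> {..n}" "q \<in> {q. q permutes {..<n}}"
    then have bq: "b \<le> n" "q permutes {..<n}" by auto
    have c: "inv_into UNIV (cycle_to 0 n) permutes {..<Suc n}"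
      by (intro permutes_inv cycle_to_permutes) simp
    have "sign (inv_into UNIV (cycle_to 0 n)) = (-1) ^ n"
      using sign_inverse[OF permutes_imp_permutation[OF _ cycle_to_permutes[of 0 n]]] sign_cycle_to[of 0 n]
      by simp
    then have "sign (cycle_to b n \<circ> q \<circ> inv_into UNIV (cycle_to 0 n)) = ((-1) ^ (n - b) * sign q) * (-1) ^ n"
      using sign_compose[OF permutes_imp_permutation[OF _ permutes_compose_cycle_to(1)[OF bq]]
          permutes_imp_permutation[OF _ c]]
      unfolding permutes_compose_cycle_to(2)[OF bq] by simp
    also have "\<dots> = ((-1) ^ (n - b) * (-1) ^ n) * sign q" by (simp only: ac_simps)
    finally have "sign (cycle_to b n \<circ> q \<circ> inv_into UNIV (cycle_to 0 n)) = (-1) ^ b * sign q"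
      unfolding m1[OF bq(1)] .
    then show "frag_cmul (sign (cycle_to b n \<circ> q \<circ> inv_into UNIV (cycle_to 0 n)))
          (frag_of (singular_face (Suc n) 0 (?S (cycle_to b n \<circ> q \<circ> inv_into UNIV (cycle_to 0 n)))))
       = frag_cmul ((-1) ^ b) (frag_cmul (sign q)
          (frag_of (simplex_map n (insert_coord b 1) (oriented_simplex n (cube_path q)))))"
      by (simp add: chain_map_insert_coord_1[OF bq] singular_face_oriented_simplex)
  qed
  also have "frag_cmul ((-1) ^ Suc n) (?Z (Suc n))
      = (\<Sum>j\<le>n. frag_cmul (- ((-1) ^ j)) (chain_map n (insert_coord j 0) (cube_chain n)))"
    unfolding sum_permutes_Suc_last map frag_cmul_sum
  proof (intro sum.cong refl)
    fix b q assume "b \<in> {..n}" "q \<in> {q. q permutes {..<n}}"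
    then have bq: "b \<le> n" "q permutes {..<n}" by auto
    have *: "(-1) * x * (y * z) = - (y * x) * z" for x y z :: int by simp
    have "(-1) ^ Suc n * sign (cycle_to b n \<circ> q) = - ((-1) ^ (n - b) * (-1) ^ n) * sign q"
      unfolding permutes_compose_cycle_to(2)[OF bq] power_Suc by (rule *)
    then have "(-1) ^ Suc n * sign (cycle_to b n \<circ> q) = - ((-1) ^ b) * sign q"
      unfolding m1[OF bq(1)] .
    moreover have "singular_face (Suc n) (Suc n) (?S (cycle_to b n \<circ> q))
        = oriented_simplex n (cube_path (cycle_to b n \<circ> q))"
      by (simp add: singular_face_oriented_simplex oriented_simplex_eq)
    ultimately show "frag_cmul ((-1) ^ Suc n) (frag_cmul (sign (cycle_to b n \<circ> q))
          (frag_of (singular_face (Suc n) (Suc n) (?S (cycle_to b n \<circ> q)))))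
       = frag_cmul (- ((-1) ^ b)) (frag_cmul (sign q)
          (frag_of (simplex_map n (insert_coord b 0) (oriented_simplex n (cube_path q)))))"
      by (simp only: chain_map_insert_coord_0[OF bq] frag_cmul_cmul)
  qed
  finally have eq: "chain_boundary (Suc n) (cube_chain (Suc n))
      = (\<Sum>j\<le>n. frag_cmul ((-1) ^ j) (chain_map n (insert_coord j 1) (cube_chain n)))
      + (\<Sum>j\<le>n. frag_cmul (- ((-1) ^ j)) (chain_map n (insert_coord j 0) (cube_chain n)))" .
  show ?thesis
    unfolding eq sum.distrib[symmetric]
    by (intro sum.cong refl) (simp add: frag_cmul_sub minus_frag_cmul[symmetric] del: minus_frag_cmul)
qed

section \<open>Relations between images of cubes\<close>

text \<open>
  The unit interval in every coordinate, including those beyond the dimension in use. The simplices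
  of a cube chain vanish there, so one set serves all dimensions.
\<close>

definition unit_cube :: "(nat \<Rightarrow> real) set" where
  "unit_cube = {t. \<forall>i. 0 \<le> t i \<and> t i \<le> 1}"

lemma singular_chain_cube_chain: "singular_chain n (top_of_set unit_cube) (cube_chain n)"
proof -
  have "oriented_simplex n (cube_path \<pi>) ` standard_simplex n \<subseteq> unit_cube" for \<pi>
  proof
    fix y assume "y \<in> oriented_simplex n (cube_path \<pi>) ` standard_simplex n"
    then obtain x where x: "x \<in> standard_simplex n"
      and y: "y = (\<lambda>i. \<Sum>j\<le>n. cube_path \<pi> j i * x j)" by (auto simp: oriented_simplex_def)
    have "0 \<le> x j" for j using x by (simp add: standard_simplex_def)
    then have "0 \<le> y i" "y i \<le> (\<Sum>j\<le>n. x j)" for i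
      unfolding y by (auto simp: cube_path_def intro!: sum_nonneg sum_mono)
    then show "y \<in> unit_cube" using x by (simp add: unit_cube_def standard_simplex_def)
  qed
  then have "singular_simplex n (subtopology (powertop_real UNIV) unit_cube) (oriented_simplex n (cube_path \<pi>))" for \<pi>
    by (intro simplicial_imp_singular_simplex) (auto simp: simplicial_simplex)
  then show ?thesis
    unfolding cube_chain_cube_path euclidean_product_topology[symmetric]
    by (intro singular_chain_sum singular_chain_cmul) (simp add: singular_chain_of)
qed

lemma insert_coord_unit_cube:
  "t \<in> unit_cube \<Longrightarrow> 0 \<le> a \<Longrightarrow> a \<le> 1 \<Longrightarrow> insert_coord j a t \<in> unit_cube"
  by (auto simp: unit_cube_def insert_coord_def)

lemma continuous_on_insert_coord: "continuous_on S (insert_coord j a)"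
proof (rule continuous_on_coordinatewise_then_product)
  show "continuous_on S (\<lambda>t. insert_coord j a t i)" for i
    unfolding insert_coord_def
    by (cases "i < j"; cases "i = j")
       (auto intro: continuous_on_subset[OF continuous_on_product_coordinates])
qed

abbreviation cube_map :: "nat \<Rightarrow> ((nat \<Rightarrow> real) \<Rightarrow> 'a) \<Rightarrow> 'a chain" where
  "cube_map n f \<equiv> chain_map n f (cube_chain n)"

lemma cube_map_cong:
  assumes "\<And>t. t \<in> unit_cube \<Longrightarrow> f t = g t"
  shows "cube_map n f = cube_map n g"
  by (rule chain_map_eq[OF singular_chain_cube_chain]) (use assms in auto)

lemma singular_chain_cube_map:
  assumes "continuous_on unit_cube f" "f ` unit_cube \<subseteq> X"
  shows "singular_chain n (top_of_set X) (cube_map n f)"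
  by (rule singular_chain_chain_map[OF singular_chain_cube_chain]) (use assms in \<open>auto simp: Pi_iff\<close>)

lemma cube_map_relboundary:
  assumes "continuous_on unit_cube f" "f ` unit_cube \<subseteq> X \<inter> A"
  shows "singular_relboundary n (top_of_set X) A (cube_map n f)"
  using singular_chain_cube_map[OF assms]
  by (intro singular_chain_imp_relboundary) (simp add: subtopology_subtopology)

lemma cube_face_compose:
  "chain_map n F (chain_map n (insert_coord j a) (cube_chain n)) = cube_map n (F \<circ> insert_coord j a)"
  by (simp add: chain_map_compose)

lemma chain_boundary_cube_map:
  "chain_boundary (Suc n) (cube_map (Suc n) F) = (\<Sum>j\<le>n. frag_cmul ((-1) ^ j)
     (cube_map n (F \<circ> insert_coord j 1) - cube_map n (F \<circ> insert_coord j 0)))"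
  by (simp add: chain_boundary_chain_map[OF singular_chain_cube_chain] chain_boundary_cube_chain
      chain_map_sum chain_map_diff cube_face_compose)

lemma singular_relboundary_sum:
  "(\<And>i. i \<in> I \<Longrightarrow> singular_relboundary p X S (f i)) \<Longrightarrow> singular_relboundary p X S (sum f I)"
  by (induction I rule: infinite_finite_induct) (auto intro: singular_relboundary_add)

lemma homologous_rel_0_iff: "homologous_rel p X S c 0 \<longleftrightarrow> singular_relboundary p X S c"
  by (simp add: homologous_rel_def)

lemma homologous_rel_cmul:
  "homologous_rel p Y S c c' \<Longrightarrow> homologous_rel p Y S (frag_cmul a c) (frag_cmul a c')"
  unfolding homologous_rel_def by (metis frag_cmul_sub singular_relboundary_cmul)

text \<open>
  The source of all homologies below. The image of an \<open>(n+1)\<close>-cube bounds the alternating sum of its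
  faces; opposite faces that agree cancel, and faces inside \<open>A\<close> are trivial in relative homology.
\<close>

lemma cube_faces_relation:
  fixes F :: "(nat \<Rightarrow> real) \<Rightarrow> 'a::topological_space"
  assumes F: "continuous_on unit_cube F" "F ` unit_cube \<subseteq> X" and J: "J \<subseteq> {..n}"
    and faces: "\<And>j. j \<le> n \<Longrightarrow> j \<notin> J \<Longrightarrow>
      (\<forall>t\<in>unit_cube. F (insert_coord j 0 t) = F (insert_coord j 1 t)) \<or>
      (\<forall>t\<in>unit_cube. F (insert_coord j 0 t) \<in> A \<and> F (insert_coord j 1 t) \<in> A)"
  shows "singular_relboundary n (top_of_set X) A (\<Sum>j\<in>J. frag_cmul ((-1) ^ j)
     (cube_map n (F \<circ> insert_coord j 1) - cube_map n (F \<circ> insert_coord j 0)))"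
proof -
  let ?D = "\<lambda>j. frag_cmul ((-1) ^ j)
     (cube_map n (F \<circ> insert_coord j 1) - cube_map n (F \<circ> insert_coord j 0))"
  have cont: "continuous_on unit_cube (F \<circ> insert_coord j a)" if "0 \<le> a" "a \<le> 1" for j a
    by (rule continuous_on_compose[OF continuous_on_insert_coord continuous_on_subset[OF F(1)]])
       (use that insert_coord_unit_cube in blast)
  have img: "(F \<circ> insert_coord j a) t \<in> X" if "0 \<le> a" "a \<le> 1" "t \<in> unit_cube" for j a t
    using F(2) insert_coord_unit_cube[OF that(3,1,2)] by auto
  have "singular_relboundary n (top_of_set X) A (chain_boundary (Suc n) (cube_map (Suc n) F))"
    unfolding singular_relboundary
    using singular_chain_cube_map[OF F] by (intro exI[of _ "cube_map (Suc n) F"] exI[of _ 0]) simp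
  then have all: "singular_relboundary n (top_of_set X) A (\<Sum>j\<le>n. ?D j)"
    by (simp only: chain_boundary_cube_map)
  have "singular_relboundary n (top_of_set X) A (?D j)" if "j \<le> n" "j \<notin> J" for j
    using faces[OF that]
  proof
    assume "\<forall>t\<in>unit_cube. F (insert_coord j 0 t) = F (insert_coord j 1 t)"
    then have "cube_map n (F \<circ> insert_coord j 1) = cube_map n (F \<circ> insert_coord j 0)"
      by (intro cube_map_cong) auto
    then show ?thesis by simp
  next
    assume A: "\<forall>t\<in>unit_cube. F (insert_coord j 0 t) \<in> A \<and> F (insert_coord j 1 t) \<in> A"
    have "singular_relboundary n (top_of_set X) A (cube_map n (F \<circ> insert_coord j a))"
      if "a = 0 \<or> a = 1" for a
      using that A img[of a _ j] by (intro cube_map_relboundary cont) auto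
    then show ?thesis by (intro singular_relboundary_cmul singular_relboundary_diff) auto
  qed
  then have "singular_relboundary n (top_of_set X) A (\<Sum>j\<in>{..n} - J. ?D j)"
    by (intro singular_relboundary_sum) auto
  with all have "singular_relboundary n (top_of_set X) A ((\<Sum>j\<le>n. ?D j) - (\<Sum>j\<in>{..n} - J. ?D j))"
    by (rule singular_relboundary_diff)
  then show ?thesis
    using sum_diff[OF _ J, of ?D] by simp
qed

lemma cube_map_relcycle:
  fixes F :: "(nat \<Rightarrow> real) \<Rightarrow> 'a::topological_space"
  assumes F: "continuous_on unit_cube F" "F ` unit_cube \<subseteq> X"
    and faces: "\<And>j t a. j \<le> n \<Longrightarrow> t \<in> unit_cube \<Longrightarrow> a \<in> {0, 1} \<Longrightarrow> F (insert_coord j a t) \<in> A"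
  shows "singular_relcycle (Suc n) (top_of_set X) A (cube_map (Suc n) F)"
proof -
  have "singular_chain n (top_of_set (X \<inter> A)) (cube_map n (F \<circ> insert_coord j a))" if "j \<le> n" "a \<in> {0, 1}" for j a
  proof (rule singular_chain_cube_map)
    show "continuous_on unit_cube (F \<circ> insert_coord j a)"
      by (rule continuous_on_compose[OF continuous_on_insert_coord continuous_on_subset[OF F(1)]])
         (use that insert_coord_unit_cube in auto)
    show "(F \<circ> insert_coord j a) ` unit_cube \<subseteq> X \<inter> A"
      using that faces[OF that(1) _ that(2)] F(2) insert_coord_unit_cube by fastforce
  qed
  then have "singular_chain n (top_of_set (X \<inter> A)) (chain_boundary (Suc n) (cube_map (Suc n) F))"
    unfolding chain_boundary_cube_map
    by (intro singular_chain_sum singular_chain_cmul singular_chain_diff) auto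
  then show ?thesis
    using singular_chain_cube_map[OF F] by (simp add: singular_relcycle subtopology_subtopology)
qed

section \<open>Products of paths\<close>

text \<open>
  Tori and truncated fibers are both of this form, with circles or vertical lines as factors.
\<close>

definition path_prod :: "('d::{finite,linorder} \<Rightarrow> real \<Rightarrow> complex) \<Rightarrow> (complex ^ 'd::{finite,linorder}) chain" where
  "path_prod g = cube_map CARD('d) (\<lambda>t. \<chi> k. g k (coord t k))"

lemma path_prod_cong:
  fixes g h :: "'d::{finite,linorder} \<Rightarrow> real \<Rightarrow> complex"
  assumes "\<And>k u. 0 \<le> u \<Longrightarrow> u \<le> 1 \<Longrightarrow> g k u = h k u"
  shows "path_prod g = path_prod h"
  unfolding path_prod_def
  by (rule cube_map_cong) (use assms in \<open>auto simp: vec_eq_iff coord_def unit_cube_def\<close>)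

lemma coord_index_less_iff [simp]:
  fixes i k :: "'d::{finite,linorder}"
  shows "card {..<k} < card {..<i} \<longleftrightarrow> k < i"
proof
  assume "k < i"
  then show "card {..<k} < card {..<i}" by (intro psubset_card_mono) auto
next
  assume "card {..<k} < card {..<i}"
  then show "k < i"
    by (metis card_mono finite lessThan_subset_iff linorder_not_le)
qed

lemma coord_index_eq_iff [simp]:
  fixes i k :: "'d::{finite,linorder}"
  shows "card {..<k} = card {..<i} \<longleftrightarrow> k = i"
  by (metis coord_index_less_iff linorder_neqE nat_neq_iff)

lemma coord_index_less_card [simp]: "card {..<(k::'d::{finite,linorder})} < CARD('d)"
  by (intro psubset_card_mono) auto

lemma coord_index_surj:
  assumes "j < CARD('d::{finite,linorder})"
  shows "\<exists>k::'d. card {..<k} = j"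
proof -
  have "inj (\<lambda>k::'d. card {..<k})" by (rule injI) simp
  then have "card (range (\<lambda>k::'d. card {..<k})) = card {..<CARD('d)}" by (simp add: card_image)
  then have "range (\<lambda>k::'d. card {..<k}) = {..<CARD('d)}"
    by (intro card_subset_eq) auto
  then show ?thesis using assms by (metis imageE lessThan_iff)
qed

lemma continuous_on_unit_cube_coord:
  assumes "continuous_on {0..1} p"
  shows "continuous_on unit_cube (\<lambda>t. p (t j))"
  by (rule continuous_on_compose2[OF assms continuous_on_subset[OF continuous_on_product_coordinates]])
     (auto simp: unit_cube_def)

text \<open>
  In each coordinate plane \<open>W\<close> is the region where the factors of a product of paths may move. The
  part \<open>E\<close> plays the role of infinity: one coordinate in \<open>E\<close> already forces a point into \<open>A\<close>.
\<close>

locale product_pair =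
  fixes X A :: "(complex ^ 'd::{finite,linorder}) set" and W E :: "complex set"
  assumes in_X: "\<And>z. (\<And>k. z $ k \<in> W) \<Longrightarrow> z \<in> X"
    and in_A: "\<And>z k. (\<And>k. z $ k \<in> W) \<Longrightarrow> z $ k \<in> E \<Longrightarrow> z \<in> A"
begin

abbreviation hom_rel (infix "\<sim>" 50) where
  "c \<sim> c' \<equiv> homologous_rel CARD('d) (top_of_set X) A c c'"

definition relpath :: "(real \<Rightarrow> complex) \<Rightarrow> bool" where
  "relpath p \<longleftrightarrow> continuous_on {0..1} p \<and> p ` {0..1} \<subseteq> W \<and> (p 0 = p 1 \<or> (p 0 \<in> E \<and> p 1 \<in> E))"

text \<open>
  A square in the \<open>i\<close>-th coordinate plane times paths in the other planes is an \<open>(n+1)\<close>-cube. Its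
  faces in the other directions cancel or lie in \<open>A\<close>, so the four sides of the square remain. The
  two directions of the square occupy neighbouring positions; hence the sides appear with the
  signs of an oriented boundary.
\<close>

lemma square_relation:
  fixes g :: "'d \<Rightarrow> real \<Rightarrow> complex"
  assumes g: "\<And>k. k \<noteq> i \<Longrightarrow> relpath (g k)"
    and Q: "continuous_on ({0..1} \<times> {0..1}) (\<lambda>w. Q (fst w) (snd w))"
    and QW: "\<And>u v. u \<in> {0..1} \<Longrightarrow> v \<in> {0..1} \<Longrightarrow> Q u v \<in> W"
  shows "path_prod (g(i := Q 1)) + path_prod (g(i := \<lambda>u. Q u 0))
       \<sim> path_prod (g(i := Q 0)) + path_prod (g(i := \<lambda>u. Q u 1))"
proof -
  define n where "n = CARD('d)"
  define a where "a = (\<lambda>k::'d. card {..<k})"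
  \<comment> \<open>the square uses the coordinates \<open>a i\<close> and \<open>a i + 1\<close>; later coordinates move up by one\<close>
  define F where "F = (\<lambda>t::nat \<Rightarrow> real. \<chi> k. if k = i then Q (t (a i)) (t (Suc (a i)))
    else if k < i then g k (t (a k)) else g k (t (Suc (a k))))"
  have a: "a k < a l \<longleftrightarrow> k < l" "a k = a l \<longleftrightarrow> k = l" "a k < n" for k l
    by (simp_all add: a_def n_def)
  have gW: "g k u \<in> W" if "k \<noteq> i" "0 \<le> u" "u \<le> 1" for k u
    using g[OF that(1)] that by (auto simp: relpath_def)
  have FW: "F t $ k \<in> W" if "t \<in> unit_cube" for t k
    using that by (auto simp: F_def unit_cube_def intro!: gW QW)
  have cont: "continuous_on unit_cube F"
    unfolding F_def
  proof (rule continuous_on_vec_lambda)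
    fix k
    have "continuous_on unit_cube (\<lambda>t. Q (t (a i)) (t (Suc (a i))))"
      by (rule continuous_on_compose2[OF Q, where f = "\<lambda>t. (t (a i), t (Suc (a i)))", simplified])
         (auto simp: unit_cube_def intro!: continuous_on_Pair
           intro: continuous_on_subset[OF continuous_on_product_coordinates])
    moreover have "continuous_on unit_cube (\<lambda>t. g k (t j))" if "k \<noteq> i" for j
      by (rule continuous_on_unit_cube_coord) (use g[OF that] in \<open>simp add: relpath_def\<close>)
    ultimately show "continuous_on unit_cube (\<lambda>t. if k = i then Q (t (a i)) (t (Suc (a i)))
        else if k < i then g k (t (a k)) else g k (t (Suc (a k))))"
      by (cases "k = i"; cases "k < i") auto
  qed
  have "singular_relboundary n (top_of_set X) A (\<Sum>j\<in>{a i, Suc (a i)}. frag_cmul ((-1) ^ j)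
     (cube_map n (F \<circ> insert_coord j 1) - cube_map n (F \<circ> insert_coord j 0)))"
  proof (rule cube_faces_relation[OF cont])
    show "F ` unit_cube \<subseteq> X" using FW in_X by blast
    show "{a i, Suc (a i)} \<subseteq> {..n}" using a(3)[of i] by auto
    fix j assume j: "j \<le> n" "j \<notin> {a i, Suc (a i)}"
    obtain k where k: "k \<noteq> i" "j = (if k < i then a k else Suc (a k))"
    proof (cases "j < a i")
      case True
      then obtain k where "a k = j"
        using coord_index_surj[of j, where ?'d = 'd] less_trans[OF True a(3)] by (auto simp: a_def n_def)
      with True a show ?thesis by (intro that[of k]) auto
    next
      case False
      then obtain k where "a k = j - 1"
        using coord_index_surj[of "j - 1", where ?'d = 'd] j False by (force simp: a_def n_def)
      moreover from this False j have "a i < a k" by auto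
      ultimately show ?thesis using a(1)[of i k] False j by (intro that[of k]) auto
    qed
    have Fk: "F (insert_coord j c t) $ k = g k c" for c t
      using k by (auto simp: F_def insert_coord_def)
    have other: "F (insert_coord j c t) $ l = F (insert_coord j c' t) $ l" if "l \<noteq> k" for c c' t l
    proof -
      have "j \<noteq> (if l < i then a l else Suc (a l))" "j \<noteq> a i" "j \<noteq> Suc (a i)"
        using k that j a(2)[of l k] a(1)[of l i] a(1)[of k i] a(2)[of i k] a(2)[of i l] a(1)[of i l] a(1)[of i k]
        by (auto split: if_splits)
      then show ?thesis by (auto simp: F_def insert_coord_def split: if_splits)
    qed
    show "(\<forall>t\<in>unit_cube. F (insert_coord j 0 t) = F (insert_coord j 1 t)) \<or>
      (\<forall>t\<in>unit_cube. F (insert_coord j 0 t) \<in> A \<and> F (insert_coord j 1 t) \<in> A)"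
    proof (cases "g k 0 = g k 1")
      case True
      have "F (insert_coord j 0 t) = F (insert_coord j 1 t)" for t
        unfolding vec_eq_iff using other[of _ 0 t 1] Fk[of 0 t] Fk[of 1 t] True by metis
      then show ?thesis by simp
    next
      case False
      then have "g k 0 \<in> E" "g k 1 \<in> E" using g[OF k(1)] by (auto simp: relpath_def)
      then have "F (insert_coord j c t) \<in> A" if "t \<in> unit_cube" "c \<in> {0, 1}" for t c
        using that Fk[of c t] by (intro in_A[of _ k] FW insert_coord_unit_cube) auto
      then show ?thesis by blast
    qed
  qed
  moreover have "cube_map n (F \<circ> insert_coord (a i) c) = path_prod (g(i := Q c))" for c
  proof -
    have "a i < a k" "\<not> Suc (a k) < a i" "Suc (a k) \<noteq> a i" "\<not> a k < a i" "a k \<noteq> a i" if "\<not> k < i" "k \<noteq> i" for k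
      using that a(1)[of i k] by (metis linorder_neqE Suc_lessD lessI less_asym)+
    then have "(F \<circ> insert_coord (a i) c) t $ k = (g(i := Q c)) k (t (a k))" for t k
      by (cases "k = i"; cases "k < i") (auto simp: F_def insert_coord_def dest: a(1)[THEN iffD2])
    then show ?thesis
      unfolding path_prod_def n_def by (intro cube_map_cong) (simp add: vec_eq_iff coord_def a_def)
  qed
  moreover have "cube_map n (F \<circ> insert_coord (Suc (a i)) c) = path_prod (g(i := \<lambda>u. Q u c))" for c
  proof -
    have "a i < a k" "\<not> Suc (a k) < a i" "Suc (a k) \<noteq> a i" "\<not> a k < a i" "a k \<noteq> a i" if "\<not> k < i" "k \<noteq> i" for k
      using that a(1)[of i k] by (metis linorder_neqE Suc_lessD lessI less_asym)+
    then have "(F \<circ> insert_coord (Suc (a i)) c) t $ k = (g(i := \<lambda>u. Q u c)) k (t (a k))" for t k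
      by (cases "k = i"; cases "k < i") (auto simp: F_def insert_coord_def dest: a(1)[THEN iffD2])
    then show ?thesis
      unfolding path_prod_def n_def by (intro cube_map_cong) (simp add: vec_eq_iff coord_def a_def)
  qed
  ultimately have "singular_relboundary n (top_of_set X) A
     (frag_cmul ((-1) ^ a i) (path_prod (g(i := Q 1)) - path_prod (g(i := Q 0)))
    + frag_cmul (- ((-1) ^ a i)) (path_prod (g(i := \<lambda>u. Q u 1)) - path_prod (g(i := \<lambda>u. Q u 0))))"
    by simp
  then have "singular_relboundary n (top_of_set X) A (frag_cmul ((-1) ^ a i)
     (frag_cmul ((-1) ^ a i) (path_prod (g(i := Q 1)) - path_prod (g(i := Q 0)))
    + frag_cmul (- ((-1) ^ a i)) (path_prod (g(i := \<lambda>u. Q u 1)) - path_prod (g(i := \<lambda>u. Q u 0)))))"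
    by (rule singular_relboundary_cmul)
  then have "singular_relboundary n (top_of_set X) A
     ((path_prod (g(i := Q 1)) - path_prod (g(i := Q 0)))
      + - (path_prod (g(i := \<lambda>u. Q u 1)) - path_prod (g(i := \<lambda>u. Q u 0))))"
    by (simp only: frag_cmul_distrib2 frag_cmul_cmul mult_minus_right power_add[symmetric]
        mult_2[symmetric] power_mult power2_minus one_power2 power_one frag_cmul_one frag_cmul_minus_one)
  then show ?thesis
    unfolding homologous_rel_def n_def by (simp add: algebra_simps)
qed

lemma path_prod_null:
  assumes "\<And>k. k \<noteq> i \<Longrightarrow> relpath (g k)" "continuous_on {0..1} p" "p ` {0..1} \<subseteq> W \<inter> E"
  shows "path_prod (g(i := p)) \<sim> 0"
  unfolding homologous_rel_0_iff path_prod_def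
proof (rule cube_map_relboundary)
  have W: "(g(i := p)) k u \<in> W" if "0 \<le> u" "u \<le> 1" for k u
    using assms(1)[of k] assms(3) that by (cases "k = i") (auto simp: relpath_def image_subset_iff)
  show "continuous_on unit_cube (\<lambda>t. \<chi> k. (g(i := p)) k (coord t k))"
    unfolding coord_def
    by (intro continuous_on_vec_lambda continuous_on_unit_cube_coord) (use assms in \<open>auto simp: relpath_def\<close>)
  show "(\<lambda>t. \<chi> k. (g(i := p)) k (coord t k)) ` unit_cube \<subseteq> X \<inter> A"
  proof clarify
    fix t assume t: "t \<in> unit_cube"
    let ?z = "\<chi> k. (g(i := p)) k (coord t k)"
    have "?z $ k \<in> W" for k using t W[of "coord t k" k] by (simp add: coord_def unit_cube_def)
    moreover have "?z $ i \<in> E" using t assms(3) by (auto simp: coord_def unit_cube_def)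
    ultimately show "?z \<in> X \<inter> A" using in_X in_A by blast
  qed
qed

text \<open>
  Two sides of the square cancel (for closed paths) or vanish (for paths with ends in \<open>E\<close>).
\<close>

lemma path_prod_homotopy:
  fixes Q :: "real \<Rightarrow> real \<Rightarrow> complex"
  assumes g: "\<And>k. k \<noteq> i \<Longrightarrow> relpath (g k)"
    and Q: "continuous_on ({0..1} \<times> {0..1}) (\<lambda>w. Q (fst w) (snd w))"
    and QW: "\<And>u v. u \<in> {0..1} \<Longrightarrow> v \<in> {0..1} \<Longrightarrow> Q u v \<in> W"
    and ends: "(\<forall>v\<in>{0..1}. Q 0 v = Q 1 v) \<or> (\<forall>v\<in>{0..1}. Q 0 v \<in> E \<and> Q 1 v \<in> E)"
  shows "path_prod (g(i := \<lambda>u. Q u 0)) \<sim> path_prod (g(i := \<lambda>u. Q u 1))"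
proof -
  have c: "continuous_on {0..1} (Q u)" if "u \<in> {0..1}" for u
    by (rule continuous_on_compose2[OF Q, where f = "Pair u", simplified])
       (use that in \<open>auto intro!: continuous_intros\<close>)
  have sides: "path_prod (g(i := Q 1)) \<sim> path_prod (g(i := Q 0))"
    using ends
  proof
    assume "\<forall>v\<in>{0..1}. Q 0 v = Q 1 v"
    then have "path_prod (g(i := Q 1)) = path_prod (g(i := Q 0))"
      by (intro path_prod_cong) auto
    then show ?thesis by simp
  next
    assume "\<forall>v\<in>{0..1}. Q 0 v \<in> E \<and> Q 1 v \<in> E"
    then have "path_prod (g(i := Q 1)) \<sim> 0" "path_prod (g(i := Q 0)) \<sim> 0"
      using QW c by (auto intro!: path_prod_null g)
    then show ?thesis by (meson homologous_rel_sym homologous_rel_trans)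
  qed
  show ?thesis
    using homologous_rel_diff[OF square_relation[where g = g and i = i and Q = Q, OF g Q QW] sides] by simp
qed

end

definition vline :: "real \<Rightarrow> real \<Rightarrow> real \<Rightarrow> complex" where
  "vline R c u = Complex c (R * (2 * u - 1))"

definition circle :: "real \<Rightarrow> real \<Rightarrow> complex" where
  "circle \<epsilon> t = of_real \<epsilon> * cis (2 * pi * t)"

text \<open>
  The bound on \<open>Re z\<close> keeps away from the hyperplanes of the arrangement, the bound on \<open>\<bar>z\<bar>\<close> from the
  coordinate hyperplane; the latter also bounds the height from above.
\<close>

definition strip :: "real \<Rightarrow> complex set" where
  "strip \<epsilon> = {z. \<bar>Re z\<bar> \<le> \<epsilon> \<and> \<epsilon> \<le> cmod z}"

definition strip_ends :: "real \<Rightarrow> complex set" where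
  "strip_ends R = {z. R \<le> \<bar>Im z\<bar>}"

text \<open>
  The coordinates dominate those of the point \<open>\<epsilon> (sin \<theta>, cos \<theta>)\<close> on the circle. In this way the
  ellipses below are seen to avoid the disc.
\<close>

lemma ellipse_norm_ge:
  fixes x y \<theta> :: real
  assumes "0 \<le> \<epsilon>" "\<epsilon> * \<bar>sin \<theta>\<bar> \<le> \<bar>x\<bar>" "\<epsilon> * \<bar>cos \<theta>\<bar> \<le> \<bar>y\<bar>"
  shows "\<epsilon> \<le> cmod (Complex x y)"
proof -
  have "\<epsilon>\<^sup>2 = (\<epsilon> * \<bar>sin \<theta>\<bar>)\<^sup>2 + (\<epsilon> * \<bar>cos \<theta>\<bar>)\<^sup>2"
    by (simp add: power_mult_distrib distrib_left[symmetric])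
  also have "\<dots> \<le> \<bar>x\<bar>\<^sup>2 + \<bar>y\<bar>\<^sup>2"
    using assms by (intro add_mono power_mono) auto
  finally show ?thesis unfolding complex_norm by (simp add: real_le_rsqrt)
qed

locale strip_pair = product_pair X A "strip \<epsilon>" "strip_ends R"
  for X A :: "(complex ^ 'd::{finite,linorder}) set" and \<epsilon> R +
  assumes eps: "0 < \<epsilon>" "\<epsilon> \<le> R"
begin

lemma relpath_circle: "relpath (circle \<epsilon>)"
proof -
  have "cmod (circle \<epsilon> t) = \<epsilon>" "\<bar>Re (circle \<epsilon> t)\<bar> \<le> \<epsilon>" for t
    using eps by (simp_all add: circle_def norm_mult abs_mult mult_left_le)
  moreover have "continuous_on {0..1} (circle \<epsilon>)"
    unfolding circle_def by (intro continuous_intros)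
  moreover have "circle \<epsilon> 0 = circle \<epsilon> 1" by (simp add: circle_def)
  ultimately show ?thesis
    unfolding relpath_def by (simp add: strip_def image_subset_iff)
qed

lemma relpath_vline:
  assumes "\<bar>c\<bar> = \<epsilon>"
  shows "relpath (vline R c)"
proof -
  have "continuous_on {0..1} (vline R c)"
    unfolding vline_def by (intro continuous_intros)
  moreover have "\<epsilon> \<le> cmod (vline R c u)" for u
    using abs_Re_le_cmod[of "vline R c u"] assms by (simp add: vline_def)
  ultimately show ?thesis
    using assms eps unfolding relpath_def by (auto simp: strip_def strip_ends_def vline_def)
qed

text \<open>
  A circle around the origin is the difference of the two vertical lines beside it, because the
  circle can be pulled towards \<open>\<plusminus>i \<infinity>\<close> without leaving the strip and is then cut at its ends.
\<close>

lemma circle_splits: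
  fixes g :: "'d \<Rightarrow> real \<Rightarrow> complex"
  assumes g: "\<And>k. k \<noteq> i \<Longrightarrow> relpath (g k)"
  shows "path_prod (g(i := circle \<epsilon>)) \<sim>
    path_prod (g(i := vline R \<epsilon>)) - path_prod (g(i := vline R (- \<epsilon>)))"
proof -
  define \<gamma> where "\<gamma> = (\<lambda>t. Complex (\<epsilon> * sin (2 * pi * t)) (- R * cos (2 * pi * t)))"
  define arc where "arc = (\<lambda>s u. Complex (s * \<epsilon> * sin (pi * u)) (- R * cos (pi * u)))"
  have R: "0 < R" using eps by simp
  note hom = path_prod_homotopy[where g = g and i = i, OF g]
  have ce: "a * \<bar>c\<bar> \<le> \<bar>b * c\<bar>" if "0 \<le> a" "a \<le> \<bar>b\<bar>" for a b c :: real
    using that by (simp add: abs_mult mult_right_mono)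
  \<comment> \<open>rotate the base point to \<open>- i\<close> while stretching the circle to an ellipse\<close>
  have 1: "path_prod (g(i := circle \<epsilon>)) \<sim> path_prod (g(i := \<gamma>))"
  proof -
    define Q where "Q = (\<lambda>u v. Complex (\<epsilon> * cos (2 * pi * u - v * (pi / 2)))
      ((\<epsilon> + v * (R - \<epsilon>)) * sin (2 * pi * u - v * (pi / 2))))"
    have "path_prod (g(i := \<lambda>u. Q u 0)) \<sim> path_prod (g(i := \<lambda>u. Q u 1))"
    proof (rule hom)
      show "continuous_on ({0..1} \<times> {0..1}) (\<lambda>w. Q (fst w) (snd w))"
        unfolding Q_def by (intro continuous_intros)
      show "Q u v \<in> strip \<epsilon>" if "u \<in> {0..1}" "v \<in> {0..1}" for u v
      proof -
        have "\<epsilon> \<le> \<bar>\<epsilon> + v * (R - \<epsilon>)\<bar>" using that eps by (simp add: abs_of_nonneg)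
        then have "\<epsilon> \<le> cmod (Q u v)"
          unfolding Q_def using eps
          by (intro ellipse_norm_ge[where \<theta> = "2 * pi * u - v * (pi / 2) + pi / 2"])
             (auto simp: sin_add cos_add intro!: ce)
        then show ?thesis using eps by (simp add: strip_def Q_def abs_mult mult_left_le)
      qed
      have "Q 0 v = Q 1 v" for v
        by (simp add: Q_def cos_diff sin_diff)
      then show "(\<forall>v\<in>{0..1}. Q 0 v = Q 1 v) \<or> (\<forall>v\<in>{0..1}. Q 0 v \<in> strip_ends R \<and> Q 1 v \<in> strip_ends R)"
        by blast
    qed auto
    moreover have "(\<lambda>u. Q u 0) = circle \<epsilon>" by (auto simp: Q_def circle_def complex_eq_iff)
    moreover have "(\<lambda>u. Q u 1) = \<gamma>" by (auto simp: Q_def \<gamma>_def complex_eq_iff cos_diff sin_diff)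
    ultimately show ?thesis by simp
  qed
  \<comment> \<open>cut the ellipse at \<open>\<plusminus> i R\<close>\<close>
  have 2: "path_prod (g(i := arc 1)) \<sim> path_prod (g(i := \<gamma>)) + path_prod (g(i := arc (-1)))"
  proof -
    \<comment> \<open>on this square the sides \<open>v = 0\<close> and \<open>v = 1\<close> run along the two halves of \<open>\<gamma>\<close> to the tip \<open>\<gamma> (1/2)\<close>, the side \<open>u = 0\<close> is \<open>\<gamma>\<close>, and the side \<open>u = 1\<close> stays at the tip\<close>
    define Q where "Q = (\<lambda>u v. \<gamma> (v + u * (1/2 - v)))"
    have \<gamma>: "\<gamma> t \<in> strip \<epsilon>" for t
    proof -
      have "\<epsilon> \<le> cmod (\<gamma> t)"
        unfolding \<gamma>_def using eps by (intro ellipse_norm_ge[where \<theta> = "2 * pi * t"] ce) (auto simp: abs_mult mult_right_mono)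
      then show ?thesis using eps by (simp add: strip_def \<gamma>_def abs_mult mult_left_le)
    qed
    have "path_prod (g(i := Q 1)) + path_prod (g(i := \<lambda>u. Q u 0))
       \<sim> path_prod (g(i := Q 0)) + path_prod (g(i := \<lambda>u. Q u 1))"
    proof (rule square_relation[OF g])
      show "continuous_on ({0..1} \<times> {0..1}) (\<lambda>w. Q (fst w) (snd w))"
        unfolding Q_def \<gamma>_def by (intro continuous_intros)
    qed (auto simp: Q_def \<gamma>)
    moreover have "Q 0 = \<gamma>" by (auto simp: Q_def)
    moreover have "(\<lambda>u. Q u 0) = arc 1" by (auto simp: Q_def \<gamma>_def arc_def)
    moreover have "(\<lambda>u. Q u 1) = arc (-1)"
    proof
      fix u :: real
      have "2 * pi * (1 + u * (1/2 - 1)) = 2 * pi - pi * u" by (simp add: algebra_simps)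
      then show "Q u 1 = arc (-1) u" by (simp add: Q_def \<gamma>_def arc_def sin_diff cos_diff)
    qed
    moreover have "path_prod (g(i := Q 1)) \<sim> 0"
    proof (rule path_prod_null[OF g])
      have "Q 1 v = Complex 0 R" for v by (simp add: Q_def \<gamma>_def)
      then show "continuous_on {0..1} (Q 1)" "Q 1 ` {0..1} \<subseteq> strip \<epsilon> \<inter> strip_ends R"
        using eps by (auto simp: strip_def strip_ends_def complex_norm)
    qed auto
    ultimately show ?thesis
      using homologous_rel_diff[of "CARD('d)" "top_of_set X" A _ _ "path_prod (g(i := Q 1))" 0] by fastforce
  qed
  \<comment> \<open>each half of the ellipse deforms to a vertical line, its ends staying in the ends of the strip\<close>
  have 3: "path_prod (g(i := arc s)) \<sim> path_prod (g(i := vline R (s * \<epsilon>)))" if s: "\<bar>s\<bar> = 1" for s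
  proof -
    \<comment> \<open>first widen the half ellipse to the line with the parametrization \<open>- cos\<close>, then make it linear\<close>
    define Q1 where "Q1 = (\<lambda>u v. Complex (s * \<epsilon> * ((1 - v) * sin (pi * u) + v)) (- R * cos (pi * u)))"
    define Q2 where "Q2 = (\<lambda>u v. Complex (s * \<epsilon>) (R * ((1 - v) * (- cos (pi * u)) + v * (2 * u - 1))))"
    have sin0: "0 \<le> sin (pi * u)" if "u \<in> {0..1}" for u
      using that by (intro sin_ge_zero) (auto simp: mult_left_le)
    have h1: "path_prod (g(i := \<lambda>u. Q1 u 0)) \<sim> path_prod (g(i := \<lambda>u. Q1 u 1))"
    proof (rule hom)
      show "continuous_on ({0..1} \<times> {0..1}) (\<lambda>w. Q1 (fst w) (snd w))"
        unfolding Q1_def by (intro continuous_intros)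
      show "Q1 u v \<in> strip \<epsilon>" if u: "u \<in> {0..1}" and v: "v \<in> {0..1}" for u v
      proof -
        let ?c = "(1 - v) * sin (pi * u) + v"
        have "v * sin (pi * u) \<le> v" "(1 - v) * sin (pi * u) \<le> 1 - v"
          using v by (auto intro!: mult_left_le)
        then have c: "sin (pi * u) \<le> ?c" "?c \<le> 1" by (auto simp: algebra_simps)
        have "\<epsilon> \<le> cmod (Q1 u v)"
          unfolding Q1_def using eps s c sin0[OF u]
          by (intro ellipse_norm_ge[where \<theta> = "pi * u"]) (auto simp: abs_mult mult_right_mono)
        then show ?thesis using eps s c sin0[OF u] by (simp add: strip_def Q1_def abs_mult mult_left_le)
      qed
      show "(\<forall>v\<in>{0..1}. Q1 0 v = Q1 1 v) \<or> (\<forall>v\<in>{0..1}. Q1 0 v \<in> strip_ends R \<and> Q1 1 v \<in> strip_ends R)"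
        using eps by (simp add: Q1_def strip_ends_def)
    qed auto
    have h2: "path_prod (g(i := \<lambda>u. Q2 u 0)) \<sim> path_prod (g(i := \<lambda>u. Q2 u 1))"
    proof (rule hom)
      show "continuous_on ({0..1} \<times> {0..1}) (\<lambda>w. Q2 (fst w) (snd w))"
        unfolding Q2_def by (intro continuous_intros)
      show "Q2 u v \<in> strip \<epsilon>" if u: "u \<in> {0..1}" and v: "v \<in> {0..1}" for u v
        using abs_Re_le_cmod[of "Q2 u v"] eps s by (simp add: strip_def Q2_def abs_mult)
      have "Q2 0 v = Complex (s * \<epsilon>) (- R)" "Q2 1 v = Complex (s * \<epsilon>) R" for v
        by (simp_all add: Q2_def algebra_simps)
      then show "(\<forall>v\<in>{0..1}. Q2 0 v = Q2 1 v) \<or> (\<forall>v\<in>{0..1}. Q2 0 v \<in> strip_ends R \<and> Q2 1 v \<in> strip_ends R)"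
        using eps by (simp add: strip_ends_def)
    qed auto
    have "(\<lambda>u. Q1 u 0) = arc s" "(\<lambda>u. Q1 u 1) = (\<lambda>u. Q2 u 0)" "(\<lambda>u. Q2 u 1) = vline R (s * \<epsilon>)"
      by (auto simp: Q1_def Q2_def arc_def vline_def)
    then show ?thesis using homologous_rel_trans[OF h2 h1[unfolded \<open>(\<lambda>u. Q1 u 1) = (\<lambda>u. Q2 u 0)\<close>]] by simp
  qed
  have "path_prod (g(i := arc 1)) - path_prod (g(i := arc (-1)))
      \<sim> path_prod (g(i := vline R \<epsilon>)) - path_prod (g(i := vline R (- \<epsilon>)))"
    using homologous_rel_diff[OF 3[of 1] 3[of "-1"]] by simp
  moreover have "path_prod (g(i := \<gamma>)) \<sim> path_prod (g(i := arc 1)) - path_prod (g(i := arc (-1)))"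
    using homologous_rel_diff[OF 2 homologous_rel_refl[of _ _ _ "path_prod (g(i := arc (-1)))"]]
    by (simp add: homologous_rel_sym)
  ultimately show ?thesis using 1 by (meson homologous_rel_trans)
qed

text \<open>
  The intermediate products: lines in the coordinates of \<open>D\<close>, on the side given by \<open>N\<close>, and circles
  in the others.
\<close>

definition partial_line :: "'d set \<Rightarrow> 'd set \<Rightarrow> 'd \<Rightarrow> real \<Rightarrow> complex" where
  "partial_line D N k = (if k \<in> D then vline R (if k \<in> N then - \<epsilon> else \<epsilon>) else circle \<epsilon>)"

text \<open>
  One coordinate at a time, \<open>circle_splits\<close> replaces a circle by the line at \<open>\<epsilon>\<close> minus the line at
  \<open>-\<epsilon>\<close>; choosing the latter in the coordinates of \<open>N\<close> gives the sign.
\<close>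

lemma circles_split:
  "path_prod (\<lambda>k. circle \<epsilon>) \<sim> (\<Sum>N\<in>Pow D. frag_cmul ((-1) ^ card N) (path_prod (partial_line D N)))"
proof (induction D rule: finite_induct[OF finite])
  case 1
  have "partial_line {} {} = (\<lambda>k. circle \<epsilon>)" by (auto simp: partial_line_def)
  then show ?case by simp
next
  case (2 i D)
  let ?L = "\<lambda>N. path_prod (partial_line (insert i D) N)"
  have rel: "relpath (partial_line D N k)" for N k
    using eps by (auto simp: partial_line_def intro!: relpath_circle relpath_vline)
  have step: "frag_cmul ((-1) ^ card N) (path_prod (partial_line D N)) \<sim>
      frag_cmul ((-1) ^ card N) (?L N) + frag_cmul ((-1) ^ card (insert i N)) (?L (insert i N))"
    if N: "N \<in> Pow D" for N
  proof -
    have i: "i \<notin> N" "finite N" using N 2 by auto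
    have "(partial_line D N)(i := circle \<epsilon>) = partial_line D N"
      "(partial_line D N)(i := vline R \<epsilon>) = partial_line (insert i D) N"
      "(partial_line D N)(i := vline R (- \<epsilon>)) = partial_line (insert i D) (insert i N)"
      using 2 i by (auto simp: partial_line_def fun_eq_iff)
    then have "path_prod (partial_line D N) \<sim> ?L N - ?L (insert i N)"
      using circle_splits[of i "partial_line D N", OF rel] by simp
    from homologous_rel_cmul[OF this, of "(-1) ^ card N"] i show ?thesis
      by (simp add: frag_cmul_sub flip: minus_frag_cmul)
  qed
  have "inj_on (insert i) (Pow D)" using 2 by (auto simp: inj_on_def)
  then have "(\<Sum>N\<in>Pow (insert i D). frag_cmul ((-1) ^ card N) (?L N))
    = (\<Sum>N\<in>Pow D. frag_cmul ((-1) ^ card N) (?L N) + frag_cmul ((-1) ^ card (insert i N)) (?L (insert i N)))"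
    using 2 unfolding Pow_insert by (subst sum.union_disjoint) (auto simp: sum.reindex sum.distrib)
  moreover have "(\<Sum>N\<in>Pow D. frag_cmul ((-1) ^ card N) (path_prod (partial_line D N))) \<sim>
     (\<Sum>N\<in>Pow D. frag_cmul ((-1) ^ card N) (?L N) + frag_cmul ((-1) ^ card (insert i N)) (?L (insert i N)))"
    by (rule homologous_rel_sum) (use step in auto)
  ultimately show ?case using 2 by (metis (no_types, lifting) homologous_rel_trans)
qed

theorem torus_as_fibers:
  "torus_chain \<epsilon> \<sim> (\<Sum>N\<in>UNIV. frag_cmul ((-1) ^ card N) (fiber_chain (\<chi> k. if k \<in> N then - \<epsilon> else \<epsilon>) R))"
proof -
  have "torus_chain \<epsilon> = (path_prod (\<lambda>k. circle \<epsilon>) :: (complex ^ 'd::{finite,linorder}) chain)"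
    unfolding torus_chain_def path_prod_def circle_def ..
  moreover have "fiber_chain (\<chi> k. if k \<in> N then - \<epsilon> else \<epsilon>) R = path_prod (partial_line UNIV N)" for N
    unfolding fiber_chain_def path_prod_def partial_line_def vline_def by simp
  ultimately show ?thesis using circles_split[of UNIV] by simp
qed

end

section \<open>Cells of the real arrangement and the classes of their fibers\<close>

lemma ell_cvec: "ell v (cvec x) = of_real (1 - v \<bullet> x)"
  by (simp add: ell_def cvec_def inner_vec_def)

lemma Re_ell: "Re (ell v z) = 1 - v \<bullet> (\<chi> i. Re (z $ i))"
  by (simp add: ell_def inner_vec_def)

lemma mfd_real_iff: "x \<in> mfd_real m b \<longleftrightarrow> (\<forall>i. x $ i \<noteq> 0) \<and> (\<forall>k\<in>{1..m}. b k \<bullet> x \<noteq> 1)"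
  by (auto simp: mfd_real_def mfd_def cstar_def flat_def ell_cvec) (auto simp: cvec_def)

lemma mfd_if_real_part:
  assumes "\<And>i. z $ i \<noteq> 0" "\<And>k. k \<in> {1..m} \<Longrightarrow> b k \<bullet> (\<chi> i. Re (z $ i)) \<noteq> 1"
  shows "z \<in> mfd m b"
proof -
  have "ell (b k) z \<noteq> 0" if "k \<in> {1..m}" for k
    using Re_ell[of "b k" z] assms(2)[OF that] by auto
  then show ?thesis using assms(1) by (auto simp: mfd_def cstar_def flat_def)
qed

definition neg_coords :: "real ^ 'd \<Rightarrow> 'd set" where
  "neg_coords x = {i. x $ i < 0}"

text \<open>
  The hyperplanes that separate \<open>x\<close> from the origin, where every \<open>\<ell>\<^sub>k\<close> is \<open>1\<close>.
\<close>

definition beyond :: "nat \<Rightarrow> (nat \<Rightarrow> real ^ 'd) \<Rightarrow> real ^ 'd \<Rightarrow> nat set" where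
  "beyond m b x = {k \<in> {1..m}. 1 < b k \<bullet> x}"

text \<open>
  Cells are given by sign patterns. As such they are visibly convex, and
  \<open>components_mfd_real\<close> identifies them with the connected components.
\<close>

definition cell :: "nat \<Rightarrow> (nat \<Rightarrow> real ^ 'd) \<Rightarrow> real ^ 'd \<Rightarrow> (real ^ 'd) set" where
  "cell m b x = {y \<in> mfd_real m b. neg_coords y = neg_coords x \<and> beyond m b y = beyond m b x}"

lemma cell_self: "x \<in> mfd_real m b \<Longrightarrow> x \<in> cell m b x"
  by (simp add: cell_def)

lemma cell_subset: "cell m b x \<subseteq> mfd_real m b"
  by (auto simp: cell_def)

lemma cell_eq: "y \<in> cell m b x \<Longrightarrow> cell m b y = cell m b x"
  by (auto simp: cell_def)

lemma cell_iff:
  assumes "x \<in> mfd_real m b"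
  shows "y \<in> cell m b x \<longleftrightarrow>
    (\<forall>i. if x $ i < 0 then y $ i < 0 else 0 < y $ i) \<and>
    (\<forall>k\<in>{1..m}. if 1 < b k \<bullet> x then 1 < b k \<bullet> y else b k \<bullet> y < 1)"
  (is "_ \<longleftrightarrow> ?R")
proof
  assume y: "y \<in> cell m b x"
  then have 1: "y $ i < 0 \<longleftrightarrow> x $ i < 0" "y $ i \<noteq> 0" for i
    by (auto simp: cell_def neg_coords_def mfd_real_iff)
  have 2: "1 < b k \<bullet> y \<longleftrightarrow> 1 < b k \<bullet> x" "b k \<bullet> y \<noteq> 1" if "k \<in> {1..m}" for k
    using y that by (auto simp: cell_def beyond_def mfd_real_iff)
  show ?R
  proof (intro conjI allI ballI)
    show "if x $ i < 0 then y $ i < 0 else 0 < y $ i" for i using 1[of i] by (auto simp: linorder_neq_iff)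
    show "if 1 < b k \<bullet> x then 1 < b k \<bullet> y else b k \<bullet> y < 1" if "k \<in> {1..m}" for k
      using 2[OF that] by (auto simp: linorder_neq_iff)
  qed
next
  assume R: ?R
  then have "if x $ i < 0 then y $ i < 0 else 0 < y $ i" for i by blast
  then have "y $ i < 0 \<longleftrightarrow> x $ i < 0" "y $ i \<noteq> 0" for i
    by (metis less_asym less_irrefl)+
  moreover have "1 < b k \<bullet> y \<longleftrightarrow> 1 < b k \<bullet> x" "b k \<bullet> y \<noteq> 1" if "k \<in> {1..m}" for k
  proof -
    have "if 1 < b k \<bullet> x then 1 < b k \<bullet> y else b k \<bullet> y < 1" using R that by blast
    then show "1 < b k \<bullet> y \<longleftrightarrow> 1 < b k \<bullet> x" "b k \<bullet> y \<noteq> 1" by (auto split: if_splits)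
  qed
  ultimately show "y \<in> cell m b x"
    by (auto simp: cell_def neg_coords_def beyond_def mfd_real_iff)
qed

lemma convex_cell:
  fixes x :: "real ^ 'd"
  assumes "x \<in> mfd_real m b"
  shows "convex (cell m b x)"
proof -
  have eq: "cell m b x = (\<Inter>i. {y. if x $ i < 0 then y $ i < 0 else 0 < y $ i}) \<inter>
     (\<Inter>k\<in>{1..m}. {y. if 1 < b k \<bullet> x then 1 < b k \<bullet> y else b k \<bullet> y < 1})"
  proof (rule Set.set_eqI)
    fix y
    show "y \<in> cell m b x \<longleftrightarrow> y \<in> (\<Inter>i. {y. if x $ i < 0 then y $ i < 0 else 0 < y $ i}) \<inter>
     (\<Inter>k\<in>{1..m}. {y. if 1 < b k \<bullet> x then 1 < b k \<bullet> y else b k \<bullet> y < 1})"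
      by (simp only: cell_iff[OF assms] Int_iff INT_iff mem_Collect_eq ball_UNIV)
  qed
  have "convex {y::real^'d. if x $ i < 0 then y $ i < 0 else 0 < y $ i}" for i
    using convex_halfspace_lt[of "axis i (1::real)" 0] convex_halfspace_gt[of 0 "axis i (1::real)"]
    by (cases "x $ i < 0") (simp_all add: inner_axis' )
  moreover have "convex {y. if 1 < b k \<bullet> x then 1 < b k \<bullet> y else b k \<bullet> y < 1}" for k
    by (cases "1 < b k \<bullet> x") (simp_all add: convex_halfspace_lt convex_halfspace_gt)
  ultimately show ?thesis unfolding eq by (intro convex_Int convex_INT)
qed

text \<open>
  Intermediate values: a continuous function on a connected set that omits the value \<open>c\<close> stays on
  one side of it.
\<close>

lemma connected_avoids:
  fixes f :: "'a::topological_space \<Rightarrow> real"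
  assumes "connected B" "continuous_on B f" "x \<in> B" "y \<in> B" "\<And>z. z \<in> B \<Longrightarrow> f z \<noteq> c"
  shows "c < f y \<longleftrightarrow> c < f x"
proof -
  have "connected (f ` B)" by (rule connected_continuous_image[OF assms(2,1)])
  then have "c \<in> f ` B" if "f u \<le> c" "c \<le> f v" "u \<in> B" "v \<in> B" for u v
    using connectedD_interval[of "f ` B" "f u" "f v" c] that by auto
  then show ?thesis using assms(3-5) by (metis imageE less_eq_real_def not_less)
qed

lemma components_mfd_real:
  "components (mfd_real m b) = cell m b ` mfd_real m b"
proof -
  have *: "connected_component_set (mfd_real m b) x = cell m b x" if x: "x \<in> mfd_real m b" for x
  proof
    show "cell m b x \<subseteq> connected_component_set (mfd_real m b) x"
      by (rule connected_component_maximal[OF cell_self[OF x] convex_connected[OF convex_cell[OF x]] cell_subset])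
    show "connected_component_set (mfd_real m b) x \<subseteq> cell m b x"
    proof
      fix y assume y: "y \<in> connected_component_set (mfd_real m b) x"
      let ?B = "connected_component_set (mfd_real m b) x"
      have B: "connected ?B" "?B \<subseteq> mfd_real m b" "x \<in> ?B"
        using x by (auto simp: connected_component_subset connected_component_refl)
      have ne: "z $ i \<noteq> 0" "k \<in> {1..m} \<Longrightarrow> b k \<bullet> z \<noteq> 1" if "z \<in> ?B" for z i k
        using that B(2) by (auto simp: mfd_real_iff)
      have "0 < y $ i \<longleftrightarrow> 0 < x $ i" for i
        by (rule connected_avoids[OF B(1) _ B(3) y, of "\<lambda>y. y $ i"]) (auto intro!: continuous_intros ne)
      then have "y $ i < 0 \<longleftrightarrow> x $ i < 0" for i
        using ne(1)[OF y, of i] ne(1)[OF B(3), of i] by (metis linorder_neqE less_asym)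
      moreover have "1 < b k \<bullet> y \<longleftrightarrow> 1 < b k \<bullet> x" if "k \<in> {1..m}" for k
        by (rule connected_avoids[OF B(1) _ B(3) y, of "\<lambda>y. b k \<bullet> y"]) (use ne(2)[OF _ that] in \<open>auto intro!: continuous_intros\<close>)
      moreover have "y \<in> mfd_real m b" using y B(2) by auto
      ultimately show "y \<in> cell m b x"
        by (auto simp: cell_def neg_coords_def beyond_def)
    qed
  qed
  then show ?thesis by (auto simp: components_def)
qed

lemma finite_components_mfd_real: "finite (components (mfd_real m b :: (real ^ 'd::finite) set))"
proof -
  have "components (mfd_real m b) \<subseteq> (\<lambda>(N, K). {y \<in> mfd_real m b. neg_coords y = N \<and> beyond m b y = K})
      ` (UNIV \<times> Pow {1..m})"
  proof
    fix B assume "B \<in> components (mfd_real m b)"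
    then obtain x where "B = cell m b x" by (auto simp: components_mfd_real)
    then show "B \<in> (\<lambda>(N, K). {y \<in> mfd_real m b. neg_coords y = N \<and> beyond m b y = K}) ` (UNIV \<times> Pow {1..m})"
      by (intro image_eqI[of _ _ "(neg_coords x, beyond m b x)"]) (auto simp: cell_def beyond_def)
  qed
  then show ?thesis by (rule finite_subset) simp
qed

lemma component_SOME:
  assumes "B \<in> components (mfd_real m b)"
  shows "(SOME x. x \<in> B) \<in> mfd_real m b" "B = cell m b (SOME x. x \<in> B)"
proof -
  obtain x where x: "x \<in> mfd_real m b" "B = cell m b x" using assms by (auto simp: components_mfd_real)
  then have "(SOME x. x \<in> B) \<in> cell m b x" using someI[of "\<lambda>x. x \<in> B" x] cell_self by metis
  then show "(SOME x. x \<in> B) \<in> mfd_real m b" "B = cell m b (SOME x. x \<in> B)"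
    using cell_subset x(2) cell_eq by blast+
qed

lemma open_segment_norm_ge:
  fixes u v s :: real
  assumes "u * v > 0" "0 \<le> s" "s \<le> 1"
  shows "min \<bar>u\<bar> \<bar>v\<bar> \<le> \<bar>(1 - s) * u + s * v\<bar>"
proof -
  have "min \<bar>u\<bar> \<bar>v\<bar> = (1 - s) * min \<bar>u\<bar> \<bar>v\<bar> + s * min \<bar>u\<bar> \<bar>v\<bar>" by (simp add: algebra_simps)
  also have "\<dots> \<le> (1 - s) * \<bar>u\<bar> + s * \<bar>v\<bar>" using assms by (intro add_mono mult_left_mono) auto
  also have "\<dots> = \<bar>(1 - s) * u + s * v\<bar>"
  proof (cases "u > 0")
    case True
    then have "0 \<le> (1 - s) * u + s * v" "v > 0" using assms by (auto simp: zero_less_mult_iff)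
    then show ?thesis using True by simp
  next
    case False
    then have uv: "u < 0" "v < 0" using assms by (auto simp: zero_less_mult_iff)
    then have "(1 - s) * u + s * v \<le> 0" using assms by (intro add_nonpos_nonpos mult_nonneg_nonpos) auto
    then show ?thesis using uv by simp
  qed
  finally show ?thesis .
qed

locale direction =
  fixes r :: "real ^ 'd::{finite,linorder}"
  assumes r_pos: "\<And>i. 0 < r $ i" and r_sum: "(\<Sum>i\<in>UNIV. r $ i) = 1"
begin

text \<open>
  All coefficients of \<open>r\<close> are positive, so one large coordinate pushes the height to \<open>-\<infinity>\<close> as long
  as the others are bounded away from zero.
\<close>

lemma far_points_are_low:
  assumes "0 < \<delta>"
  shows "\<exists>R0>0. \<forall>z. (\<forall>k. \<delta> \<le> cmod (z $ k)) \<longrightarrow> (\<exists>k. R0 \<le> cmod (z $ k)) \<longrightarrow> height r z \<le> a"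
proof -
  define \<rho> where "\<rho> = Min (range (($) r))"
  define \<delta>' where "\<delta>' = min \<delta> 1"
  define R0 where "R0 = max 1 (exp ((- ln \<delta>' - a) / \<rho>))"
  have \<rho>: "0 < \<rho>" "\<And>i. \<rho> \<le> r $ i" using r_pos by (auto simp: \<rho>_def)
  have \<delta>': "0 < \<delta>'" "\<delta>' \<le> \<delta>" "ln \<delta>' \<le> 0" using assms by (auto simp: \<delta>'_def)
  have "(- ln \<delta>' - a) / \<rho> \<le> ln R0"
    unfolding R0_def by (subst ln_exp[symmetric]) (intro ln_mono, auto)
  then have R0: "- ln \<delta>' - a \<le> \<rho> * ln R0" "1 \<le> R0" using \<rho> by (auto simp: field_simps R0_def)
  have "height r z \<le> a" if z: "\<And>k. \<delta> \<le> cmod (z $ k)" "R0 \<le> cmod (z $ k0)" for z k0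
  proof -
    have "\<rho> * ln R0 \<le> r $ k0 * ln (cmod (z $ k0))"
      using \<rho> R0 z(2) by (intro mult_mono ln_mono less_imp_le[OF r_pos]) auto
    moreover have "(\<Sum>i\<in>UNIV - {k0}. r $ i) * ln \<delta>' \<le> (\<Sum>i\<in>UNIV - {k0}. r $ i * ln (cmod (z $ i)))"
      unfolding sum_distrib_right
    proof (intro sum_mono mult_left_mono less_imp_le[OF r_pos])
      fix i show "ln \<delta>' \<le> ln (cmod (z $ i))"
        using \<delta>' z(1)[of i] by (intro ln_mono) auto
    qed
    moreover have "ln \<delta>' \<le> (\<Sum>i\<in>UNIV - {k0}. r $ i) * ln \<delta>'"
    proof -
      have "(\<Sum>i\<in>UNIV - {k0}. r $ i) \<le> 1" using r_pos[of k0] r_sum by (simp add: sum_diff1)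
      then show ?thesis using \<delta>'(3) mult_right_mono_neg by fastforce
    qed
    ultimately have "- a \<le> (\<Sum>i\<in>UNIV. r $ i * ln (cmod (z $ i)))"
      using R0(1) by (simp add: sum.remove[of UNIV k0])
    then show ?thesis by (simp add: height_def)
  qed
  then show ?thesis using R0(2) by (intro exI[of _ R0]) auto
qed

text \<open>
  Moving the real part along the segment from \<open>x\<close> to \<open>y\<close>, and the truncation from \<open>R\<close> to \<open>R'\<close>, sweeps out
  a cube whose remaining faces have a coordinate with large imaginary part. The segment stays in
  the convex cell, so the coordinates are bounded away from zero.
\<close>

lemma fiber_homologous:
  assumes x: "x \<in> mfd_real m b" and y: "y \<in> cell m b x"
  shows "\<exists>R0. \<forall>R\<ge>R0. \<forall>R'\<ge>R0. homologous_rel CARD('d) (top_of_set (mfd m b)) (mfd_le m b r a)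
           (fiber_chain x R) (fiber_chain y R')"
proof -
  define \<delta> where "\<delta> = Min (range (\<lambda>i. min \<bar>x $ i\<bar> \<bar>y $ i\<bar>))"
  have ymfd: "y \<in> mfd_real m b" using y cell_subset by auto
  have xy: "x $ i * y $ i > 0" for i
  proof -
    have "if x $ i < 0 then y $ i < 0 else 0 < y $ i" using y unfolding cell_iff[OF x] by blast
    moreover have "x $ i \<noteq> 0" using x by (simp add: mfd_real_iff)
    ultimately show ?thesis by (auto simp: zero_less_mult_iff split: if_splits)
  qed
  have "0 < \<delta>" using x ymfd by (auto simp: \<delta>_def mfd_real_iff)
  from far_points_are_low[OF this] obtain R0 where R0: "0 < R0"
    "\<And>z k. (\<And>k. \<delta> \<le> cmod (z $ k)) \<Longrightarrow> R0 \<le> cmod (z $ k) \<Longrightarrow> height r z \<le> a" by meson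
  show ?thesis
  proof (intro exI[of _ R0] allI impI)
    fix R R' assume R: "R \<ge> R0" "R' \<ge> R0"
    define F where "F = (\<lambda>t. \<chi> k::'d. Complex ((1 - t 0) * x $ k + t 0 * y $ k)
       (((1 - t 0) * R + t 0 * R') * (2 * t (Suc (card {..<k})) - 1)))"
    have t0: "0 \<le> t 0" "t 0 \<le> 1" if "t \<in> unit_cube" for t using that by (auto simp: unit_cube_def)
    have F\<delta>: "\<delta> \<le> cmod (F t $ k)" if "t \<in> unit_cube" for t k
    proof -
      have "\<delta> \<le> min \<bar>x $ k\<bar> \<bar>y $ k\<bar>" unfolding \<delta>_def by (rule Min_le) auto
      also have "\<dots> \<le> \<bar>Re (F t $ k)\<bar>"
        using open_segment_norm_ge[OF xy[of k] t0[OF that]] by (simp add: F_def)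
      also have "\<dots> \<le> cmod (F t $ k)" by (rule abs_Re_le_cmod)
      finally show ?thesis .
    qed
    have Fmfd: "F t \<in> mfd m b" if "t \<in> unit_cube" for t
    proof (rule mfd_if_real_part)
      show "F t $ i \<noteq> 0" for i using F\<delta>[OF that, of i] \<open>0 < \<delta>\<close> by auto
      have "(\<chi> i. Re (F t $ i)) = (1 - t 0) *\<^sub>R x + t 0 *\<^sub>R y" by (simp add: F_def vec_eq_iff)
      also have "\<dots> \<in> cell m b x"
        using convexD[OF convex_cell[OF x] cell_self[OF x] y, of "1 - t 0" "t 0"] t0[OF that] by simp
      finally show "k \<in> {1..m} \<Longrightarrow> b k \<bullet> (\<chi> i. Re (F t $ i)) \<noteq> 1" for k
        using cell_subset mfd_real_iff by blast
    qed
    have "singular_relboundary CARD('d) (top_of_set (mfd m b)) (mfd_le m b r a)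
       (\<Sum>j\<in>{0}. frag_cmul ((-1) ^ j)
         (cube_map CARD('d) (F \<circ> insert_coord j 1) - cube_map CARD('d) (F \<circ> insert_coord j 0)))"
    proof (rule cube_faces_relation)
      show "continuous_on unit_cube F"
        unfolding F_def
        by (intro continuous_intros continuous_on_subset[OF continuous_on_product_coordinates]) auto
      show "F ` unit_cube \<subseteq> mfd m b" using Fmfd by auto
      fix j assume j: "j \<le> CARD('d)" "j \<notin> {0::nat}"
      then have "j - 1 < CARD('d)" by auto
      then obtain k :: 'd where k: "card {..<k} = j - 1" using coord_index_surj by blast
      have "F (insert_coord j c t) \<in> mfd_le m b r a" if t: "t \<in> unit_cube" and c: "c \<in> {0, 1}" for t c
      proof -
        have tc: "insert_coord j c t \<in> unit_cube" using t c by (intro insert_coord_unit_cube) auto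
        have "F (insert_coord j c t) $ k = Complex ((1 - t 0) * x $ k + t 0 * y $ k)
            (((1 - t 0) * R + t 0 * R') * (2 * c - 1))"
          using j by (simp add: F_def insert_coord_def k)
        then have "\<bar>Im (F (insert_coord j c t) $ k)\<bar> = \<bar>(1 - t 0) * R + t 0 * R'\<bar>"
          using c by auto
        moreover have "R0 \<le> (1 - t 0) * R + t 0 * R'"
          using convex_bound_le[of "-R" "-R0" "-R'" "1 - t 0" "t 0"] R t0[OF t] by simp
        ultimately have "R0 \<le> cmod (F (insert_coord j c t) $ k)"
          using abs_Im_le_cmod[of "F (insert_coord j c t) $ k"] by linarith
        then show ?thesis using R0(2)[OF F\<delta>[OF tc]] Fmfd[OF tc] by (simp add: mfd_le_def)
      qed
      then show "(\<forall>t\<in>unit_cube. F (insert_coord j 0 t) = F (insert_coord j 1 t)) \<or>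
        (\<forall>t\<in>unit_cube. F (insert_coord j 0 t) \<in> mfd_le m b r a \<and> F (insert_coord j 1 t) \<in> mfd_le m b r a)"
        by blast
    qed simp
    moreover have "cube_map CARD('d) (F \<circ> insert_coord 0 0) = fiber_chain x R"
      "cube_map CARD('d) (F \<circ> insert_coord 0 1) = fiber_chain y R'"
      unfolding fiber_chain_def
      by (rule cube_map_cong; simp add: F_def insert_coord_def coord_def vec_eq_iff)+
    ultimately show "homologous_rel CARD('d) (top_of_set (mfd m b)) (mfd_le m b r a)
           (fiber_chain x R) (fiber_chain y R')"
      by (simp add: homologous_rel_def flip: singular_relboundary_minus[of _ _ _ "fiber_chain x R - _"])
  qed
qed

lemma fiber_in_mfd:
  assumes x: "x \<in> mfd_real m b"
  shows "(\<chi> k. Complex (x $ k) (s k)) \<in> mfd m b"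
proof (rule mfd_if_real_part)
  show "(\<chi> k. Complex (x $ k) (s k)) $ i \<noteq> 0" for i using x by (auto simp: mfd_real_iff complex_eq_iff)
  show "k \<in> {1..m} \<Longrightarrow> b k \<bullet> (\<chi> i. Re ((\<chi> k. Complex (x $ k) (s k)) $ i)) \<noteq> 1" for k
    using x by (simp add: mfd_real_iff)
qed

lemma continuous_on_fiber:
  "continuous_on S (\<lambda>t. \<chi> k::'d. Complex (x $ k) (R * (2 * coord t k - 1)))"
  unfolding coord_def
  by (intro continuous_intros continuous_on_subset[OF continuous_on_product_coordinates]) auto

lemma fiber_relcycle:
  assumes x: "x \<in> mfd_real m b"
  shows "\<exists>R0. \<forall>R\<ge>R0. singular_relcycle CARD('d) (top_of_set (mfd m b)) (mfd_le m b r a) (fiber_chain x R)"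
proof -
  define \<delta> where "\<delta> = Min (range (\<lambda>i. \<bar>x $ i\<bar>))"
  have "0 < \<delta>" using x by (auto simp: \<delta>_def mfd_real_iff)
  from far_points_are_low[OF this] obtain R0 where R0: "0 < R0"
    "\<And>z k. (\<And>k. \<delta> \<le> cmod (z $ k)) \<Longrightarrow> R0 \<le> cmod (z $ k) \<Longrightarrow> height r z \<le> a" by meson
  obtain n where n: "CARD('d) = Suc n" using zero_less_card_finite gr0_implies_Suc by blast
  show ?thesis
  proof (intro exI[of _ R0] allI impI)
    fix R assume R: "R \<ge> R0"
    let ?f = "\<lambda>t. \<chi> k::'d. Complex (x $ k) (R * (2 * coord t k - 1))"
    have "singular_relcycle (Suc n) (top_of_set (mfd m b)) (mfd_le m b r a) (cube_map (Suc n) ?f)"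
    proof (rule cube_map_relcycle[OF continuous_on_fiber])
      show "?f ` unit_cube \<subseteq> mfd m b" by (rule image_subsetI) (rule fiber_in_mfd[OF x])
      fix j t and c :: real assume j: "j \<le> n" and c: "c \<in> {0, 1}"
      obtain k :: 'd where k: "card {..<k} = j" using coord_index_surj[of j, where ?'d = 'd] j n by auto
      have "\<delta> \<le> cmod (?f (insert_coord j c t) $ i)" for i
      proof -
        have "\<delta> \<le> \<bar>x $ i\<bar>" unfolding \<delta>_def by (rule Min_le) auto
        also have "\<dots> \<le> cmod (?f (insert_coord j c t) $ i)"
          using abs_Re_le_cmod[of "?f (insert_coord j c t) $ i"] by simp
        finally show ?thesis .
      qed
      moreover have "R0 \<le> cmod (?f (insert_coord j c t) $ k)"
        using abs_Im_le_cmod[of "?f (insert_coord j c t) $ k"] R c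
        by (auto simp: coord_def k insert_coord_def)
      ultimately show "?f (insert_coord j c t) \<in> mfd_le m b r a"
        using R0(2)[of "?f (insert_coord j c t)" k] fiber_in_mfd[OF x] by (simp add: mfd_le_def)
    qed
    then show "singular_relcycle CARD('d) (top_of_set (mfd m b)) (mfd_le m b r a) (fiber_chain x R)"
      by (simp add: fiber_chain_def n)
  qed
qed

text \<open>
  The height on a fiber is largest at its real point.
\<close>

lemma low_fiber_null:
  assumes x: "x \<in> mfd_real m b" and low: "height r (cvec x) \<le> a"
  shows "singular_relboundary CARD('d) (top_of_set (mfd m b)) (mfd_le m b r a) (fiber_chain x R)"
  unfolding fiber_chain_def
proof (rule cube_map_relboundary[OF continuous_on_fiber])
  have "height r (\<chi> k. Complex (x $ k) (s k)) \<le> a" for s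
  proof -
    have "height r (\<chi> k. Complex (x $ k) (s k)) \<le> height r (cvec x)"
      unfolding height_def neg_le_iff_le
    proof (intro sum_mono mult_left_mono less_imp_le[OF r_pos])
      fix i
      show "ln (cmod (cvec x $ i)) \<le> ln (cmod ((\<chi> k. Complex (x $ k) (s k)) $ i))"
        using x abs_Re_le_cmod[of "Complex (x $ i) (s i)"]
        by (intro ln_mono) (auto simp: cvec_def mfd_real_iff complex_eq_iff)
    qed
    with low show ?thesis by simp
  qed
  then show "(\<lambda>t. \<chi> k. Complex (x $ k) (R * (2 * coord t k - 1))) ` unit_cube \<subseteq> mfd m b \<inter> mfd_le m b r a"
    using fiber_in_mfd[OF x] by (auto simp: mfd_le_def)
qed

text \<open>
  Far points of the cell may be close to a coordinate hyperplane, which raises the height. The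
  midpoint between such a point and the fixed point \<open>x\<close> is still far away, and each of its
  coordinates is at least half as large as that of \<open>x\<close>.
\<close>

lemma unbounded_cell_low_point:
  assumes x: "x \<in> mfd_real m b" and unb: "\<not> bounded (cell m b x)"
  shows "\<exists>y\<in>cell m b x. height r (cvec y) \<le> a"
proof -
  define \<delta> where "\<delta> = Min (range (\<lambda>i. \<bar>x $ i\<bar> / 2))"
  have "0 < \<delta>" using x by (auto simp: \<delta>_def mfd_real_iff)
  from far_points_are_low[OF this] obtain R0 where R0: "0 < R0"
    "\<And>z k. (\<And>k. \<delta> \<le> cmod (z $ k)) \<Longrightarrow> R0 \<le> cmod (z $ k) \<Longrightarrow> height r z \<le> a" by meson
  have "\<exists>y\<in>cell m b x. \<exists>k. 2 * R0 \<le> \<bar>y $ k\<bar>"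
  proof (rule ccontr)
    assume "\<not> ?thesis"
    then have *: "\<bar>y $ k\<bar> \<le> 2 * R0" if "y \<in> cell m b x" for y k
      using that by (meson linorder_le_cases)
    have "norm y \<le> of_nat CARD('d) * (2 * R0)" if "y \<in> cell m b x" for y
      using norm_le_l1_cart[of y] sum_bounded_above[of UNIV "\<lambda>i. \<bar>y $ i\<bar>" "2 * R0"] *[OF that] by simp
    then show False using unb by (auto simp: bounded_iff)
  qed
  then obtain y k where y: "y \<in> cell m b x" "2 * R0 \<le> \<bar>y $ k\<bar>" by blast
  define z where "z = (1/2) *\<^sub>R x + (1/2) *\<^sub>R y"
  have "z \<in> cell m b x"
    unfolding z_def using convexD[OF convex_cell[OF x] cell_self[OF x] y(1), of "1/2" "1/2"] by simp
  have abs: "\<bar>z $ i\<bar> = \<bar>x $ i\<bar> / 2 + \<bar>y $ i\<bar> / 2" for i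
  proof -
    have "if x $ i < 0 then y $ i < 0 else 0 < y $ i" using y(1) unfolding cell_iff[OF x] by blast
    moreover have "x $ i \<noteq> 0" using x by (simp add: mfd_real_iff)
    moreover have "z $ i = x $ i / 2 + y $ i / 2" by (simp add: z_def)
    ultimately show ?thesis by (cases "x $ i < 0") (auto simp: abs_if)
  qed
  have "\<delta> \<le> \<bar>x $ i\<bar> / 2" for i unfolding \<delta>_def by (rule Min_le) auto
  then have "\<delta> \<le> cmod (cvec z $ i)" for i
    using abs[of i] by (simp add: cvec_def add_increasing2)
  moreover have "R0 \<le> cmod (cvec z $ k)" using abs[of k] y(2) by (simp add: cvec_def)
  ultimately have "height r (cvec z) \<le> a" by (rule R0(2))
  with \<open>z \<in> cell m b x\<close> show ?thesis by blast
qed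

lemma fiber_unbounded_cell_null:
  assumes x: "x \<in> mfd_real m b" and unb: "\<not> bounded (cell m b x)"
  shows "\<exists>R0. \<forall>R\<ge>R0. singular_relboundary CARD('d) (top_of_set (mfd m b)) (mfd_le m b r a) (fiber_chain x R)"
proof -
  obtain y where y: "y \<in> cell m b x" "height r (cvec y) \<le> a" using unbounded_cell_low_point[OF assms] by blast
  have ymfd: "y \<in> mfd_real m b" using y(1) cell_subset by blast
  obtain R0 where "\<And>R. R \<ge> R0 \<Longrightarrow> homologous_rel CARD('d) (top_of_set (mfd m b)) (mfd_le m b r a)
      (fiber_chain x R) (fiber_chain y R)"
    using fiber_homologous[OF x y(1)] by blast
  then show ?thesis
    using low_fiber_null[OF ymfd y(2)] homologous_rel_0_iff homologous_rel_trans by blast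
qed

text \<open>
  The truncated fibers are eventually homologous to each other, so the description in
  \<^const>\<open>fiber_class\<close> denotes their common class.
\<close>

lemma fiber_class_eq:
  assumes x: "x \<in> mfd_real m b"
  shows "\<exists>R0. \<forall>R\<ge>R0. fiber_class m b r a x = hclass m b r a (fiber_chain x R)"
proof -
  obtain R0 where R0: "\<And>R R'. R \<ge> R0 \<Longrightarrow> R' \<ge> R0 \<Longrightarrow>
      homologous_rel CARD('d) (top_of_set (mfd m b)) (mfd_le m b r a) (fiber_chain x R) (fiber_chain x R')"
    using fiber_homologous[OF x cell_self[OF x]] by blast
  have eq: "hclass m b r a (fiber_chain x R) = hclass m b r a (fiber_chain x R0)" if "R \<ge> R0" for R
    unfolding hclass_def homologous_rel_set_eq using R0[OF that] by simp
  have "fiber_class m b r a x = hclass m b r a (fiber_chain x R0)"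
    unfolding fiber_class_def
  proof (rule the_equality)
    show "\<forall>\<^sub>F R in at_top. hclass m b r a (fiber_chain x R) = hclass m b r a (fiber_chain x R0)"
      using eq eventually_at_top_linorder by blast
    fix C assume "\<forall>\<^sub>F R in at_top. hclass m b r a (fiber_chain x R) = C"
    then obtain R1 where "\<And>R. R \<ge> R1 \<Longrightarrow> hclass m b r a (fiber_chain x R) = C"
      by (auto simp: eventually_at_top_linorder)
    then show "C = hclass m b r a (fiber_chain x R0)" using eq[of "max R0 R1"] by simp
  qed
  then show ?thesis using eq by metis
qed

end

section \<open>Linear algebra of simple arrangements\<close>

text \<open>
  The component of \<open>b k\<close> orthogonal to the span of the other vectors, suitably scaled.
\<close>

lemma dual_vector:
  fixes b :: "nat \<Rightarrow> 'a::euclidean_space"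
  assumes "inj_on b S" "independent (b ` S)" "k \<in> S"
  shows "\<exists>q. b k \<bullet> q = 1 \<and> (\<forall>j\<in>S - {k}. b j \<bullet> q = 0)"
proof -
  obtain y z where y: "y \<in> span (b ` (S - {k}))"
    and z: "\<And>w. w \<in> span (b ` (S - {k})) \<Longrightarrow> orthogonal z w" and eq: "b k = y + z"
    using orthogonal_subspace_decomp_exists by metis
  have "b ` (S - {k}) = b ` S - {b k}" using assms by (auto simp: inj_on_def)
  then have "b k \<notin> span (b ` (S - {k}))" using assms unfolding dependent_def by auto
  then have "z \<noteq> 0" using y eq by auto
  moreover have "y \<bullet> z = 0" using z[OF y] by (simp add: orthogonal_def inner_commute)
  ultimately have "b k \<bullet> ((1 / (z \<bullet> z)) *\<^sub>R z) = 1" by (simp add: eq inner_add_left)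
  moreover have "b j \<bullet> ((1 / (z \<bullet> z)) *\<^sub>R z) = 0" if "j \<in> S - {k}" for j
    using z[of "b j"] that by (simp add: orthogonal_def inner_commute span_base)
  ultimately show ?thesis by blast
qed

lemma span_if_orthogonal:
  fixes w :: "'a::euclidean_space"
  assumes "\<And>q. (\<And>v. v \<in> V \<Longrightarrow> v \<bullet> q = 0) \<Longrightarrow> w \<bullet> q = 0"
  shows "w \<in> span V"
proof -
  obtain y z where y: "y \<in> span V" and z: "\<And>w. w \<in> span V \<Longrightarrow> orthogonal z w" and eq: "w = y + z"
    using orthogonal_subspace_decomp_exists by metis
  have "w \<bullet> z = 0" using z by (intro assms) (simp add: orthogonal_def inner_commute span_base)
  moreover have "y \<bullet> z = 0" using z[OF y] by (simp add: orthogonal_def inner_commute)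
  ultimately have "z = 0" by (simp add: eq inner_add_left)
  then show ?thesis using y eq by simp
qed

text \<open>
  Farkas' lemma for linearly independent constraints, where dual vectors test the sign of each
  coefficient separately.
\<close>

lemma nonneg_combination:
  fixes b :: "nat \<Rightarrow> 'a::euclidean_space"
  assumes "finite S" "inj_on b S" "independent (b ` S)"
    and polar: "\<And>v. (\<And>k. k \<in> S \<Longrightarrow> b k \<bullet> v \<le> 0) \<Longrightarrow> w \<bullet> v \<le> 0"
  shows "\<exists>a. (\<forall>k\<in>S. 0 \<le> a k) \<and> w = (\<Sum>k\<in>S. a k *\<^sub>R b k)"
proof -
  have "w \<in> span (b ` S)"
  proof (rule span_if_orthogonal)
    fix q assume q: "\<And>v. v \<in> b ` S \<Longrightarrow> v \<bullet> q = 0"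
    have "w \<bullet> q \<le> 0" "w \<bullet> (- q) \<le> 0" by (rule polar; use q in force)+
    then show "w \<bullet> q = 0" by simp
  qed
  then obtain u where "w = (\<Sum>v\<in>b ` S. u v *\<^sub>R v)"
    using assms(1) by (auto simp: span_finite)
  then have w: "w = (\<Sum>k\<in>S. u (b k) *\<^sub>R b k)" by (simp add: sum.reindex[OF assms(2)])
  have "0 \<le> u (b k)" if k: "k \<in> S" for k
  proof -
    obtain q where q: "b k \<bullet> q = 1" "\<And>j. j \<in> S - {k} \<Longrightarrow> b j \<bullet> q = 0"
      using dual_vector[OF assms(2,3) k] by blast
    have "b j \<bullet> (- q) \<le> 0" if "j \<in> S" for j using q that by (cases "j = k") auto
    then have "w \<bullet> (- q) \<le> 0" by (rule polar)
    moreover have "w \<bullet> q = (\<Sum>j\<in>S. if j = k then u (b k) else 0)"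
      unfolding w inner_sum_left using q by (intro sum.cong) auto
    ultimately show ?thesis using k assms(1) by simp
  qed
  then show ?thesis using w by (intro exI[of _ "\<lambda>k. u (b k)"]) simp
qed

text \<open>
  Adding or removing \<open>\<kappa> T\<close> is a sign-reversing involution, provided that \<open>\<kappa>\<close> does not notice the
  change.
\<close>

lemma signed_sum_toggle:
  fixes Z :: "'a set set"
  assumes fin: "\<And>T. T \<in> Z \<Longrightarrow> finite T"
    and Z: "\<And>T. T \<in> Z \<Longrightarrow> insert (\<kappa> T) T \<in> Z" "\<And>T. T \<in> Z \<Longrightarrow> T - {\<kappa> T} \<in> Z"
    and \<kappa>: "\<And>T. T \<in> Z \<Longrightarrow> \<kappa> (insert (\<kappa> T) T) = \<kappa> T" "\<And>T. T \<in> Z \<Longrightarrow> \<kappa> (T - {\<kappa> T}) = \<kappa> T"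
  shows "(\<Sum>T\<in>Z. (-1) ^ card T) = (0::int)"
proof -
  let ?f = "\<lambda>T. if \<kappa> T \<in> T then T - {\<kappa> T} else insert (\<kappa> T) T"
  have inv: "?f (?f T) = T" if "T \<in> Z" for T
    using \<kappa>[OF that] by (auto simp: insert_absorb)
  have Zf: "?f T \<in> Z" if "T \<in> Z" for T using Z[OF that] by simp
  have "(\<Sum>T\<in>Z. (-1) ^ card T) = (\<Sum>T\<in>Z. - ((-1::int) ^ card T))"
  proof (rule sum.reindex_bij_witness[where i = ?f and j = ?f])
    fix T assume T: "T \<in> Z"
    show "- ((-1::int) ^ card (?f T)) = (-1) ^ card T"
    proof (cases "\<kappa> T \<in> T")
      case True
      have "card T = Suc (card (T - {\<kappa> T}))" by (rule card.remove[OF fin[OF T] True])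
      then have "(-1::int) ^ card T = - ((-1) ^ card (T - {\<kappa> T}))" by (simp only: power_Suc mult_minus1)
      then show ?thesis using True by simp
    next
      case False
      then show ?thesis using fin[OF T] by simp
    qed
  qed (use inv Zf in auto)
  then show ?thesis by (simp add: sum_negf)
qed

section \<open>The height function on orthants\<close>

lemma cvec_inject [simp]: "cvec x = cvec y \<longleftrightarrow> x = y"
  by (auto simp: cvec_def vec_eq_iff)

definition orthant :: "'d set \<Rightarrow> (real ^ 'd) set" where
  "orthant N = {x. \<forall>i. if i \<in> N then x $ i < 0 else 0 < x $ i}"

lemma orthantD: "x \<in> orthant N \<Longrightarrow> (if i \<in> N then x $ i < 0 else 0 < x $ i)" "x \<in> orthant N \<Longrightarrow> x $ i \<noteq> 0"
  unfolding orthant_def mem_Collect_eq by blast (metis less_irrefl)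

lemma convex_orthant: "convex (orthant N :: (real ^ 'd::finite) set)"
proof -
  have eq: "orthant N = (\<Inter>i. {x::real^'d. if i \<in> N then x $ i < 0 else 0 < x $ i})" by (auto simp: orthant_def)
  have "convex {y::real^'d. if i \<in> N then y $ i < 0 else 0 < y $ i}" for i
    using convex_halfspace_lt[of "axis i (1::real)" 0] convex_halfspace_gt[of 0 "axis i (1::real)"]
    by (cases "i \<in> N") (simp_all add: inner_axis')
  then show ?thesis unfolding eq by (intro convex_INT)
qed

lemma incident_cvec: "incident m b (cvec x) = {k \<in> {1..m}. b k \<bullet> x = 1}"
  by (auto simp: incident_def ell_cvec)

context direction
begin

text \<open>
  The height at the real point \<^term>\<open>cvec x\<close>.
\<close>

definition real_height :: "(real, 'd) vec \<Rightarrow> real" where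
  "real_height x = - (\<Sum>i\<in>UNIV. r $ i * ln \<bar>x $ i\<bar>)"

text \<open>
  The negative gradient of \<^term>\<open>real_height\<close>.
\<close>

definition descent :: "(real, 'd) vec \<Rightarrow> (real, 'd) vec" where
  "descent x = (\<chi> i. r $ i / x $ i)"

text \<open>
  Strict convexity in its tangent form. Coordinate by coordinate it is \<open>ln u \<le> u - 1\<close> for the
  quotient \<open>u\<close> of the coordinates, with equality only for \<open>u = 1\<close>.
\<close>

lemma real_height_gradient:
  assumes "x \<in> orthant N" "y \<in> orthant N"
  shows "real_height x - descent x \<bullet> (y - x) \<le> real_height y"
    and "y \<noteq> x \<Longrightarrow> real_height x - descent x \<bullet> (y - x) < real_height y"
proof -
  let ?t = "\<lambda>i. r $ i * (y $ i / x $ i - 1)" and ?l = "\<lambda>i. r $ i * ln (y $ i / x $ i)"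
  have pos: "0 < y $ i / x $ i" for i
    using orthantD(1)[OF assms(1), of i] orthantD(1)[OF assms(2), of i]
    by (auto simp: zero_less_divide_iff split: if_splits)
  have ln: "ln (y $ i / x $ i) = ln \<bar>y $ i\<bar> - ln \<bar>x $ i\<bar>" for i
  proof -
    have "y $ i / x $ i = \<bar>y $ i\<bar> / \<bar>x $ i\<bar>" using pos[of i] by (simp flip: abs_divide)
    then show ?thesis
      using orthantD(2)[OF assms(1), of i] orthantD(2)[OF assms(2), of i] by (simp add: ln_div)
  qed
  have 1: "descent x \<bullet> (y - x) = (\<Sum>i\<in>UNIV. ?t i)"
    unfolding descent_def inner_vec_def
    using orthantD(2)[OF assms(1)] by (intro sum.cong) (auto simp: field_simps)
  have 2: "real_height x - real_height y = (\<Sum>i\<in>UNIV. ?l i)"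
    unfolding real_height_def ln by (simp add: algebra_simps sum_subtractf)
  have le: "?l i \<le> ?t i" for i
    using ln_le_minus_one[OF pos[of i]] r_pos[of i] by (intro mult_left_mono) auto
  show "real_height x - descent x \<bullet> (y - x) \<le> real_height y"
    using sum_mono[of UNIV ?l ?t, OF le] 1 2 by simp
  assume "y \<noteq> x"
  then obtain i where i: "y $ i \<noteq> x $ i" by (auto simp: vec_eq_iff)
  then have "y $ i / x $ i \<noteq> 1" using orthantD(2)[OF assms(1), of i] by auto
  then have "ln (y $ i / x $ i) < y $ i / x $ i - 1"
    using ln_le_minus_one[OF pos[of i]] ln_eq_minus_one[OF pos[of i]] by linarith
  then have "?l i < ?t i" using r_pos[of i] by simp
  then have "(\<Sum>i\<in>UNIV. ?l i) < (\<Sum>i\<in>UNIV. ?t i)"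
    using le by (intro sum_strict_mono_ex1) auto
  then show "real_height x - descent x \<bullet> (y - x) < real_height y" using 1 2 by simp
qed

lemma real_height_convex:
  assumes xy: "x \<in> orthant N" "y \<in> orthant N" and t: "0 \<le> t" "t \<le> 1"
  shows "real_height ((1 - t) *\<^sub>R x + t *\<^sub>R y) \<le> (1 - t) * real_height x + t * real_height y"
    and "x \<noteq> y \<Longrightarrow> 0 < t \<Longrightarrow> t < 1 \<Longrightarrow> real_height ((1 - t) *\<^sub>R x + t *\<^sub>R y) < (1 - t) * real_height x + t * real_height y"
proof -
  define z where "z = (1 - t) *\<^sub>R x + t *\<^sub>R y"
  have z: "z \<in> orthant N" unfolding z_def using convexD[OF convex_orthant xy, of "1 - t" t] t by simp
  have 0: "(1 - t) * (descent z \<bullet> (x - z)) + t * (descent z \<bullet> (y - z)) = 0"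
  proof -
    have "(1 - t) *\<^sub>R (x - z) + t *\<^sub>R (y - z) = 0" by (simp add: z_def algebra_simps)
    then have "descent z \<bullet> ((1 - t) *\<^sub>R (x - z) + t *\<^sub>R (y - z)) = 0" by simp
    then show ?thesis by (simp only: inner_add_right inner_scaleR_right)
  qed
  have "(1 - t) * (real_height z - descent z \<bullet> (x - z)) + t * (real_height z - descent z \<bullet> (y - z)) \<le> (1 - t) * real_height x + t * real_height y"
    using real_height_gradient(1)[OF z xy(1)] real_height_gradient(1)[OF z xy(2)] t by (intro add_mono mult_left_mono) auto
  then show "real_height z \<le> (1 - t) * real_height x + t * real_height y" using 0 by (simp add: algebra_simps)
  assume s: "x \<noteq> y" "0 < t" "t < 1"
  have "z - x = t *\<^sub>R (y - x)" by (simp add: z_def algebra_simps)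
  then have "x \<noteq> z" using s by auto
  then have "(1 - t) * (real_height z - descent z \<bullet> (x - z)) + t * (real_height z - descent z \<bullet> (y - z)) < (1 - t) * real_height x + t * real_height y"
    using real_height_gradient(2)[OF z xy(1)] real_height_gradient(1)[OF z xy(2)] s
    by (intro add_less_le_mono mult_left_mono mult_strict_left_mono) auto
  then show "real_height z < (1 - t) * real_height x + t * real_height y" using 0 by (simp add: algebra_simps)
qed

definition minimises :: "((real, 'd) vec) set \<Rightarrow> (real, 'd) vec \<Rightarrow> bool" where
  "minimises C x \<longleftrightarrow> x \<in> C \<and> (\<forall>y\<in>C. real_height x \<le> real_height y)"

lemma minimises_unique:
  assumes "convex C" "C \<subseteq> orthant N" "minimises C x" "minimises C y"
  shows "x = y"
proof (rule ccontr)
  assume ne: "x \<noteq> y"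
  have xy: "x \<in> C" "y \<in> C" "real_height x = real_height y" using assms by (auto simp: minimises_def intro: antisym)
  have "(1 - 1/2) *\<^sub>R x + (1/2) *\<^sub>R y \<in> C" using convexD[OF assms(1) xy(1,2), of "1/2" "1/2"] by simp
  then have "real_height x \<le> real_height ((1 - 1/2) *\<^sub>R x + (1/2) *\<^sub>R y)" using assms(3) unfolding minimises_def by blast
  then show False
    using real_height_convex(2)[of x N y "1/2"] xy assms(2) ne by auto
qed

text \<open>
  The height tends to \<open>\<infinity>\<close> at the coordinate hyperplanes inside a bounded set, so its sublevel sets
  are compact.
\<close>

lemma minimiser_exists:
  assumes Z: "closed Z" and ne: "x1 \<in> orthant N \<inter> Z" "\<And>i. \<bar>x1 $ i\<bar> \<le> L" and L: "1 \<le> L"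
  shows "\<exists>x. minimises {x \<in> orthant N \<inter> Z. \<forall>i. \<bar>x $ i\<bar> \<le> L} x"
proof -
  let ?C = "{x \<in> orthant N \<inter> Z. \<forall>i. \<bar>x $ i\<bar> \<le> L}"
  \<comment> \<open>a point with a coordinate smaller than \<open>\<delta>\<close> is higher than \<open>x1\<close>, since its other coordinates lower the height by at most \<open>ln L\<close>\<close>
  define \<delta> where "\<delta> = Min (range (\<lambda>i. exp (- (real_height x1 + ln L) / r $ i)))"
  have \<delta>0: "0 < \<delta>" by (auto simp: \<delta>_def)
  have low: "\<delta> \<le> \<bar>y $ i\<bar>" if y: "y \<in> ?C" "real_height y \<le> real_height x1" for y i
  proof -
    have "(\<Sum>j\<in>UNIV - {i}. r $ j * ln \<bar>y $ j\<bar>) \<le> (\<Sum>j\<in>UNIV - {i}. r $ j * ln L)"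
    proof (intro sum_mono mult_left_mono less_imp_le[OF r_pos])
      fix j show "ln \<bar>y $ j\<bar> \<le> ln L" using y orthantD(2)[of y N j] by (intro ln_mono) auto
    qed
    also have "\<dots> \<le> 1 * ln L"
      unfolding sum_distrib_right[symmetric] using r_pos[of i] r_sum L
      by (intro mult_right_mono) (auto simp: sum_diff1)
    finally have "- (real_height x1 + ln L) \<le> r $ i * ln \<bar>y $ i\<bar>"
      using y(2) unfolding real_height_def[of y] by (simp add: sum.remove[of UNIV i])
    then have "- (real_height x1 + ln L) / r $ i \<le> ln \<bar>y $ i\<bar>" using r_pos[of i] by (simp add: field_simps)
    then have "exp (- (real_height x1 + ln L) / r $ i) \<le> \<bar>y $ i\<bar>"
      using y orthantD(2)[of y N i] by (simp add: ln_ge_iff)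
    moreover have "\<delta> \<le> exp (- (real_height x1 + ln L) / r $ i)" unfolding \<delta>_def by (rule Min_le) auto
    ultimately show ?thesis by linarith
  qed
  define C' where "C' = {x \<in> Z. \<forall>i. \<bar>x $ i\<bar> \<le> L \<and> (if i \<in> N then x $ i \<le> - \<delta> else \<delta> \<le> x $ i)}"
  have C'C: "C' \<subseteq> ?C"
  proof
    fix x assume x: "x \<in> C'"
    then have "if i \<in> N then x $ i \<le> - \<delta> else \<delta> \<le> x $ i" for i unfolding C'_def by blast
    then have "if i \<in> N then x $ i < 0 else 0 < x $ i" for i
      using \<delta>0 by (smt (verit, best))
    then show "x \<in> ?C" using x by (auto simp: C'_def orthant_def)
  qed
  have inC': "y \<in> C'" if "y \<in> ?C" "real_height y \<le> real_height x1" for y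
    using that low[OF that] orthantD(1)[of y N]
    unfolding C'_def mem_Collect_eq by (intro conjI allI) (auto, (smt (verit, best))+)
  have x1: "x1 \<in> C'" using ne by (intro inC') auto
  have eq: "C' = Z \<inter> (\<Inter>i. {x. \<bar>x $ i\<bar> \<le> L} \<inter> {x. if i \<in> N then x $ i \<le> - \<delta> else \<delta> \<le> x $ i})"
    by (auto simp: C'_def)
  have "closed {x::(real, 'd) vec. if i \<in> N then x $ i \<le> - \<delta> else \<delta> \<le> x $ i}" for i
    by (cases "i \<in> N") (auto intro!: closed_Collect_le continuous_intros)
  moreover have "closed {x::(real, 'd) vec. \<bar>x $ i\<bar> \<le> L}" for i
    by (intro closed_Collect_le continuous_intros)
  ultimately have "closed C'" unfolding eq by (intro closed_Int Z closed_INT ballI) auto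
  moreover have "bounded C'"
  proof -
    have "norm x \<le> of_nat CARD('d) * L" if "x \<in> C'" for x
      using norm_le_l1_cart[of x] sum_bounded_above[of UNIV "\<lambda>i. \<bar>x $ i\<bar>" L] that by (simp add: C'_def)
    then show ?thesis by (auto simp: bounded_iff)
  qed
  ultimately have "compact C'" by (simp add: compact_eq_bounded_closed)
  moreover have "continuous_on C' real_height"
    unfolding real_height_def using C'C orthantD(2) by (intro continuous_intros) fastforce+
  ultimately obtain x where x: "x \<in> C'" "\<And>y. y \<in> C' \<Longrightarrow> real_height x \<le> real_height y"
    using continuous_attains_inf[of C' real_height] x1 by blast
  have "minimises ?C x"
    unfolding minimises_def
  proof (intro conjI ballI)
    show "x \<in> ?C" using x(1) C'C by blast
    fix y assume y: "y \<in> ?C"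
    show "real_height x \<le> real_height y"
      using x(2)[OF x1] x(2)[OF inC'[OF y]] by linarith
  qed
  then show ?thesis by blast
qed

lemma height_has_derivative:
  assumes "\<And>i. x $ i \<noteq> 0"
  shows "(height r has_derivative (\<lambda>v. - (descent x \<bullet> (\<chi> i. Re (v $ i))))) (at (cvec x))"
proof -
  have *: "((\<lambda>z. ln (cmod (z $ i))) has_derivative (\<lambda>v. Re (v $ i) / x $ i)) (at (cvec x))" for i
  proof -
    have s: "sgn (complex_of_real (x $ i)) = of_real (sgn (x $ i))" by (simp add: sgn_of_real)
    have "((\<lambda>z::(complex, 'd) vec. cmod (z $ i)) has_derivative (\<lambda>v. (v $ i) \<bullet> sgn (cvec x $ i))) (at (cvec x))"
      using assms[of i]
      by (intro has_derivative_norm[THEN has_derivative_compose[rotated], simplified] has_derivative_compose[OF _ has_derivative_norm] bounded_linear_imp_has_derivative bounded_linear_vec_nth)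
         (auto simp: cvec_def)
    then have "((\<lambda>z. ln (cmod (z $ i))) has_derivative
        (\<lambda>v. ((v $ i) \<bullet> sgn (cvec x $ i)) * inverse (cmod (cvec x $ i)))) (at (cvec x))"
      using assms[of i] by (intro has_derivative_ln) (auto simp: cvec_def)
    moreover have "((v $ i) \<bullet> sgn (cvec x $ i)) * inverse (cmod (cvec x $ i)) = Re (v $ i) / x $ i" for v :: "(complex, 'd) vec"
      using assms[of i] by (simp add: cvec_def s inner_complex_def sgn_real_def divide_simps)
    ultimately show ?thesis by simp
  qed
  have "((\<lambda>z. - (\<Sum>i\<in>UNIV. r $ i * ln (cmod (z $ i)))) has_derivative
      (\<lambda>v. - (\<Sum>i\<in>UNIV. r $ i * (Re (v $ i) / x $ i)))) (at (cvec x))"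
    by (intro has_derivative_minus has_derivative_sum has_derivative_mult_right *)
  then show ?thesis
    by (simp add: height_def[abs_def] descent_def inner_vec_def)
qed

text \<open>
  Along the flat the linear forms \<open>b k\<close> are constant for \<open>k \<in> S\<close>, hence so is, to first order, the
  height if its gradient is a combination of them.
\<close>

lemma critical_point_cvec:
  fixes b :: "nat \<Rightarrow> (real, 'd) vec"
  assumes x: "\<And>i. x $ i \<noteq> 0" and S: "\<And>k. k \<in> S \<Longrightarrow> b k \<bullet> x = 1"
    and w: "descent x = (\<Sum>k\<in>S'. a k *\<^sub>R b k)" "S' \<subseteq> S"
  shows "critical_point b r S (cvec x)"
proof -
  let ?F = "flat b S \<inter> cstar" and ?D = "\<lambda>v::(complex, 'd) vec. - (descent x \<bullet> (\<chi> i. Re (v $ i)))"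
  have "cvec x \<in> ?F" using x S by (auto simp: flat_def cstar_def ell_cvec) (simp add: cvec_def)
  moreover have D: "(height r has_derivative ?D) (at (cvec x) within ?F)"
    using height_has_derivative[OF x] has_derivative_at_withinI by blast
  have "?D (y - cvec x) = 0" if "y \<in> ?F" for y
  proof -
    have "b k \<bullet> (\<chi> i. Re ((y - cvec x) $ i)) = 0" if "k \<in> S'" for k
    proof -
      have "ell (b k) y = 0" using \<open>y \<in> ?F\<close> w(2) that by (auto simp: flat_def)
      then have "b k \<bullet> (\<chi> i. Re (y $ i)) = 1" using Re_ell[of "b k" y] by simp
      moreover have "(\<chi> i. Re ((y - cvec x) $ i)) = (\<chi> i. Re (y $ i)) - x" by (simp add: vec_eq_iff cvec_def)
      ultimately show ?thesis using S w(2) that by (auto simp: inner_diff_right)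
    qed
    then show ?thesis unfolding w(1) inner_sum_left by simp
  qed
  then have "(height r has_derivative (\<lambda>_. 0)) (at (cvec x) within ?F)"
    using D unfolding has_derivative_within
    by (auto elim!: Lim_transform_eventually simp: eventually_at_filter)
  ultimately show ?thesis by (simp add: critical_point_def)
qed

text \<open>
  A contributing point is the only one with the given hyperplanes through it in its orthant: by
  strict convexity each of two such points would be lower than the other.
\<close>

lemma finite_contrib: "finite (contrib m b r)"
proof -
  have real: "\<exists>x. \<sigma> = cvec x \<and> (\<forall>i. x $ i \<noteq> 0) \<and> descent x \<in> normal_cone m b \<sigma>" if \<sigma>: "\<sigma> \<in> contrib m b r" for \<sigma>
  proof -
    obtain u where u: "u \<in> normal_cone m b \<sigma>" "(\<chi> i. complex_of_real (r $ i) / \<sigma> $ i) = cvec u"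
      using \<sigma> unfolding contrib_def by blast
    have "\<sigma> \<in> cstar" using \<sigma> by (auto simp: contrib_def Omega_def critical_point_def)
    then have ne: "\<sigma> $ i \<noteq> 0" for i by (simp add: cstar_def)
    have q: "complex_of_real (r $ i) / \<sigma> $ i = of_real (u $ i)" for i
      using u(2) by (simp add: vec_eq_iff cvec_def)
    have une: "u $ i \<noteq> 0" for i
    proof
      assume "u $ i = 0"
      then have "complex_of_real (r $ i) / \<sigma> $ i = 0" using q[of i] by simp
      then show False using ne[of i] r_pos[of i] by simp
    qed
    have "\<sigma> $ i = of_real (r $ i / u $ i)" for i
      using q[of i] ne[of i] une[of i] by (simp add: field_simps)
    then have "\<sigma> = cvec (\<chi> i. r $ i / u $ i)" "descent (\<chi> i. r $ i / u $ i) = u"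
      using r_pos by (auto simp: vec_eq_iff cvec_def descent_def less_imp_neq[THEN not_sym])
    moreover have "(\<chi> i. r $ i / u $ i) $ i \<noteq> 0" for i
      using r_pos[of i] une by (simp add: less_imp_neq[THEN not_sym])
    ultimately show ?thesis using u(1) by metis
  qed
  have "inj_on (\<lambda>\<sigma>. ({i. Re (\<sigma> $ i) < 0}, incident m b \<sigma>)) (contrib m b r)"
  proof (rule inj_onI, clarify)
    fix \<sigma> \<sigma>' assume s: "\<sigma> \<in> contrib m b r" "\<sigma>' \<in> contrib m b r"
      and N: "{i. Re (\<sigma> $ i) < 0} = {i. Re (\<sigma>' $ i) < 0}" and I: "incident m b \<sigma> = incident m b \<sigma>'"
    obtain x x' where x: "\<sigma> = cvec x" "\<And>i. x $ i \<noteq> 0" "descent x \<in> normal_cone m b \<sigma>"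
      and x': "\<sigma>' = cvec x'" "\<And>i. x' $ i \<noteq> 0" "descent x' \<in> normal_cone m b \<sigma>'"
      using real[OF s(1)] real[OF s(2)] by metis
    have orth: "x \<in> orthant {i. x $ i < 0}" "x' \<in> orthant {i. x $ i < 0}"
      using N x x' by (auto simp: orthant_def cvec_def not_less less_le set_eq_iff)
    have le: "real_height u < real_height v" if nc: "descent u \<in> normal_cone m b (cvec u)"
      and inc: "incident m b (cvec u) = incident m b (cvec v)"
      and o: "u \<in> orthant M" "v \<in> orthant M" "v \<noteq> u" for u v M
    proof -
      obtain a where a: "descent u = (\<Sum>j\<in>incident m b (cvec u). a j *\<^sub>R b j)"
        using nc by (auto simp: normal_cone_def)
      have "b j \<bullet> u = 1 \<and> b j \<bullet> v = 1" if "j \<in> incident m b (cvec u)" for j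
        using that inc that[unfolded inc] unfolding incident_cvec by simp
      then have "descent u \<bullet> (v - u) = 0" unfolding a inner_sum_left by (simp add: inner_diff_right)
      then show ?thesis using real_height_gradient(2)[OF o] by simp
    qed
    have "x = x'"
    proof (rule ccontr)
      assume "x \<noteq> x'"
      then have "real_height x < real_height x'" "real_height x' < real_height x" using le[of x x'] le[of x' x] x x' I orth by auto
      then show False by simp
    qed
    then show "\<sigma> = \<sigma>'" using x(1) x'(1) by simp
  qed
  moreover have "(\<lambda>\<sigma>. ({i. Re (\<sigma> $ i) < 0}, incident m b \<sigma>)) ` contrib m b r \<subseteq> UNIV \<times> Pow {1..m}"
    by (auto simp: incident_def)
  ultimately show ?thesis by (rule inj_on_finite) simp
qed

end

section \<open>Contributing points on the closure of a bounded cell\<close>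

locale simple_generic = direction r for r :: "real ^ 'd::{finite,linorder}" +
  fixes m :: nat and b :: "nat \<Rightarrow> real ^ 'd::{finite,linorder}"
  assumes simple: "simple_arrangement m b" and generic: "generic_direction m b r"
begin

lemma incident_independent:
  assumes "S \<subseteq> {1..m}" "\<And>k. k \<in> S \<Longrightarrow> b k \<bullet> x = 1"
  shows "inj_on b S" "independent (b ` S)"
proof -
  have "cvec x \<in> flat b S" using assms(2) by (simp add: flat_def ell_cvec)
  then have ne: "flat b S \<noteq> {}" by blast
  have "inj_on b S \<and> independent (b ` S)"
  proof (cases "S = {}")
    case False
    then show ?thesis
      using simple[unfolded simple_arrangement_def, rule_format, of S] assms(1) ne by blast
  qed (simp add: independent_empty)
  then show "inj_on b S" "independent (b ` S)" by auto
qed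

text \<open>
  The use of genericity: hyperplanes with a vanishing multiplier could be dropped, and \<open>x\<close> would be
  critical on a larger flat, too. The two flats are different because the arrangement is simple.
\<close>

lemma critical_coefficients:
  assumes x: "\<And>i. x $ i \<noteq> 0" and Act: "Act \<subseteq> incident m b (cvec x)"
    and a: "\<And>k. k \<in> Act \<Longrightarrow> 0 \<le> a k" "descent x = (\<Sum>k\<in>Act. a k *\<^sub>R b k)"
  shows "Act = incident m b (cvec x) \<and> (\<forall>k\<in>Act. 0 < a k) \<and> cvec x \<in> contrib m b r"
proof -
  let ?S = "incident m b (cvec x)"
  define S0 where "S0 = {k \<in> Act. 0 < a k}"
  have S: "?S \<subseteq> {1..m}" "\<And>k. k \<in> ?S \<Longrightarrow> b k \<bullet> x = 1" by (auto simp: incident_cvec)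
  have fin: "finite ?S" by (auto simp: incident_def)
  have S0S: "S0 \<subseteq> ?S" using Act by (auto simp: S0_def)
  have w: "descent x = (\<Sum>k\<in>S0. a k *\<^sub>R b k)"
    unfolding a(2) S0_def using a(1) finite_subset[OF Act fin]
    by (intro sum.mono_neutral_right) (auto simp: order.strict_iff_order)
  obtain i :: 'd where True by blast
  have "descent x $ i \<noteq> 0" using x[of i] r_pos[of i] by (simp add: descent_def)
  then have "S0 \<noteq> {}" using w by auto
  have crit: "critical_point b r S0 (cvec x)" "critical_point b r ?S (cvec x)"
    by (rule critical_point_cvec[OF x _ w]; use S S0S in blast)+
  have eq: "S0 = ?S"
  proof (rule ccontr)
    assume "S0 \<noteq> ?S"
    then obtain k where k: "k \<in> ?S" "k \<notin> S0" using S0S by blast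
    obtain q where q: "b k \<bullet> q = 1" "\<And>j. j \<in> ?S - {k} \<Longrightarrow> b j \<bullet> q = 0"
      using dual_vector[OF incident_independent[OF S] k(1)] by blast
    have "b j \<bullet> q = 0" if "j \<in> S0" for j using q(2)[of j] that k S0S by blast
    moreover have "b j \<bullet> x = 1" if "j \<in> S0" for j using S(2) S0S that by blast
    ultimately have "cvec (x + q) \<in> flat b S0"
      by (simp add: flat_def ell_cvec inner_add_right)
    moreover have "cvec (x + q) \<notin> flat b ?S"
    proof -
      have "ell (b k) (cvec (x + q)) \<noteq> 0" using q(1) S(2)[OF k(1)] by (simp add: ell_cvec inner_add_right)
      then show ?thesis using k(1) unfolding flat_def by blast
    qed
    ultimately have "flat b S0 \<noteq> flat b ?S" by blast
    then show False
      using generic crit \<open>S0 \<noteq> {}\<close> S0S S(1) unfolding generic_direction_def by blast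
  qed
  then have Act_eq: "Act = ?S" "\<forall>k\<in>Act. 0 < a k" using Act by (auto simp: S0_def)
  have "cvec x \<in> Omega m b r"
    unfolding Omega_def using crit(2) S(1) eq \<open>S0 \<noteq> {}\<close> by blast
  moreover have "(\<chi> i. complex_of_real (r $ i) / cvec x $ i) = cvec (descent x)"
    by (simp add: cvec_def descent_def vec_eq_iff)
  moreover have "descent x \<in> normal_cone m b (cvec x)"
    unfolding normal_cone_def using w eq Act_eq by (auto simp: S0_def)
  ultimately show ?thesis using Act_eq by (auto simp: contrib_def)
qed

end

text \<open>
  The identity for the bounded cell of \<open>x0\<close>. In terms of this cell, \<open>K\<close> are the hyperplanes that
  separate it from the origin, \<open>P\<close> the remaining ones and \<open>N\<close> the negative coordinates.
\<close>

locale bounded_cell = simple_generic r m b for r :: "real ^ 'd::{finite,linorder}" and m b +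
  fixes x0 :: "real ^ 'd::{finite,linorder}"
  assumes x0: "x0 \<in> mfd_real m b" and bdd: "bounded (cell m b x0)"
begin

abbreviation "N \<equiv> neg_coords x0"
abbreviation "K \<equiv> beyond m b x0"
abbreviation "P \<equiv> {1..m} - K"

text \<open>
  The box \<open>\<bar>x\<^sub>i\<bar> \<le> L\<close> makes minimisers exist for every choice of constraints. It is so large that its
  walls do not meet the closure of the cell.
\<close>

definition L :: real where
  "L = (SOME L. 1 \<le> L \<and> (\<forall>x\<in>closure (cell m b x0). \<forall>i. \<bar>x $ i\<bar> < L))"

lemma L_bounds: "1 \<le> L" "x \<in> closure (cell m b x0) \<Longrightarrow> \<bar>x $ i\<bar> < L"
proof -
  obtain c where c: "\<And>x. x \<in> closure (cell m b x0) \<Longrightarrow> norm x \<le> c"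
    using bounded_closure[OF bdd] by (auto simp: bounded_iff)
  have "1 \<le> max 1 (c + 1) \<and> (\<forall>x\<in>closure (cell m b x0). \<forall>i. \<bar>x $ i\<bar> < max 1 (c + 1))"
  proof (intro conjI ballI allI)
    fix x i assume "x \<in> closure (cell m b x0)"
    then show "\<bar>x $ i\<bar> < max 1 (c + 1)" using component_le_norm_cart[of x i] c[of x] by linarith
  qed simp
  then have "1 \<le> L \<and> (\<forall>x\<in>closure (cell m b x0). \<forall>i. \<bar>x $ i\<bar> < L)"
    unfolding L_def by (rule someI)
  then show "1 \<le> L" "x \<in> closure (cell m b x0) \<Longrightarrow> \<bar>x $ i\<bar> < L" by auto
qed

lemma K_facts: "K \<subseteq> {1..m}" "finite K" "K \<inter> P = {}"
  by (auto simp: beyond_def intro: finite_subset[of _ "{1..m}"])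

lemma x0_orthant: "x0 \<in> orthant N"
  using x0 by (auto simp: orthant_def neg_coords_def mfd_real_iff not_less less_le)

lemma x0_sides: "k \<in> K \<Longrightarrow> 1 < b k \<bullet> x0" "k \<in> P \<Longrightarrow> b k \<bullet> x0 < 1"
  using x0 by (auto simp: beyond_def mfd_real_iff less_le)

lemma cell_x0_iff:
  "y \<in> cell m b x0 \<longleftrightarrow> y \<in> orthant N \<and> (\<forall>k\<in>K. 1 < b k \<bullet> y) \<and> (\<forall>k\<in>P. b k \<bullet> y < 1)"
  unfolding cell_iff[OF x0] by (auto simp: orthant_def neg_coords_def beyond_def)

lemma closure_cell_sides:
  assumes "y \<in> closure (cell m b x0)"
  shows "k \<in> K \<Longrightarrow> 1 \<le> b k \<bullet> y" "k \<in> P \<Longrightarrow> b k \<bullet> y \<le> 1"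
    "i \<in> N \<Longrightarrow> y $ i \<le> 0" "i \<notin> N \<Longrightarrow> 0 \<le> y $ i"
proof -
  have sub: "y \<in> T" if "closed T" "cell m b x0 \<subseteq> T" for T
    using closure_minimal[OF that(2,1)] assms by blast
  have "closed {y. 1 \<le> b k \<bullet> y}" "closed {y. b k \<bullet> y \<le> 1}"
    "closed {y::(real, 'd) vec. y $ i \<le> 0}" "closed {y::(real, 'd) vec. 0 \<le> y $ i}" for k i
    by (intro closed_Collect_le continuous_intros)+
  note cl = this
  show "1 \<le> b k \<bullet> y" if "k \<in> K"
  proof -
    have "cell m b x0 \<subseteq> {y. 1 \<le> b k \<bullet> y}" using that by (auto simp: cell_x0_iff intro: less_imp_le)
    then show ?thesis using sub[OF cl(1)] by blast
  qed
  show "b k \<bullet> y \<le> 1" if "k \<in> P"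
  proof -
    have "cell m b x0 \<subseteq> {y. b k \<bullet> y \<le> 1}" 
    proof
      fix z assume "z \<in> cell m b x0"
      then have "b k \<bullet> z < 1" using that unfolding cell_x0_iff by blast
      then show "z \<in> {y. b k \<bullet> y \<le> 1}" by simp
    qed
    then show ?thesis using sub[OF cl(2)] by blast
  qed
  have o: "if i \<in> N then z $ i < 0 else 0 < z $ i" if "z \<in> cell m b x0" for z
    using that orthantD(1)[of z N i] unfolding cell_x0_iff by blast
  show "y $ i \<le> 0" if "i \<in> N"
  proof -
    have "cell m b x0 \<subseteq> {y. y $ i \<le> 0}" using o that by (auto intro: less_imp_le)
    then show ?thesis using sub[OF cl(3)] by blast
  qed
  show "0 \<le> y $ i" if "i \<notin> N"
  proof -
    have "cell m b x0 \<subseteq> {y. 0 \<le> y $ i}" using o that by (auto intro: less_imp_le)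
    then show ?thesis using sub[OF cl(4)] by blast
  qed
qed

text \<open>
  Points of the open segment to \<open>x0\<close> satisfy all inequalities strictly.
\<close>

lemma in_closure_cell:
  assumes "x \<in> orthant N" "\<And>k. k \<in> K \<Longrightarrow> 1 \<le> b k \<bullet> x" "\<And>k. k \<in> P \<Longrightarrow> b k \<bullet> x \<le> 1"
  shows "x \<in> closure (cell m b x0)"
proof -
  define f where "f = (\<lambda>n::nat. (1 - inverse (real (Suc n))) *\<^sub>R x + inverse (real (Suc n)) *\<^sub>R x0)"
  have "f n \<in> cell m b x0" for n
  proof -
    define t where "t = inverse (real (Suc n))"
    have t: "0 < t" "t \<le> 1" by (auto simp: t_def field_simps)
    have "f n \<in> orthant N"
      unfolding f_def t_def[symmetric] using convexD[OF convex_orthant assms(1) x0_orthant, of "1 - t" t] t by simp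
    moreover have bf: "b k \<bullet> f n - 1 = (1 - t) * (b k \<bullet> x - 1) + t * (b k \<bullet> x0 - 1)" for k
      unfolding f_def t_def[symmetric] by (simp add: inner_add_right algebra_simps)
    moreover have "0 < (1 - t) * (b k \<bullet> x - 1) + t * (b k \<bullet> x0 - 1)" if "k \<in> K" for k
      using t assms(2)[OF that] x0_sides(1)[OF that] by (intro add_nonneg_pos mult_nonneg_nonneg mult_pos_pos) auto
    moreover have "(1 - t) * (b k \<bullet> x - 1) + t * (b k \<bullet> x0 - 1) < 0" if "k \<in> P" for k
      using t assms(3)[OF that] x0_sides(2)[OF that] by (intro add_nonpos_neg mult_nonneg_nonpos mult_pos_neg) auto
    ultimately show ?thesis
      unfolding cell_x0_iff by (metis diff_gt_0_iff_gt diff_less_0_iff_less)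
  qed
  moreover have "f \<longlonglongrightarrow> (1 - 0) *\<^sub>R x + 0 *\<^sub>R x0"
    unfolding f_def by (intro tendsto_intros LIMSEQ_inverse_real_of_nat)
  ultimately show ?thesis by (auto simp: closure_sequential)
qed

definition region :: "nat set \<Rightarrow> (real, 'd) vec set" where
  "region T = {x \<in> orthant N \<inter> {x. \<forall>k\<in>P \<union> T. b k \<bullet> x \<le> 1}. \<forall>i. \<bar>x $ i\<bar> \<le> L}"

lemma convex_region: "convex (region T)"
proof -
  have eq: "region T = orthant N \<inter> (\<Inter>k\<in>P \<union> T. {x. b k \<bullet> x \<le> 1}) \<inter> (\<Inter>i. {x. \<bar>x $ i\<bar> \<le> L})"
    by (auto simp: region_def)
  have "convex {x::(real, 'd) vec. \<bar>x $ i\<bar> \<le> L}" for i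
  proof -
    have "{x::(real, 'd) vec. \<bar>x $ i\<bar> \<le> L} = {x. axis i 1 \<bullet> x \<le> L} \<inter> {x. axis i 1 \<bullet> x \<ge> - L}"
      by (auto simp: inner_axis' abs_le_iff)
    then show ?thesis by (simp add: convex_Int convex_halfspace_le convex_halfspace_ge)
  qed
  then show ?thesis unfolding eq by (intro convex_Int convex_orthant convex_INT convex_halfspace_le)
qed

lemma region_subset: "region T \<subseteq> orthant N"
  by (auto simp: region_def)

text \<open>
  The constraints \<open>b k \<bullet> x \<le> 1\<close> hold strictly at the origin, hence at all points of the orthant near
  it.
\<close>

lemma region_nonempty: "finite T \<Longrightarrow> \<exists>x\<in>region T. True"
proof -
  assume fin: "finite T"
  define s where "s = (\<chi> i. if i \<in> N then -1 else (1 :: real))"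
  define t where "t = 1 / (1 + (\<Sum>k\<in>P \<union> T. \<bar>b k \<bullet> s\<bar>))"
  have pos: "0 < 1 + (\<Sum>k\<in>P \<union> T. \<bar>b k \<bullet> s\<bar>)" by (intro add_pos_nonneg sum_nonneg) auto
  have t: "0 < t" "t \<le> 1" using pos by (auto simp: t_def divide_le_eq sum_nonneg)
  have "b k \<bullet> (t *\<^sub>R s) \<le> 1" if "k \<in> P \<union> T" for k
  proof -
    have "b k \<bullet> s \<le> \<bar>b k \<bullet> s\<bar>" by simp
    also have "\<dots> \<le> (\<Sum>k\<in>P \<union> T. \<bar>b k \<bullet> s\<bar>)" using that fin by (intro member_le_sum) auto
    also have "\<dots> \<le> 1 + \<dots>" by simp
    finally show ?thesis using pos by (simp add: t_def divide_le_eq)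
  qed
  moreover have "t *\<^sub>R s \<in> orthant N" using t by (auto simp: orthant_def s_def)
  moreover have "\<bar>(t *\<^sub>R s) $ i\<bar> \<le> L" for i using t L_bounds(1) by (auto simp: s_def)
  ultimately have "t *\<^sub>R s \<in> region T" by (simp add: region_def)
  then show ?thesis by blast
qed

definition lowest :: "nat set \<Rightarrow> (real, 'd) vec" where
  "lowest T = (SOME x. minimises (region T) x)"

lemma lowest_minimises:
  assumes "finite T"
  shows "minimises (region T) (lowest T)"
proof -
  obtain x1 where "x1 \<in> region T" using region_nonempty[OF assms] by blast
  moreover have "closed {x. \<forall>k\<in>P \<union> T. b k \<bullet> x \<le> 1}"
  proof -
    have "{x. \<forall>k\<in>P \<union> T. b k \<bullet> x \<le> 1} = (\<Inter>k\<in>P \<union> T. {x. b k \<bullet> x \<le> 1})" by auto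
    then show ?thesis by (simp only:) (intro closed_INT ballI closed_halfspace_le)
  qed
  ultimately have "\<exists>x. minimises (region T) x"
    unfolding region_def by (intro minimiser_exists[of _ x1] L_bounds(1)) auto
  then show ?thesis unfolding lowest_def by (rule someI_ex)
qed

lemma lowest_eqI: "finite T \<Longrightarrow> minimises (region T) x \<Longrightarrow> lowest T = x"
  using minimises_unique[OF convex_region region_subset lowest_minimises] by blast

text \<open>
  A constraint that is slack at the minimiser can be removed: a lower point elsewhere could be
  approached along a segment, on which the constraint holds at the beginning.
\<close>

lemma lowest_slack:
  assumes fin: "finite T" "finite T'" and TT': "insert k T = insert k T'" and k: "b k \<bullet> lowest T < 1"
  shows "lowest T' = lowest T"
proof (rule lowest_eqI[OF fin(2)])
  let ?x = "lowest T"
  have x: "?x \<in> region T" "\<And>y. y \<in> region T \<Longrightarrow> real_height ?x \<le> real_height y"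
    using lowest_minimises[OF fin(1)] by (auto simp: minimises_def)
  show "minimises (region T') ?x"
    unfolding minimises_def
  proof (intro conjI ballI)
    have "T' \<subseteq> insert k T" using TT' by blast
    then show "?x \<in> region T'" using x(1) k unfolding region_def by (auto simp: less_imp_le)
    fix y assume y: "y \<in> region T'"
    show "real_height ?x \<le> real_height y"
    proof (rule ccontr)
      assume less: "\<not> real_height ?x \<le> real_height y"
      \<comment> \<open>the last parameter at which the segment from the minimiser to \<open>y\<close> satisfies the constraint \<open>k\<close>\<close>
      define t where "t = (if b k \<bullet> y \<le> 1 then 1 else (1 - b k \<bullet> ?x) / (b k \<bullet> y - b k \<bullet> ?x))"
      have t: "0 < t" "t \<le> 1" using k by (auto simp: t_def divide_le_eq)
      define z where "z = (1 - t) *\<^sub>R ?x + t *\<^sub>R y"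
      have bz: "b j \<bullet> z = b j \<bullet> ?x + t * (b j \<bullet> y - b j \<bullet> ?x)" for j
        by (simp add: z_def inner_add_right algebra_simps)
      have "b k \<bullet> z \<le> 1" unfolding bz using k by (auto simp: t_def)
      moreover have "z \<in> region (T - {k})"
      proof -
        have "?x \<in> region (T - {k})" "y \<in> region (T - {k})"
          using x(1) y TT' by (auto simp: region_def)
        then show ?thesis
          unfolding z_def using convexD[OF convex_region, of ?x _ y "1 - t" t] t by simp
      qed
      ultimately have "z \<in> region T" by (auto simp: region_def)
      then have "real_height ?x \<le> real_height z" by (rule x(2))
      also have "\<dots> \<le> (1 - t) * real_height ?x + t * real_height y"
        unfolding z_def using real_height_convex(1)[of ?x N y t] x(1) y region_subset t by auto
      also have "\<dots> < (1 - t) * real_height ?x + t * real_height ?x" using less t by simp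
      finally show False by (simp add: algebra_simps)
    qed
  qed
qed

text \<open>
  The lowest point for \<open>T\<close> lies, with respect to every hyperplane of \<open>K\<close>, on the same closed side as
  the cell, away from the origin.
\<close>

definition far_side :: "nat set \<Rightarrow> bool" where
  "far_side T \<longleftrightarrow> (\<forall>k\<in>K. 1 \<le> b k \<bullet> lowest T)"

text \<open>
  If some hyperplane of \<open>K\<close> has the lowest point strictly on the side of the origin, then membership
  of its index in \<open>T\<close> does not influence the lowest point. Such \<open>T\<close> cancel in pairs, so the sum
  may be extended to all subsets of \<open>K\<close>.
\<close>

lemma signed_sum_far_side: "(\<Sum>T | T \<subseteq> K \<and> far_side T. (-1) ^ card T) = (if K = {} then 1 else (0::int))"
proof -
  define \<kappa> where "\<kappa> = (\<lambda>T. LEAST k. k \<in> K \<and> b k \<bullet> lowest T < 1)"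
  have \<kappa>_eq: "\<kappa> T = (LEAST k. k \<in> K \<and> b k \<bullet> lowest T < 1)" for T by (simp add: \<kappa>_def)
  have fin: "finite T" if "T \<subseteq> K" for T using that K_facts(2) finite_subset by blast
  have \<kappa>: "\<kappa> T \<in> K" "b (\<kappa> T) \<bullet> lowest T < 1" if "\<not> far_side T" for T
    using that LeastI_ex[of "\<lambda>k. k \<in> K \<and> b k \<bullet> lowest T < 1"] by (auto simp: far_side_def not_le \<kappa>_eq)
  have lo: "lowest (insert (\<kappa> T) T) = lowest T" "lowest (T - {\<kappa> T}) = lowest T" if "T \<subseteq> K" "\<not> far_side T" for T
    using fin[OF that(1)] \<kappa>[OF that(2)] by (auto intro!: lowest_slack)
  have "(\<Sum>T | T \<subseteq> K \<and> \<not> far_side T. (-1) ^ card T) = (0::int)"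
  proof (rule signed_sum_toggle[where \<kappa> = \<kappa>])
    fix T assume "T \<in> {T. T \<subseteq> K \<and> \<not> far_side T}"
    then have T: "T \<subseteq> K" "\<not> far_side T" by auto
    have g: "far_side (insert (\<kappa> T) T) = far_side T" "far_side (T - {\<kappa> T}) = far_side T"
      unfolding far_side_def using lo[OF T] by auto
    show "finite T" using fin T by blast
    show "insert (\<kappa> T) T \<in> {T. T \<subseteq> K \<and> \<not> far_side T}" "T - {\<kappa> T} \<in> {T. T \<subseteq> K \<and> \<not> far_side T}"
      using T g \<kappa>(1)[OF T(2)] by auto
    show "\<kappa> (insert (\<kappa> T) T) = \<kappa> T" "\<kappa> (T - {\<kappa> T}) = \<kappa> T"
      unfolding \<kappa>_eq[of "insert (\<kappa> T) T"] \<kappa>_eq[of "T - {\<kappa> T}"] lo[OF T] by (simp_all only: \<kappa>_eq)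
  qed
  moreover have "(\<Sum>T\<in>Pow K. (-1) ^ card T) = (if K = {} then 1 else (0::int))"
  proof (cases "K = {}")
    case False
    then obtain k where "k \<in> K" by blast
    then have "(\<Sum>T\<in>Pow K. (-1) ^ card T) = (0::int)"
      by (intro signed_sum_toggle[where \<kappa> = "\<lambda>_. k"]) (auto intro: fin)
    with False show ?thesis by simp
  qed simp
  moreover have "(\<Sum>T\<in>Pow K. (-1::int) ^ card T)
     = (\<Sum>T | T \<subseteq> K \<and> far_side T. (-1) ^ card T) + (\<Sum>T | T \<subseteq> K \<and> \<not> far_side T. (-1) ^ card T)"
    using K_facts(2) by (subst sum.union_disjoint[symmetric]) (auto intro!: sum.cong intro: finite_subset[of _ "Pow K"])
  ultimately show ?thesis by simp
qed

text \<open>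
  First-order conditions at a minimiser. Feasible directions are tested by moving a small amount
  \<open>t > 0\<close>; the tangent inequality at the moved point gives the condition there, and \<open>t\<close> tends to \<open>0\<close>.
\<close>

lemma far_side_contributes:
  assumes T: "T \<subseteq> K" "far_side T"
  shows "lowest T \<in> closure (cell m b x0)" "cvec (lowest T) \<in> contrib m b r"
    "incident m b (cvec (lowest T)) \<inter> K = T"
proof -
  let ?x = "lowest T"
  have fin: "finite T" using T K_facts(2) finite_subset by blast
  have x: "?x \<in> region T" "\<And>y. y \<in> region T \<Longrightarrow> real_height ?x \<le> real_height y"
    using lowest_minimises[OF fin] by (auto simp: minimises_def)
  have xo: "?x \<in> orthant N" using x(1) region_subset by blast
  have sides: "\<And>k. k \<in> K \<Longrightarrow> 1 \<le> b k \<bullet> ?x" "\<And>k. k \<in> P \<union> T \<Longrightarrow> b k \<bullet> ?x \<le> 1"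
    using T x(1) unfolding far_side_def region_def by blast+
  show cl: "?x \<in> closure (cell m b x0)"
    using xo sides by (intro in_closure_cell) auto
  define Act where "Act = {k \<in> P \<union> T. b k \<bullet> ?x = 1}"
  have ActS: "Act \<subseteq> incident m b (cvec ?x)" using T K_facts(1) by (auto simp: Act_def incident_cvec)
  have TAct: "T \<subseteq> Act" using T sides by (force simp: Act_def)
  have "descent ?x \<bullet> v \<le> 0" if v: "\<And>k. k \<in> Act \<Longrightarrow> b k \<bullet> v \<le> 0" for v
  proof -
    have lim: "((\<lambda>t. ?x + t *\<^sub>R v) \<longlongrightarrow> ?x + 0 *\<^sub>R v) (at_right 0)" by (intro tendsto_intros)
    have ev_o: "\<forall>\<^sub>F t in at_right 0. ?x + t *\<^sub>R v \<in> orthant N"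
    proof -
      have "\<forall>\<^sub>F t in at_right 0. if i \<in> N then (?x + t *\<^sub>R v) $ i < 0 else 0 < (?x + t *\<^sub>R v) $ i" for i
      proof -
        have l: "((\<lambda>t. (?x + t *\<^sub>R v) $ i) \<longlongrightarrow> ?x $ i) (at_right 0)"
          using tendsto_vec_nth[OF lim, of i] by simp
        show ?thesis
          using orthantD(1)[OF xo, of i] order_tendstoD[OF l] by (cases "i \<in> N") auto
      qed
      then show ?thesis unfolding orthant_def by (simp add: eventually_all_finite)
    qed
    have ev_L: "\<forall>\<^sub>F t in at_right 0. \<forall>i. \<bar>(?x + t *\<^sub>R v) $ i\<bar> \<le> L"
    proof (rule eventually_all_finite)
      fix i
      have l: "((\<lambda>t. \<bar>(?x + t *\<^sub>R v) $ i\<bar>) \<longlongrightarrow> \<bar>?x $ i\<bar>) (at_right 0)"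
        using tendsto_rabs[OF tendsto_vec_nth[OF lim, of i]] by simp
      show "\<forall>\<^sub>F t in at_right 0. \<bar>(?x + t *\<^sub>R v) $ i\<bar> \<le> L"
        using order_tendstoD(2)[OF l L_bounds(2)[OF cl]] by (rule eventually_mono) simp
    qed
    have ev_b: "\<forall>\<^sub>F t in at_right 0. \<forall>k\<in>P \<union> T. b k \<bullet> (?x + t *\<^sub>R v) \<le> 1"
    proof (rule eventually_ball_finite)
      show "finite (P \<union> T)" using fin by auto
      show "\<forall>k\<in>P \<union> T. \<forall>\<^sub>F t in at_right 0. b k \<bullet> (?x + t *\<^sub>R v) \<le> 1"
      proof
        fix k assume k: "k \<in> P \<union> T"
        show "\<forall>\<^sub>F t in at_right 0. b k \<bullet> (?x + t *\<^sub>R v) \<le> 1"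
        proof (cases "k \<in> Act")
          case True
          then have "b k \<bullet> (?x + t *\<^sub>R v) \<le> 1" if "t > 0" for t
            using v[OF True] that by (simp add: Act_def inner_add_right mult_nonneg_nonpos)
          then show ?thesis using eventually_at_right_less[of 0] by (auto elim: eventually_mono)
        next
          case False
          then have "b k \<bullet> ?x < 1" using k sides(2)[OF k] by (auto simp: Act_def)
          moreover have "((\<lambda>t. b k \<bullet> (?x + t *\<^sub>R v)) \<longlongrightarrow> b k \<bullet> ?x) (at_right 0)"
            using tendsto_inner[OF tendsto_const lim, of "b k"] by simp
          ultimately show ?thesis using order_tendstoD(2) by (fastforce elim: eventually_mono)
        qed
      qed
    qed
    have "\<forall>\<^sub>F t in at_right 0. descent (?x + t *\<^sub>R v) \<bullet> v \<le> 0"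
      using ev_o ev_L ev_b eventually_at_right_less[of 0]
    proof eventually_elim
      case (elim t)
      let ?y = "?x + t *\<^sub>R v"
      have "?y \<in> region T" using elim by (simp add: region_def)
      then have "real_height ?x \<le> real_height ?y" by (rule x(2))
      moreover have "real_height ?y - descent ?y \<bullet> (?x - ?y) \<le> real_height ?x"
        by (rule real_height_gradient(1)[OF elim(1) xo])
      ultimately have "t * (descent ?y \<bullet> v) \<le> 0" by simp
      then show ?case using elim(4) by (simp add: mult_le_0_iff)
    qed
    moreover have "((\<lambda>t. descent (?x + t *\<^sub>R v) \<bullet> v) \<longlongrightarrow> descent ?x \<bullet> v) (at_right 0)"
      unfolding descent_def using orthantD(2)[OF xo]
      by (auto intro!: tendsto_eq_intros tendsto_vec_lambda)
    ultimately show ?thesis by (intro tendsto_upperbound) auto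
  qed
  then have "\<exists>a. (\<forall>k\<in>Act. 0 \<le> a k) \<and> descent ?x = (\<Sum>k\<in>Act. a k *\<^sub>R b k)"
  proof (intro nonneg_combination)
    have A: "Act \<subseteq> {1..m}" "\<And>k. k \<in> Act \<Longrightarrow> b k \<bullet> ?x = 1" using ActS by (auto simp: incident_cvec)
    show "inj_on b Act" "independent (b ` Act)" by (rule incident_independent[OF A], assumption)+
    show "finite Act" using A(1) finite_subset by blast
  qed auto
  then have *: "Act = incident m b (cvec ?x) \<and> cvec ?x \<in> contrib m b r"
    using critical_coefficients[OF orthantD(2)[OF xo] ActS] by blast
  then show "cvec ?x \<in> contrib m b r" by simp
  show "incident m b (cvec ?x) \<inter> K = T" using * TAct T by (auto simp: Act_def)
qed

text \<open>
  Conversely, positive multipliers make a point the minimiser over the half spaces of the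
  hyperplanes through it, by the tangent inequality.
\<close>

lemma contrib_is_lowest:
  assumes "cvec x \<in> contrib m b r" "x \<in> closure (cell m b x0)"
  shows "far_side (incident m b (cvec x) \<inter> K)" "lowest (incident m b (cvec x) \<inter> K) = x"
proof -
  let ?T = "incident m b (cvec x) \<inter> K"
  have "cvec x \<in> cstar" using assms(1) by (auto simp: contrib_def Omega_def critical_point_def)
  then have ne: "x $ i \<noteq> 0" for i by (auto simp: cstar_def cvec_def)
  have "(\<chi> i. complex_of_real (r $ i) / cvec x $ i) = cvec (descent x)"
    by (simp add: cvec_def descent_def vec_eq_iff)
  then have "descent x \<in> normal_cone m b (cvec x)"
    using assms(1) by (auto simp: contrib_def)
  then obtain a where a: "descent x = (\<Sum>j\<in>incident m b (cvec x). a j *\<^sub>R b j)"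
    "\<And>j. j \<in> incident m b (cvec x) \<Longrightarrow> 0 < a j" by (auto simp: normal_cone_def)
  have xo: "x \<in> orthant N"
    using closure_cell_sides(3,4)[OF assms(2)] ne by (auto simp: orthant_def less_le)
  have inc: "b j \<bullet> x = 1" "j \<in> P \<union> ?T" if "j \<in> incident m b (cvec x)" for j
    using that by (auto simp: incident_cvec)
  have "minimises (region ?T) x"
    unfolding minimises_def
  proof (intro conjI ballI)
    show "x \<in> region ?T"
      using xo closure_cell_sides(2)[OF assms(2)] inc(1) L_bounds(2)[OF assms(2)]
      by (auto simp: region_def less_imp_le)
    fix y assume y: "y \<in> region ?T"
    have "descent x \<bullet> (y - x) = (\<Sum>j\<in>incident m b (cvec x). a j * (b j \<bullet> y - 1))"
      unfolding a(1) inner_sum_left using inc(1) by (intro sum.cong) (auto simp: inner_diff_right right_diff_distrib)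
    also have "\<dots> \<le> 0"
      using y a(2) inc(2) by (intro sum_nonpos mult_nonneg_nonpos) (auto simp: region_def less_imp_le)
    finally show "real_height x \<le> real_height y"
      using real_height_gradient(1)[OF xo, of y] y region_subset by fastforce
  qed
  then show lo: "lowest ?T = x" using K_facts(2) by (intro lowest_eqI) auto
  show "far_side ?T" unfolding far_side_def lo using closure_cell_sides(1)[OF assms(2)] by blast
qed

theorem signed_contrib_count:
  "(\<Sum>\<sigma> | \<sigma> \<in> contrib m b r \<and> \<sigma> \<in> cvec ` closure (cell m b x0). (-1) ^ card (incident m b \<sigma> \<inter> K))
     = (if K = {} then 1 else (0::int))"
  unfolding signed_sum_far_side[symmetric]
proof (rule sum.reindex_bij_witness[where i = "\<lambda>T. cvec (lowest T)" and j = "\<lambda>\<sigma>. incident m b \<sigma> \<inter> K"])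
  fix \<sigma> assume "\<sigma> \<in> {\<sigma>. \<sigma> \<in> contrib m b r \<and> \<sigma> \<in> cvec ` closure (cell m b x0)}"
  then obtain x where x: "\<sigma> = cvec x" "cvec x \<in> contrib m b r" "x \<in> closure (cell m b x0)" by auto
  show "cvec (lowest (incident m b \<sigma> \<inter> K)) = \<sigma>" "incident m b \<sigma> \<inter> K \<in> {T. T \<subseteq> K \<and> far_side T}"
    using contrib_is_lowest[OF x(2,3)] x(1) by auto
next
  fix T assume "T \<in> {T. T \<subseteq> K \<and> far_side T}"
  then show "incident m b (cvec (lowest T)) \<inter> K = T"
    "cvec (lowest T) \<in> {\<sigma>. \<sigma> \<in> contrib m b r \<and> \<sigma> \<in> cvec ` closure (cell m b x0)}"
    using far_side_contributes[of T] by auto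
qed simp

end

section \<open>Products of classes and sums of chains\<close>

context
  fixes m :: nat and b :: "nat \<Rightarrow> real ^ 'd::finite" and r :: "real ^ 'd::finite" and a :: real
begin

abbreviation relcycle :: "(complex, 'd) vec chain \<Rightarrow> bool" where
  "relcycle \<equiv> singular_relcycle CARD('d) (top_of_set (mfd m b)) (mfd_le m b r a)"

lemma comm_group_hgroup: "comm_group (hgroup m b r a)"
  unfolding hgroup_def by (rule abelian_relative_homology_group)

lemma hclass_closed: "relcycle c \<Longrightarrow> hclass m b r a c \<in> carrier (hgroup m b r a)"
  unfolding hgroup_def hclass_def carrier_relative_homology_group by blast

text \<open>
  The class map is the quotient map from relative cycles.
\<close>

lemma hclass_add:
  assumes "relcycle c" "relcycle c'"
  shows "hclass m b r a (c + c') = hclass m b r a c \<otimes>\<^bsub>hgroup m b r a\<^esub> hclass m b r a c'"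
proof -
  let ?R = "relcycle_group CARD('d) (top_of_set (mfd m b)) (mfd_le m b r a)"
  let ?B = "singular_relboundary_set CARD('d) (top_of_set (mfd m b)) (mfd_le m b r a)"
  have "(\<lambda>c. ?B #>\<^bsub>?R\<^esub> c) \<in> hom ?R (?R Mod ?B)"
    by (rule normal.r_coset_hom_Mod[OF normal_subgroup_singular_relboundary_relcycle])
  moreover have "(\<lambda>c. ?B #>\<^bsub>?R\<^esub> c) = hclass m b r a"
    by (simp add: right_coset_singular_relboundary hclass_def fun_eq_iff)
  moreover have "?R Mod ?B = hgroup m b r a"
    by (simp add: hgroup_def nontrivial_relative_homology_group)
  ultimately have "hclass m b r a \<in> hom ?R (hgroup m b r a)" by simp
  from hom_mult[OF this, of c c'] assms show ?thesis by simp
qed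

lemma hclass_0: "hclass m b r a 0 = \<one>\<^bsub>hgroup m b r a\<^esub>"
  using homologous_rel_set_eq_relboundary[of "CARD('d)" "top_of_set (mfd m b)" "mfd_le m b r a" 0]
  by (simp add: hclass_def hgroup_def)

lemma hclass_int_pow:
  assumes c: "relcycle c"
  shows "hclass m b r a c [^]\<^bsub>hgroup m b r a\<^esub> (k::int) = hclass m b r a (frag_cmul k c)"
proof -
  interpret G: comm_group "hgroup m b r a" by (rule comm_group_hgroup)
  have nat: "hclass m b r a c [^]\<^bsub>hgroup m b r a\<^esub> n = hclass m b r a (frag_cmul (int n) c)" for n
  proof (induction n)
    case 0
    then show ?case by (simp add: hclass_0)
  next
    case (Suc n)
    have "frag_cmul (int (Suc n)) c = frag_cmul (int n) c + c"
      using frag_cmul_distrib[of "int n" 1 c] by (simp add: add.commute)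
    then show ?case using Suc hclass_add[OF singular_relcycle_cmul[OF c] c] by simp
  qed
  show ?thesis
  proof (cases k rule: int_cases2)
    case (nonneg n)
    then show ?thesis by (simp add: int_pow_int nat)
  next
    case (nonpos n)
    let ?c = "frag_cmul (int n) c" and ?d = "frag_cmul (- int n) c"
    have cd: "relcycle ?c" "relcycle ?d" using c by (auto intro: singular_relcycle_cmul)
    have "hclass m b r a ?d \<otimes>\<^bsub>hgroup m b r a\<^esub> hclass m b r a ?c = hclass m b r a (?d + ?c)"
      by (rule hclass_add[OF cd(2,1), symmetric])
    also have "?d + ?c = 0" using frag_cmul_distrib[of "- int n" "int n" c] by simp
    finally have "inv\<^bsub>hgroup m b r a\<^esub> (hclass m b r a ?c) = hclass m b r a ?d"
      using cd by (intro G.inv_equality) (auto simp: hclass_0 hclass_closed)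
    then show ?thesis
      using nonpos by (simp add: G.int_pow_neg_int[OF hclass_closed[OF c]] nat del: minus_frag_cmul)
  qed
qed

lemma hclass_finprod:
  assumes "finite I" "\<And>i. i \<in> I \<Longrightarrow> relcycle (f i)"
  shows "(\<Otimes>\<^bsub>hgroup m b r a\<^esub>i\<in>I. hclass m b r a (f i)) = hclass m b r a (\<Sum>i\<in>I. f i)"
proof -
  interpret G: comm_group "hgroup m b r a" by (rule comm_group_hgroup)
  show ?thesis
    using assms
  proof (induction I)
    case empty
    then show ?case by (simp add: hclass_0)
  next
    case (insert i I)
    then show ?case
      by (subst G.finprod_insert) (auto simp: hclass_add hclass_closed singular_relcycle_sum Pi_iff)
  qed
qed

end

section \<open>Signs of cells\<close>

lemma prod_signs:
  assumes "finite I" "\<And>i. i \<in> I \<Longrightarrow> f i \<noteq> (0::real)"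
  shows "\<lfloor>sgn (\<Prod>i\<in>I. f i)\<rfloor> = (-1) ^ card {i \<in> I. f i < 0}"
proof -
  have "sgn (\<Prod>i\<in>I. f i) = (\<Prod>i\<in>I. sgn (f i))"
    using assms(1) by (induction I) (auto simp: sgn_mult)
  also have "\<dots> = (\<Prod>i\<in>I. if f i < 0 then -1 else 1)"
    using assms(2) by (intro prod.cong) (auto simp: sgn_if)
  also have "\<dots> = (\<Prod>i\<in>{i \<in> I. f i < 0}. -1)"
    by (rule prod.inter_filter[OF assms(1), symmetric])
  also have "\<dots> = of_int ((-1) ^ card {i \<in> I. f i < 0})" by simp
  finally show ?thesis by (simp only: floor_of_int)
qed

text \<open>
  The point of a cell that the signs and the fiber class of a component refer to.
\<close>

definition base :: "(real, 'd) vec set \<Rightarrow> (real, 'd) vec" where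
  "base B = (SOME x. x \<in> B)"

lemma sgn_comp_base:
  assumes "base B \<in> mfd_real m b"
  shows "sgn_comp B = (-1) ^ card (neg_coords (base B))"
  unfolding sgn_comp_def Let_def base_def[symmetric] neg_coords_def
  using assms by (subst prod_signs) (auto simp: mfd_real_iff)

lemma sgn_comp_at_base:
  assumes "base B \<in> mfd_real m b"
  shows "sgn_comp_at m b \<sigma> B = (-1) ^ card (incident m b \<sigma> \<inter> beyond m b (base B))"
proof -
  have "{k \<in> incident m b \<sigma>. Re (ell (b k) (cvec (base B))) < 0} = incident m b \<sigma> \<inter> beyond m b (base B)"
    by (auto simp: incident_def beyond_def ell_cvec)
  then show ?thesis
    unfolding sgn_comp_at_def Let_def base_def[symmetric]
    using assms by (subst prod_signs) (auto simp: mfd_real_iff ell_cvec incident_def)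
qed

section \<open>The torus as a sum of linking tori\<close>

context simple_generic
begin

text \<open>
  The real points of the torus with all coordinates \<open>\<plusminus>\<epsilon>\<close>, one in each cell at the origin.
\<close>

definition corner :: "real \<Rightarrow> 'd set \<Rightarrow> (real, 'd) vec" where
  "corner \<epsilon> N = (\<chi> k. if k \<in> N then - \<epsilon> else \<epsilon>)"

text \<open>
  The condition makes \<open>\<bar>b\<^sub>k \<bullet> x\<bar> < 1\<close> on the cube \<open>\<bar>x\<^sub>i\<bar> \<le> \<epsilon>\<close>, so no hyperplane meets it.
\<close>

definition small :: "real \<Rightarrow> bool" where
  "small \<epsilon> \<longleftrightarrow> 0 < \<epsilon> \<and> (\<forall>k\<in>{1..m}. \<epsilon> * (\<Sum>i\<in>UNIV. \<bar>b k $ i\<bar>) < 1)"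

lemma eventually_small: "\<forall>\<^sub>F \<epsilon> in at_right 0. small \<epsilon>"
proof -
  have "\<forall>\<^sub>F \<epsilon> in at_right 0. \<epsilon> * (\<Sum>i\<in>UNIV. \<bar>b k $ i\<bar>) < 1" for k
  proof -
    have "((\<lambda>\<epsilon>. \<epsilon> * (\<Sum>i\<in>UNIV. \<bar>b k $ i\<bar>)) \<longlongrightarrow> 0 * (\<Sum>i\<in>UNIV. \<bar>b k $ i\<bar>)) (at_right 0)"
      by (intro tendsto_intros)
    then show ?thesis by (intro order_tendstoD(2)[of _ 0]) auto
  qed
  then have "\<forall>\<^sub>F \<epsilon> in at_right 0. \<forall>k\<in>{1..m}. \<epsilon> * (\<Sum>i\<in>UNIV. \<bar>b k $ i\<bar>) < 1"
    by (intro eventually_ball_finite) auto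
  with eventually_at_right_less[of 0] show ?thesis
    unfolding small_def by eventually_elim auto
qed

lemma small_inner:
  assumes "small \<epsilon>" "k \<in> {1..m}" "\<And>i. \<bar>x $ i\<bar> \<le> \<epsilon>"
  shows "b k \<bullet> x < 1"
proof -
  have "b k \<bullet> x \<le> (\<Sum>i\<in>UNIV. \<bar>b k $ i\<bar> * \<epsilon>)"
    unfolding inner_vec_def
  proof (rule sum_mono)
    fix i
    have "b k $ i \<bullet> x $ i \<le> \<bar>b k $ i\<bar> * \<bar>x $ i\<bar>" by (simp add: abs_mult[symmetric])
    also have "\<dots> \<le> \<bar>b k $ i\<bar> * \<epsilon>" using assms(3) by (intro mult_left_mono) auto
    finally show "b k $ i \<bullet> x $ i \<le> \<bar>b k $ i\<bar> * \<epsilon>" .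
  qed
  also have "\<dots> = \<epsilon> * (\<Sum>i\<in>UNIV. \<bar>b k $ i\<bar>)" by (simp add: sum_distrib_left mult.commute)
  also have "\<dots> < 1" using assms(1,2) unfolding small_def by blast
  finally show ?thesis .
qed

lemma corner_cell:
  assumes "small \<epsilon>"
  shows "corner \<epsilon> N \<in> mfd_real m b" "neg_coords (corner \<epsilon> N) = N" "beyond m b (corner \<epsilon> N) = {}"
proof -
  have eps: "0 < \<epsilon>" using assms by (simp add: small_def)
  have "b k \<bullet> corner \<epsilon> N < 1" if "k \<in> {1..m}" for k
    using eps by (intro small_inner[OF assms that]) (auto simp: corner_def)
  then show "corner \<epsilon> N \<in> mfd_real m b" "beyond m b (corner \<epsilon> N) = {}"
    using eps by (auto simp: mfd_real_iff beyond_def corner_def less_imp_neq less_not_sym)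
  show "neg_coords (corner \<epsilon> N) = N"
    using eps by (auto simp: neg_coords_def corner_def)
qed

lemma strip_pair_far:
  assumes "small \<epsilon>"
  shows "\<exists>R0. \<forall>R\<ge>R0. strip_pair (mfd m b) (mfd_le m b r a) \<epsilon> R"
proof -
  have eps: "0 < \<epsilon>" using assms by (simp add: small_def)
  from far_points_are_low[OF eps] obtain R0 where R0: "0 < R0"
    "\<And>z k. (\<And>k. \<epsilon> \<le> cmod (z $ k)) \<Longrightarrow> R0 \<le> cmod (z $ k) \<Longrightarrow> height r z \<le> a" by meson
  have in_mfd: "z \<in> mfd m b" if "\<And>k. z $ k \<in> strip \<epsilon>" for z
  proof (rule mfd_if_real_part)
    show "z $ i \<noteq> 0" for i using that[of i] eps by (auto simp: strip_def)
    show "b k \<bullet> (\<chi> i. Re (z $ i)) \<noteq> 1" if "k \<in> {1..m}" for k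
      using small_inner[OF assms that, of "\<chi> i. Re (z $ i)"] \<open>\<And>k. z $ k \<in> strip \<epsilon>\<close>
      by (force simp: strip_def)
  qed
  have "strip_pair (mfd m b) (mfd_le m b r a) \<epsilon> R" if R: "R \<ge> max R0 \<epsilon>" for R
  proof
    show "z \<in> mfd m b" if "\<And>k. z $ k \<in> strip \<epsilon>" for z using in_mfd that by blast
    show "z \<in> mfd_le m b r a" if z: "\<And>k. z $ k \<in> strip \<epsilon>" "z $ k \<in> strip_ends R" for z k
    proof -
      have "R0 \<le> cmod (z $ k)"
        using z(2) R abs_Im_le_cmod[of "z $ k"] by (simp add: strip_ends_def)
      then show ?thesis
        using R0(2)[of z k] z(1) in_mfd[OF z(1)] by (simp add: mfd_le_def strip_def)
    qed
  qed (use eps R in auto)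
  then show ?thesis by blast
qed

lemma base_component:
  assumes "B \<in> components (mfd_real m b)"
  shows "base B \<in> mfd_real m b" "B = cell m b (base B)"
  using component_SOME[OF assms] by (simp_all add: base_def)

text \<open>
  The cells at the origin are those that no hyperplane separates from it; each contains exactly
  one corner.
\<close>

lemma sum_over_corners:
  assumes "small \<epsilon>"
  shows "(\<Sum>N\<in>UNIV. frag_cmul ((-1) ^ card N) (f (cell m b (corner \<epsilon> N))))
       = (\<Sum>B | B \<in> components (mfd_real m b) \<and> beyond m b (base B) = {}. frag_cmul (sgn_comp B) (f B))"
proof (rule sum.reindex_bij_witness[where i = "\<lambda>B. neg_coords (base B)" and j = "\<lambda>N. cell m b (corner \<epsilon> N)"])
  fix N :: "'d set"
  let ?B = "cell m b (corner \<epsilon> N)"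
  have comp: "?B \<in> components (mfd_real m b)"
    using corner_cell(1)[OF assms] by (auto simp: components_mfd_real)
  have "base ?B \<in> ?B" using base_component[OF comp] cell_self by metis
  then have nb: "neg_coords (base ?B) = N" "beyond m b (base ?B) = {}"
    using corner_cell(2,3)[OF assms, of N] by (auto simp: cell_def)
  show "neg_coords (base ?B) = N" "?B \<in> {B. B \<in> components (mfd_real m b) \<and> beyond m b (base B) = {}}"
    using comp nb by auto
  show "frag_cmul (sgn_comp ?B) (f ?B) = frag_cmul ((-1) ^ card N) (f ?B)"
    using sgn_comp_base[OF base_component(1)[OF comp]] nb by simp
next
  fix B assume "B \<in> {B. B \<in> components (mfd_real m b) \<and> beyond m b (base B) = {}}"
  then have B: "B \<in> components (mfd_real m b)" "beyond m b (base B) = {}" by auto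
  let ?c = "corner \<epsilon> (neg_coords (base B))"
  have "base B \<in> cell m b ?c"
    using base_component[OF B(1)] B(2) corner_cell[OF assms, of "neg_coords (base B)"] by (auto simp: cell_def)
  then show "cell m b ?c = B" using cell_eq base_component(2)[OF B(1)] by metis
qed auto

text \<open>
  The identity of \<open>signed_contrib_count\<close> in terms of the signs of the linking tori.
\<close>

lemma coefficient_bounded:
  assumes B: "B \<in> components (mfd_real m b)" "bounded B"
  shows "(\<Sum>\<sigma> | \<sigma> \<in> contrib m b r \<and> \<sigma> \<in> cvec ` closure B. sgn_comp_at m b \<sigma> B)
       = (if beyond m b (base B) = {} then 1 else 0)"
proof -
  note base = base_component[OF B(1)]
  interpret bounded_cell r m b "base B"
    using base B(2) by unfold_locales auto
  show ?thesis
    unfolding sgn_comp_at_base[OF base(1)] using signed_contrib_count base(2) by simp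
qed

text \<open>
  Both sides are combinations of fibers over the base points of the cells, truncated at a common
  large \<open>R\<close>. Their coefficients agree on bounded cells, and the fibers over unbounded cells are null.
\<close>

lemma torus_class:
  assumes small: "small \<epsilon>"
  shows "hclass m b r a (torus_chain \<epsilon>) = (\<Otimes>\<^bsub>hgroup m b r a\<^esub>\<sigma>\<in>contrib m b r. linking_torus m b r a \<sigma>)"
proof -
  let ?C = "components (mfd_real m b)" and ?G = "hgroup m b r a"
  let ?near = "{B. B \<in> ?C \<and> beyond m b (base B) = {}}"
  let ?hom = "homologous_rel CARD('d) (top_of_set (mfd m b)) (mfd_le m b r a)"
  have finC: "finite ?C" by (rule finite_components_mfd_real)
  have ev1: "\<forall>\<^sub>F R in at_top. \<forall>B\<in>?C. component_class m b r a B = hclass m b r a (fiber_chain (base B) R)"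
    using fiber_class_eq[OF base_component(1)] finC
    by (intro eventually_ball_finite ballI) (auto simp: eventually_at_top_linorder component_class_def base_def)
  have ev2: "\<forall>\<^sub>F R in at_top. \<forall>B\<in>?C. relcycle m b r a (fiber_chain (base B) R)"
    using fiber_relcycle[OF base_component(1)] finC
    by (intro eventually_ball_finite ballI) (auto simp: eventually_at_top_linorder)
  have ev3: "\<forall>\<^sub>F R in at_top. \<forall>B\<in>?C. \<not> bounded B \<longrightarrow> ?hom (fiber_chain (base B) R) 0"
  proof (intro eventually_ball_finite ballI finC)
    fix B assume B: "B \<in> ?C"
    show "\<forall>\<^sub>F R in at_top. \<not> bounded B \<longrightarrow> ?hom (fiber_chain (base B) R) 0"
    proof (cases "bounded B")
      case False
      then show ?thesis
        using fiber_unbounded_cell_null[OF base_component(1)[OF B], of a] base_component(2)[OF B]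
        by (simp add: eventually_at_top_linorder homologous_rel_0_iff)
    qed simp
  qed
  have ev4: "\<forall>\<^sub>F R in at_top. \<forall>N\<in>UNIV. ?hom (fiber_chain (corner \<epsilon> N) R) (fiber_chain (base (cell m b (corner \<epsilon> N))) R)"
  proof (intro eventually_ball_finite ballI)
    fix N :: "'d set"
    let ?B = "cell m b (corner \<epsilon> N)"
    have "?B \<in> ?C" using corner_cell(1)[OF small] by (auto simp: components_mfd_real)
    then have "base ?B \<in> ?B" using base_component cell_self by metis
    from fiber_homologous[OF corner_cell(1)[OF small] this, of a]
    show "\<forall>\<^sub>F R in at_top. ?hom (fiber_chain (corner \<epsilon> N) R) (fiber_chain (base ?B) R)"
      unfolding eventually_at_top_linorder by blast
  qed simp
  have ev5: "\<forall>\<^sub>F R in at_top. strip_pair (mfd m b) (mfd_le m b r a) \<epsilon> R"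
    using strip_pair_far[OF small] by (simp add: eventually_at_top_linorder)
  obtain R where R1: "\<And>B. B \<in> ?C \<Longrightarrow> component_class m b r a B = hclass m b r a (fiber_chain (base B) R)"
    and R2: "\<And>B. B \<in> ?C \<Longrightarrow> relcycle m b r a (fiber_chain (base B) R)"
    and R3: "\<And>B. B \<in> ?C \<Longrightarrow> \<not> bounded B \<Longrightarrow> ?hom (fiber_chain (base B) R) 0"
    and R4: "\<And>N. ?hom (fiber_chain (corner \<epsilon> N) R) (fiber_chain (base (cell m b (corner \<epsilon> N))) R)"
    and R5: "strip_pair (mfd m b) (mfd_le m b r a) \<epsilon> R"
    using eventually_happens'[OF _ eventually_conj[OF ev1 eventually_conj[OF ev2 eventually_conj[OF ev3 eventually_conj[OF ev4 ev5]]]]]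
    by auto
  define f where "f = (\<lambda>B :: (real, 'd) vec set. fiber_chain (base B) R)"
  define q where "q = (\<lambda>B :: (real, 'd) vec set. \<Sum>\<sigma> | \<sigma> \<in> contrib m b r \<and> \<sigma> \<in> cvec ` closure B. sgn_comp_at m b \<sigma> B)"
  let ?at = "\<lambda>\<sigma>. {B \<in> ?C. \<sigma> \<in> cvec ` closure B}"
  \<comment> \<open>the product of the linking tori is the class of a combination of fibers\<close>
  have "(\<Otimes>\<^bsub>?G\<^esub>\<sigma>\<in>contrib m b r. linking_torus m b r a \<sigma>)
      = (\<Otimes>\<^bsub>?G\<^esub>\<sigma>\<in>contrib m b r. hclass m b r a (\<Sum>B\<in>?at \<sigma>. frag_cmul (sgn_comp B * sgn_comp_at m b \<sigma> B) (f B)))"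
  proof -
    interpret G: comm_group ?G by (rule comm_group_hgroup)
    have rc: "relcycle m b r a (frag_cmul k (f B))" if "B \<in> ?C" for k B
      using R2[OF that] by (simp add: f_def singular_relcycle_cmul)
    have "linking_torus m b r a \<sigma> = hclass m b r a (\<Sum>B\<in>?at \<sigma>. frag_cmul (sgn_comp B * sgn_comp_at m b \<sigma> B) (f B))" for \<sigma>
    proof -
      have "linking_torus m b r a \<sigma>
          = (\<Otimes>\<^bsub>?G\<^esub>B\<in>?at \<sigma>. hclass m b r a (frag_cmul (sgn_comp B * sgn_comp_at m b \<sigma> B) (f B)))"
        unfolding linking_torus_def
        by (intro G.finprod_cong') (use R1 R2 rc in \<open>auto simp: hclass_int_pow f_def hclass_closed\<close>)
      also have "\<dots> = hclass m b r a (\<Sum>B\<in>?at \<sigma>. frag_cmul (sgn_comp B * sgn_comp_at m b \<sigma> B) (f B))"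
        using finC rc by (intro hclass_finprod) auto
      finally show ?thesis .
    qed
    then show ?thesis by simp
  qed
  also have "\<dots> = hclass m b r a (\<Sum>\<sigma>\<in>contrib m b r. \<Sum>B\<in>?at \<sigma>. frag_cmul (sgn_comp B * sgn_comp_at m b \<sigma> B) (f B))"
    using finite_contrib R2 by (intro hclass_finprod singular_relcycle_sum singular_relcycle_cmul) (auto simp: f_def)
  also have "(\<Sum>\<sigma>\<in>contrib m b r. \<Sum>B\<in>?at \<sigma>. frag_cmul (sgn_comp B * sgn_comp_at m b \<sigma> B) (f B))
      = (\<Sum>B\<in>?C. frag_cmul (sgn_comp B * q B) (f B))"
  proof -
    have frag_sum: "(\<Sum>\<sigma>\<in>I. frag_cmul (k * g \<sigma>) c) = frag_cmul (k * sum g I) c" for I k c and g :: "'z \<Rightarrow> int"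
      by (induction I rule: infinite_finite_induct) (auto simp: distrib_left frag_cmul_distrib)
    show ?thesis
      unfolding q_def frag_sum[symmetric]
      by (rule sum.swap_restrict[OF finite_contrib finC])
  qed
  finally have tori: "(\<Otimes>\<^bsub>?G\<^esub>\<sigma>\<in>contrib m b r. linking_torus m b r a \<sigma>)
      = hclass m b r a (\<Sum>B\<in>?C. frag_cmul (sgn_comp B * q B) (f B))" .
  \<comment> \<open>only the cells at the origin survive\<close>
  have "?hom (\<Sum>B\<in>?C. frag_cmul (sgn_comp B * q B) (f B)) (\<Sum>B\<in>?C. if B \<in> ?near then frag_cmul (sgn_comp B) (f B) else 0)"
  proof (rule homologous_rel_sum)
    fix B assume B: "B \<in> ?C"
    show "?hom (frag_cmul (sgn_comp B * q B) (f B)) (if B \<in> ?near then frag_cmul (sgn_comp B) (f B) else 0)"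
    proof (cases "bounded B")
      case True
      then show ?thesis using coefficient_bounded[OF B] B by (simp add: q_def)
    next
      case False
      have null: "?hom (frag_cmul k (f B)) 0" for k
        using homologous_rel_cmul[OF R3[OF B False], of k] by (simp add: f_def)
      have "?hom 0 (frag_cmul k (f B))" for k
        using null homologous_rel_sym by blast
      then show ?thesis
        using null by (auto intro: homologous_rel_trans)
    qed
  qed (use finC in auto)
  also have "(\<Sum>B\<in>?C. if B \<in> ?near then frag_cmul (sgn_comp B) (f B) else 0) = (\<Sum>B\<in>?near. frag_cmul (sgn_comp B) (f B))"
    using finC by (simp add: sum.inter_filter[symmetric])
  also have "\<dots> = (\<Sum>N\<in>UNIV. frag_cmul ((-1) ^ card N) (f (cell m b (corner \<epsilon> N))))"
    by (rule sum_over_corners[OF small, symmetric])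
  finally have near: "?hom (\<Sum>B\<in>?C. frag_cmul (sgn_comp B * q B) (f B))
      (\<Sum>N\<in>UNIV. frag_cmul ((-1) ^ card N) (f (cell m b (corner \<epsilon> N))))" .
  have "?hom (torus_chain \<epsilon>) (\<Sum>N\<in>UNIV. frag_cmul ((-1) ^ card N) (fiber_chain (corner \<epsilon> N) R))"
    using strip_pair.torus_as_fibers[OF R5] by (simp add: corner_def)
  moreover have "?hom (\<Sum>N\<in>UNIV. frag_cmul ((-1) ^ card N) (fiber_chain (corner \<epsilon> N) R))
      (\<Sum>N\<in>UNIV. frag_cmul ((-1) ^ card N) (f (cell m b (corner \<epsilon> N))))"
    by (rule homologous_rel_sum) (auto simp: f_def intro: homologous_rel_cmul[OF R4])
  ultimately have "?hom (torus_chain \<epsilon>) (\<Sum>B\<in>?C. frag_cmul (sgn_comp B * q B) (f B))"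
    using near by (meson homologous_rel_sym homologous_rel_trans)
  then show ?thesis unfolding tori unfolding hclass_def homologous_rel_set_eq .
qed

end

theorem theorem3p13:
  fixes m :: nat
    and b :: "nat \<Rightarrow> real ^ 'd::{finite,linorder}"
    and p :: "nat \<Rightarrow> nat"
    and F G :: "complex ^ 'd::{finite,linorder} \<Rightarrow> complex"
    and r :: "real ^ 'd::{finite,linorder}"
  assumes "\<forall>j\<in>{1..m}. b j \<noteq> 0"
    and "inj_on (\<lambda>j. ell (b j)) {1..m}"
    and "\<forall>j\<in>{1..m}. 1 \<le> p j"
    and "entire G"
    and "\<forall>j\<in>{1..m}. \<exists>z. ell (b j) z = 0 \<and> G z \<noteq> 0"
    and "F = (\<lambda>z. G z / (\<Prod>j=1..m. ell (b j) z ^ p j))"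
    and "\<forall>i. 0 < r $ i"
    and "(\<Sum>i\<in>UNIV. r $ i) = 1"
    and "simple_arrangement m b"
    and "generic_direction m b r"
  shows "\<forall>\<^sub>F \<epsilon> in at_right 0. \<forall>a. below_critical m b r a \<longrightarrow>
           hclass m b r a (torus_chain \<epsilon>) =
             (\<Otimes>\<^bsub>hgroup m b r a\<^esub>\<sigma>\<in>contrib m b r. linking_torus m b r a \<sigma>)"
proof -
  interpret simple_generic r m b
    using assms by unfold_locales auto
  show ?thesis
    using eventually_small by (rule eventually_mono) (simp add: torus_class)
qed

end
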